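(* Let $\mathcal{X}=(\boldsymbol{x}_j)_{j=1}^\infty$ be a semi-normalized Schauder basis of a quasi-Banach space $\mathbb{X}$, let $\mathbb{S}$ be a locally convex subsymmetric sequence space, and let $\sigma=(\sigma_n)_{n=1}^\infty$ be an ordered partition of $\mathbb{N}$. Put $N_n=|\sigma_n|$ and $M_r=\sum_{n=1}^rN_n$. Assume that $\Lambda[\mathbb{S}]=(\Lambda_m[\mathbb{S}])_{m=1}^\infty$ has both the LRP and the URP, and that $M_r\lesssim N_{r+1}$ for $r\in\mathbb{N}$. Then the unit vector system is an almost greedy basis of $\mathbb{Y}[\mathcal{X},\mathbb{S},\sigma]$ with fundamental function equivalent to $\Lambda[\mathbb{S}]$.
   Context: $\mathbb{F}$ is $\mathbb{R}$ or $\mathbb{C}$; $\mathbb{E}$ is the set of scalars of modulus 1; $a_r\lesssim b_r$ means $a_r\le Cb_r$ for a constant $C$. $(\boldsymbol{x}_j)$ is semi-normalized if $0<\inf_j\|\boldsymbol{x}_j\|\le\sup_j\|\boldsymbol{x}_j\|<\infty$. $(\boldsymbol{e}_n)$ is the unit vector system of $\mathbb{F}^{\mathbb{N}}$, and $c_{00}$ is its linear span. A locally convex subsymmetric sequence space is a Banach space $\mathbb{S}\subseteq\mathbb{F}^{\mathbb{N}}$ with $(\boldsymbol{e}_n)$ as a Schauder basis and $\|\sum_n\varepsilon_na_n\boldsymbol{e}_{\phi(n)}\|=\|f\|$ for all $f=\sum_na_n\boldsymbol{e}_n\in\mathbb{S}$, $(\varepsilon_n)\in\mathbb{E}^{\mathbb{N}}$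 and increasing $\phi\colon\mathbb{N}\to\mathbb{N}$. $\Lambda_m=\Lambda_m[\mathbb{S}]=\|\sum_{n\in A}\boldsymbol{e}_n\|_{\mathbb{S}}$ for any $|A|=m$. A sequence $(\Gamma_m)$ in $(0,\infty)$ has the LRP if there is $b\in\mathbb{N}$ with $2\Gamma_m\le\Gamma_{bm}$ for all $m$; it has the URP if there is $b\in\mathbb{N}$ with $2\Gamma_{bm}\le b\Gamma_m$ for all $m$. An ordered partition is a sequence $(\sigma_n)$ of disjoint (finite, nonempty) subsets of $\mathbb{N}$ with union $\mathbb{N}$ and $\max\sigma_n<\min\sigma_{n+1}$. For $f=(a_j)_j\in\mathbb{F}^{\mathbb{N}}$ put $\boldsymbol{v}_n^*(f)=\frac{\Lambda_{N_n}}{N_n}\sum_{j\in\sigma_n}a_j$; let $P_\sigma(f)$ be the sequence equal on each $\sigma_n$ to the constant $\frac1{N_n}\sum_{j\in\sigma_n}a_j$, and $Q_\sigma=\mathrm{Id}-P_\sigma$. The space $\mathbb{Y}[\mathcal{X},\mathbb{S},\sigma]$ is the completion (a sequence space) of $c_{00}$ under the quasi-norm $\|f\|_{\mathcal{X},\mathbb{S},\sigma}=\|Q_\sigma(f)\|_{\mathbb{S}}+\|\sum_{n=1}^\infty\boldsymbol{v}_n^*(f)\boldsymbol{x}_n\|_{\mathbb{X}}$. For a Schauder basis $\mathcal{Y}=(\boldsymbol{y}_n)$ of $\mathbb{Y}$ with coordinate functionals $(\boldsymbol{y}_n^* )$: $S_A(f)=\sum_{n\in A}\boldsymbol{y}_n^*(f)\boldsymbol{y}_n$;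 a finite $A$ is a greedy set of $f$ if $|\boldsymbol{y}_k^*(f)|\le|\boldsymbol{y}_j^*(f)|$ for $j\in A$, $k\notin A$; $\mathcal{Y}$ is almost greedy if there is $C$ with $\|f-S_A(f)\|\le C\|f-S_B(f)\|$ for all $f$, all greedy sets $A$ of $f$ and all $B$ with $|B|\le|A|$ (equivalently, quasi-greedy and democratic). Its fundamental function is $m\mapsto\sup\{\|\sum_{n\in A}\varepsilon_n\boldsymbol{y}_n\|\colon|A|\le m,\ \varepsilon\in\mathbb{E}^A\}$. *)

theory Defs
  imports "HOL-Analysis.Analysis" "HOL-Library.Function_Algebras"
begin

text \<open>
  The scalar field is a type \<open>'k\<close> of sort \<open>{real_normed_field, banach}\<close>. The instances include
  \<open>real\<close> and \<open>complex\<close>, and by the theorem of Gelfand and Mazur every instance is isometrically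
  isomorphic to one of these two. Sequences are indexed from 0, and \<open>HOL-Library.Function_Algebras\<close>
  supplies the pointwise group structure on \<open>nat \<Rightarrow> 'k\<close>.
\<close>

section \<open>Quasi-Banach spaces and Schauder bases\<close>

text \<open>
  Spaces are linear subspaces \<open>V\<close> of an ambient vector space; the values of \<open>q\<close> outside \<open>V\<close> are
  irrelevant. A quasi-norm need not be continuous with respect to the topology it defines.
\<close>

locale quasi_normed_space = vector_space smul
  for smul :: "'k::{real_normed_field, banach} \<Rightarrow> 'v::ab_group_add \<Rightarrow> 'v" +
  fixes V :: "'v set" and q :: "'v \<Rightarrow> real"
  assumes subspace_V: "subspace V"
    and q_nonneg: "f \<in> V \<Longrightarrow> 0 \<le> q f"
    and q_eq_0_iff: "f \<in> V \<Longrightarrow> q f = 0 \<longleftrightarrow> f = 0"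
    and q_scale: "f \<in> V \<Longrightarrow> q (smul c f) = norm c * q f"
    and q_quasi_triangle: "\<exists>\<kappa>. \<forall>f\<in>V. \<forall>g\<in>V. q (f + g) \<le> \<kappa> * (q f + q g)"

definition qlim :: "('v::ab_group_add \<Rightarrow> real) \<Rightarrow> (nat \<Rightarrow> 'v) \<Rightarrow> 'v \<Rightarrow> bool" where
  "qlim q u l \<longleftrightarrow> (\<lambda>n. q (u n - l)) \<longlonglongrightarrow> 0"

definition qCauchy :: "('v::ab_group_add \<Rightarrow> real) \<Rightarrow> (nat \<Rightarrow> 'v) \<Rightarrow> bool" where
  "qCauchy q u \<longleftrightarrow> (\<forall>e>0. \<exists>M. \<forall>m\<ge>M. \<forall>n\<ge>M. q (u m - u n) < e)"

definition qsums :: "('v::ab_group_add \<Rightarrow> real) \<Rightarrow> (nat \<Rightarrow> 'v) \<Rightarrow> 'v \<Rightarrow> bool" where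
  "qsums q u s \<longleftrightarrow> qlim q (\<lambda>n. \<Sum>k<n. u k) s"

locale quasi_banach_space = quasi_normed_space +
  assumes complete_V: "range u \<subseteq> V \<Longrightarrow> qCauchy q u \<Longrightarrow> \<exists>l\<in>V. qlim q u l"

definition bounded_functional ::
  "('k::{real_normed_field, banach} \<Rightarrow> 'v::ab_group_add \<Rightarrow> 'v) \<Rightarrow> 'v set \<Rightarrow> ('v \<Rightarrow> real)
    \<Rightarrow> ('v \<Rightarrow> 'k) \<Rightarrow> bool" where
  "bounded_functional smul V q \<phi> \<longleftrightarrow>
    (\<forall>f\<in>V. \<forall>g\<in>V. \<phi> (f + g) = \<phi> f + \<phi> g) \<and>
    (\<forall>c. \<forall>f\<in>V. \<phi> (smul c f) = c * \<phi> f) \<and>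
    (\<exists>C. \<forall>f\<in>V. norm (\<phi> f) \<le> C * q f)"

text \<open>
  \<open>schauder_system smul V q y ys\<close>: \<open>y\<close> is a Schauder basis of \<open>V\<close> with coordinate functionals
  \<open>ys\<close>. The functionals are determined on \<open>V\<close> by \<open>y\<close>, and the expansion of each vector is unique
  because they are continuous and biorthogonal to \<open>y\<close>.
\<close>

definition schauder_system ::
  "('k::{real_normed_field, banach} \<Rightarrow> 'v::ab_group_add \<Rightarrow> 'v) \<Rightarrow> 'v set \<Rightarrow> ('v \<Rightarrow> real)
    \<Rightarrow> (nat \<Rightarrow> 'v) \<Rightarrow> (nat \<Rightarrow> 'v \<Rightarrow> 'k) \<Rightarrow> bool" where
  "schauder_system smul V q y ys \<longleftrightarrow>
    range y \<subseteq> V \<and>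
    (\<forall>n. bounded_functional smul V q (ys n)) \<and>
    (\<forall>n m. ys n (y m) = (if n = m then 1 else 0)) \<and>
    (\<forall>f\<in>V. qsums q (\<lambda>n. smul (ys n f) (y n)) f)"

definition schauder_basis ::
  "('k::{real_normed_field, banach} \<Rightarrow> 'v::ab_group_add \<Rightarrow> 'v) \<Rightarrow> 'v set \<Rightarrow> ('v \<Rightarrow> real)
    \<Rightarrow> (nat \<Rightarrow> 'v) \<Rightarrow> bool" where
  "schauder_basis smul V q y \<longleftrightarrow> (\<exists>ys. schauder_system smul V q y ys)"

definition semi_normalized :: "('v \<Rightarrow> real) \<Rightarrow> (nat \<Rightarrow> 'v) \<Rightarrow> bool" where
  "semi_normalized q x \<longleftrightarrow> 0 < (INF j. q (x j)) \<and> bdd_above (range (\<lambda>j. q (x j)))"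

section \<open>Almost greedy bases\<close>

definition greedy_set ::
  "(nat \<Rightarrow> 'v \<Rightarrow> 'k::real_normed_field) \<Rightarrow> 'v \<Rightarrow> nat set \<Rightarrow> bool" where
  "greedy_set ys f A \<longleftrightarrow> finite A \<and> (\<forall>j\<in>A. \<forall>k. k \<notin> A \<longrightarrow> norm (ys k f) \<le> norm (ys j f))"

definition coord_proj ::
  "('k \<Rightarrow> 'v::ab_group_add \<Rightarrow> 'v) \<Rightarrow> (nat \<Rightarrow> 'v) \<Rightarrow> (nat \<Rightarrow> 'v \<Rightarrow> 'k) \<Rightarrow> nat set \<Rightarrow> 'v \<Rightarrow> 'v" where
  "coord_proj smul y ys A f = (\<Sum>n\<in>A. smul (ys n f) (y n))"

definition almost_greedy_basis ::
  "('k::{real_normed_field, banach} \<Rightarrow> 'v::ab_group_add \<Rightarrow> 'v) \<Rightarrow> 'v set \<Rightarrow> ('v \<Rightarrow> real)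
    \<Rightarrow> (nat \<Rightarrow> 'v) \<Rightarrow> bool" where
  "almost_greedy_basis smul V q y \<longleftrightarrow>
    (\<exists>ys. schauder_system smul V q y ys \<and>
      (\<exists>C. \<forall>f\<in>V. \<forall>A B. greedy_set ys f A \<longrightarrow> finite B \<longrightarrow> card B \<le> card A \<longrightarrow>
        q (f - coord_proj smul y ys A f) \<le> C * q (f - coord_proj smul y ys B f)))"

text \<open>The supremum is taken in \<open>ereal\<close>, so that it is \<open>\<infinity>\<close> when the set is unbounded.\<close>

definition fundamental_function ::
  "('k::real_normed_field \<Rightarrow> 'v::ab_group_add \<Rightarrow> 'v) \<Rightarrow> ('v \<Rightarrow> real) \<Rightarrow> (nat \<Rightarrow> 'v)
    \<Rightarrow> nat \<Rightarrow> ereal" where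
  "fundamental_function smul q y m =
    Sup {ereal (q (\<Sum>n\<in>A. smul (\<epsilon> n) (y n))) | A \<epsilon>.
           finite A \<and> card A \<le> m \<and> (\<forall>n\<in>A. norm (\<epsilon> n) = 1)}"

definition equivalent_to :: "(nat \<Rightarrow> ereal) \<Rightarrow> (nat \<Rightarrow> real) \<Rightarrow> bool" where
  "equivalent_to \<Phi> \<Gamma> \<longleftrightarrow>
    (\<exists>c>0. \<exists>C. \<forall>m\<ge>1. ereal (c * \<Gamma> m) \<le> \<Phi> m \<and> \<Phi> m \<le> ereal (C * \<Gamma> m))"

section \<open>Sequence spaces\<close>

definition seq_scale :: "'k::field \<Rightarrow> (nat \<Rightarrow> 'k) \<Rightarrow> nat \<Rightarrow> 'k" where
  "seq_scale c f = (\<lambda>n. c * f n)"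

lemma vector_space_seq_scale: "vector_space seq_scale"
  by unfold_locales (auto simp: seq_scale_def fun_eq_iff algebra_simps)

definition unit_vec :: "nat \<Rightarrow> nat \<Rightarrow> 'k::field" where
  "unit_vec n = (\<lambda>j. if j = n then 1 else 0)"

definition c00 :: "(nat \<Rightarrow> 'k::field) set" where
  "c00 = module.span seq_scale (range unit_vec)"

text \<open>
  Taking evaluation at \<open>n\<close> as the \<open>n\<close>-th coordinate functional says that \<open>f = (a\<^sub>n)\<close> as a sequence
  exactly when \<open>f = \<Sum>\<^sub>n a\<^sub>n e\<^sub>n\<close> as a convergent series.
\<close>

locale lc_subsymmetric_space = quasi_banach_space seq_scale S nS
  for S :: "(nat \<Rightarrow> 'k::{real_normed_field, banach}) set" and nS :: "(nat \<Rightarrow> 'k) \<Rightarrow> real" +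
  assumes triangle: "f \<in> S \<Longrightarrow> g \<in> S \<Longrightarrow> nS (f + g) \<le> nS f + nS g"
    and basis: "schauder_system seq_scale S nS unit_vec (\<lambda>n f. f n)"
    and subsymmetric: "\<lbrakk>f \<in> S; \<And>n. norm (\<epsilon> n) = 1; strict_mono (\<phi> :: nat \<Rightarrow> nat)\<rbrakk> \<Longrightarrow>
      \<exists>g\<in>S. qsums nS (\<lambda>n. seq_scale (\<epsilon> n * f n) (unit_vec (\<phi> n))) g \<and> nS g = nS f"

text \<open>By subsymmetry, any other set of cardinality \<open>m\<close> in place of \<open>{..<m}\<close> gives the same value.\<close>

definition Lam :: "((nat \<Rightarrow> 'k::field) \<Rightarrow> real) \<Rightarrow> nat \<Rightarrow> real" where
  "Lam nS m = nS (\<Sum>n<m. unit_vec n)"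

definition LRP :: "(nat \<Rightarrow> real) \<Rightarrow> bool" where
  "LRP \<Gamma> \<longleftrightarrow> (\<exists>b\<ge>1. \<forall>m\<ge>1. 2 * \<Gamma> m \<le> \<Gamma> (b * m))"

definition URP :: "(nat \<Rightarrow> real) \<Rightarrow> bool" where
  "URP \<Gamma> \<longleftrightarrow> (\<exists>b\<ge>1. \<forall>m\<ge>1. 2 * \<Gamma> (b * m) \<le> real b * \<Gamma> m)"

section \<open>The space built from a basis, a subsymmetric space and an ordered partition\<close>

definition ordered_partition :: "(nat \<Rightarrow> nat set) \<Rightarrow> bool" where
  "ordered_partition \<sigma> \<longleftrightarrow>
    (\<forall>n. finite (\<sigma> n) \<and> \<sigma> n \<noteq> {}) \<and> disjoint_family \<sigma> \<and> (\<Union>n. \<sigma> n) = UNIV \<and>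
    (\<forall>n. Max (\<sigma> n) < Min (\<sigma> (Suc n)))"

definition block_avg :: "(nat \<Rightarrow> nat set) \<Rightarrow> nat \<Rightarrow> (nat \<Rightarrow> 'k::real_normed_field) \<Rightarrow> 'k" where
  "block_avg \<sigma> n f = (\<Sum>j\<in>\<sigma> n. f j) / of_nat (card (\<sigma> n))"

definition P_proj :: "(nat \<Rightarrow> nat set) \<Rightarrow> (nat \<Rightarrow> 'k::real_normed_field) \<Rightarrow> nat \<Rightarrow> 'k" where
  "P_proj \<sigma> f = (\<lambda>j. block_avg \<sigma> (THE n. j \<in> \<sigma> n) f)"

definition Q_proj :: "(nat \<Rightarrow> nat set) \<Rightarrow> (nat \<Rightarrow> 'k::real_normed_field) \<Rightarrow> nat \<Rightarrow> 'k" where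
  "Q_proj \<sigma> f = f - P_proj \<sigma> f"

definition v_star ::
  "((nat \<Rightarrow> 'k) \<Rightarrow> real) \<Rightarrow> (nat \<Rightarrow> nat set) \<Rightarrow> nat \<Rightarrow> (nat \<Rightarrow> 'k::real_normed_field) \<Rightarrow> 'k" where
  "v_star nS \<sigma> n f =
    of_real (Lam nS (card (\<sigma> n)) / real (card (\<sigma> n))) * (\<Sum>j\<in>\<sigma> n. f j)"

text \<open>
  Used only for \<open>f \<in> c00\<close>, where finitely many of the coefficients \<open>v_star nS \<sigma> n f\<close> are nonzero.
\<close>

definition Y_qnorm ::
  "('k::real_normed_field \<Rightarrow> 'v::ab_group_add \<Rightarrow> 'v) \<Rightarrow> ('v \<Rightarrow> real) \<Rightarrow> (nat \<Rightarrow> 'v)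
    \<Rightarrow> ((nat \<Rightarrow> 'k) \<Rightarrow> real) \<Rightarrow> (nat \<Rightarrow> nat set) \<Rightarrow> (nat \<Rightarrow> 'k) \<Rightarrow> real" where
  "Y_qnorm smul q x nS \<sigma> f =
    nS (Q_proj \<sigma> f) +
    q (\<Sum>n | v_star nS \<sigma> n f \<noteq> 0. smul (v_star nS \<sigma> n f) (x n))"

text \<open>
  A completion of \<open>c00\<close> under \<open>q0\<close> realized as a space of sequences with continuous coordinates.
  Such a realization is unique as a set of sequences. As \<open>q0\<close> need not be continuous, the
  extension of \<open>q0\<close> to it is in general unique only up to equivalence.
\<close>

definition seq_completion ::
  "((nat \<Rightarrow> 'k::{real_normed_field, banach}) \<Rightarrow> real) \<Rightarrow> (nat \<Rightarrow> 'k) set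
    \<Rightarrow> ((nat \<Rightarrow> 'k) \<Rightarrow> real) \<Rightarrow> bool" where
  "seq_completion q0 Y q \<longleftrightarrow>
    quasi_banach_space seq_scale Y q \<and>
    (\<forall>n. bounded_functional seq_scale Y q (\<lambda>f. f n)) \<and>
    c00 \<subseteq> Y \<and> (\<forall>f\<in>c00. q f = q0 f) \<and>
    (\<forall>f\<in>Y. \<exists>u. range u \<subseteq> c00 \<and> qlim q u f)"

end

theory Submission
  imports Defs
begin

text \<open>
  The map \<open>f \<mapsto> (Q f, \<Sum>\<^sub>n v\<^sub>n(f) x\<^sub>n)\<close> identifies the completion with the product of \<open>X\<close> and the
  subspace of \<open>S\<close> of all sequences with vanishing block averages; any other completion is the same
  space with an equivalent quasi-norm.

  Since \<open>M\<^sub>r \<lesssim> N\<^bsub>r+1\<^esub>\<close>, the block lengths \<open>N\<^sub>n\<close> grow geometrically. By the LRP and the URP, for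
  \<open>M\<^sub>r \<le> m < M\<^bsub>r+1\<^esub>\<close> the numbers \<open>\<Lambda>(N\<^sub>n)\<close> with \<open>n \<le> r\<close> and \<open>m \<Lambda>(N\<^sub>n) / N\<^sub>n\<close> with \<open>n > r\<close> are then at most
  a constant times \<open>\<Lambda>(m)\<close>, with geometric decay away from \<open>r\<close>. Hence the coefficients \<open>v\<^sub>n(f)\<close> of a
  vector \<open>f\<close> bounded by \<open>1\<close> and supported on \<open>m\<close> points can be summed against any bounded sequence in a
  quasi-normed space, which gives upper democracy. In the other direction, if \<open>m\<close> coordinates of \<open>f\<close>
  are at least \<open>t\<close> in modulus, then half of them come from \<open>Q f\<close> or half from \<open>P f\<close>, so
  \<open>t \<Lambda>(m) \<lesssim> \<parallel>f\<parallel>\<close>. For a greedy set \<open>G\<close> of \<open>f\<close> with \<open>m\<close> elements and the union \<open>F\<close> of the first \<open>r\<close>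
  blocks, write \<open>S\<^sub>G f = S\<^sub>F f - S\<^bsub>F-G\<^esub> f + S\<^bsub>G-F\<^esub> f\<close>. The first term is a partial sum, the second is bounded
  by \<open>t = min\<^sub>G \<bar>f\<bar>\<close> on at most \<open>m\<close> points, and the coefficients \<open>v\<^sub>n\<close> of the third decay geometrically.
\<close>

section \<open>Quasi-normed spaces\<close>

lemma sum_lessThan_add:
  fixes y :: "nat \<Rightarrow> 'a::comm_monoid_add"
  shows "(\<Sum>i<l + n. y i) = (\<Sum>i<l. y i) + (\<Sum>i<n. y (i + l))"
  by (induction n) (simp_all add: ac_simps)

context quasi_normed_space
begin

lemma V_0 [simp]: "0 \<in> V"
  using subspace_V by (rule subspace_0)

lemma V_add: "f \<in> V \<Longrightarrow> g \<in> V \<Longrightarrow> f + g \<in> V"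
  using subspace_V by (rule subspace_add)

lemma V_diff: "f \<in> V \<Longrightarrow> g \<in> V \<Longrightarrow> f - g \<in> V"
  using subspace_V by (rule subspace_diff)

lemma V_scale: "f \<in> V \<Longrightarrow> smul c f \<in> V"
  using subspace_V by (rule subspace_scale)

lemma V_neg: "f \<in> V \<Longrightarrow> - f \<in> V"
  using subspace_V by (rule subspace_neg)

lemma V_sum: "(\<And>i. i \<in> A \<Longrightarrow> y i \<in> V) \<Longrightarrow> sum y A \<in> V"
  using subspace_V by (rule subspace_sum)

lemma q_0 [simp]: "q 0 = 0"
  using q_eq_0_iff[of 0] by simp

lemma q_neg: "f \<in> V \<Longrightarrow> q (- f) = q f"
  using q_scale[of f "-1"] by simp

lemma q_minus_commute: "f \<in> V \<Longrightarrow> g \<in> V \<Longrightarrow> q (f - g) = q (g - f)"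
  using q_neg[of "f - g"] V_diff by simp

text \<open>The quasi-triangle axiom only provides some constant; choice fixes one. Requiring it to
  be at least 1 ensures that inserting the factor weakens a nonnegative bound.\<close>

definition K :: real where
  "K = (SOME k. 1 \<le> k \<and> (\<forall>f\<in>V. \<forall>g\<in>V. q (f + g) \<le> k * (q f + q g)))"

lemma K_spec: "1 \<le> K \<and> (\<forall>f\<in>V. \<forall>g\<in>V. q (f + g) \<le> K * (q f + q g))"
proof -
  obtain k where k: "\<forall>f\<in>V. \<forall>g\<in>V. q (f + g) \<le> k * (q f + q g)"
    using q_quasi_triangle by blast
  have "1 \<le> max 1 k \<and> (\<forall>f\<in>V. \<forall>g\<in>V. q (f + g) \<le> max 1 k * (q f + q g))"
  proof (intro conjI ballI)
    fix f g assume fg: "f \<in> V" "g \<in> V"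
    have "q (f + g) \<le> k * (q f + q g)" using k fg by blast
    also have "\<dots> \<le> max 1 k * (q f + q g)"
      using fg q_nonneg by (intro mult_right_mono) (auto intro: add_nonneg_nonneg)
    finally show "q (f + g) \<le> max 1 k * (q f + q g)" .
  qed simp
  then show ?thesis unfolding K_def by (rule someI)
qed

lemma K_ge_1: "1 \<le> K"
  using K_spec by blast

lemma q_add: "f \<in> V \<Longrightarrow> g \<in> V \<Longrightarrow> q (f + g) \<le> K * (q f + q g)"
  using K_spec by blast

lemma q_diff: "f \<in> V \<Longrightarrow> g \<in> V \<Longrightarrow> q (f - g) \<le> K * (q f + q g)"
  using q_add[of f "- g"] V_neg q_neg by simp

lemma q_diff3:
  assumes "f \<in> V" "g \<in> V" "h \<in> V"
  shows "q (f - h) \<le> K * (q (f - g) + q (g - h))"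
  using q_add[of "f - g" "g - h"] assms V_diff by simp

text \<open>Iterating the quasi-triangle inequality gives a constant that depends only on the number
  \<open>n\<close> of summands. It serves for a fixed number of leading terms.\<close>

lemma q_sum_bounded:
  fixes n :: nat
  shows "\<exists>C\<ge>0. \<forall>y M. 0 \<le> M \<longrightarrow> (\<forall>i<n. y i \<in> V \<and> q (y i) \<le> M) \<longrightarrow> q (\<Sum>i<n. y i) \<le> C * M"
proof (induction n)
  case 0
  then show ?case by (intro exI[of _ 0]) simp
next
  case (Suc n)
  then obtain C where C: "0 \<le> C"
    "\<And>y M. 0 \<le> M \<Longrightarrow> (\<forall>i<n. y i \<in> V \<and> q (y i) \<le> M) \<Longrightarrow> q (\<Sum>i<n. y i) \<le> C * M"
    by blast
  show ?case
  proof (intro exI[of _ "K * (C + 1)"] conjI allI impI)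
    show "0 \<le> K * (C + 1)" using C K_ge_1 by simp
    fix y M assume M: "0 \<le> M" and y: "\<forall>i<Suc n. y i \<in> V \<and> q (y i) \<le> M"
    have "q (\<Sum>i<Suc n. y i) \<le> K * (q (\<Sum>i<n. y i) + q (y n))"
      using q_add[of "\<Sum>i<n. y i" "y n"] y V_sum[of "{..<n}" y] by simp
    also have "\<dots> \<le> K * (C * M + M)"
      using C(2)[of M y] y M K_ge_1 by (intro mult_left_mono add_mono) auto
    finally show "q (\<Sum>i<Suc n. y i) \<le> K * (C + 1) * M" by (simp add: algebra_simps)
  qed
qed

text \<open>
  A quasi-norm does not satisfy a triangle inequality uniformly in the number of summands. For
  geometrically decaying summands it does: if \<open>K * \<rho> ^ l \<le> 1 / 2\<close>, the sum without the first
  \<open>l\<close> terms can be absorbed.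
\<close>

lemma q_geometric_sum:
  assumes \<rho>: "0 \<le> \<rho>" "\<rho> < 1"
  shows "\<exists>C\<ge>0. \<forall>n y M. 0 \<le> M \<longrightarrow> (\<forall>i<n. y i \<in> V \<and> q (y i) \<le> M * \<rho> ^ i) \<longrightarrow>
    q (\<Sum>i<n. y i) \<le> C * M"
proof -
  have "(\<lambda>l. \<rho> ^ l) \<longlonglongrightarrow> 0" using \<rho> by (simp add: LIMSEQ_realpow_zero)
  moreover have "0 < 1 / (2 * K)" using K_ge_1 by simp
  ultimately have "\<forall>\<^sub>F l in sequentially. \<rho> ^ l < 1 / (2 * K)" by (rule order_tendstoD)
  then obtain l0 where "\<rho> ^ l0 < 1 / (2 * K)" by (auto simp: eventually_sequentially)
  \<comment> \<open>Passing to the successor of \<open>l0\<close> makes the chosen length positive,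
    so that removing that many terms really shortens the sum in the induction.\<close>
  moreover have "\<rho> ^ Suc l0 \<le> \<rho> ^ l0" using \<rho> by (intro power_decreasing) auto
  ultimately have "\<rho> ^ Suc l0 < 1 / (2 * K)" by linarith
  then have "K * \<rho> ^ Suc l0 \<le> 1 / 2" using K_ge_1 by (simp add: field_simps)
  then obtain l where l: "K * \<rho> ^ l \<le> 1 / 2" "0 < l" by blast
  obtain C0 where C0: "0 \<le> C0"
    "\<And>y M n. 0 \<le> M \<Longrightarrow> (\<forall>i<l. y i \<in> V \<and> q (y i) \<le> M) \<Longrightarrow> q (\<Sum>i<l. y i) \<le> C0 * M"
    using q_sum_bounded[of l] by blast
  \<comment> \<open>This value solves \<open>K * C0 + C / 2 = C\<close>, the balance between the
    first \<open>l\<close> terms and the absorbed rest.\<close>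
  define C where "C = 2 * K * C0"
  have C_nonneg: "0 \<le> C" using C0 K_ge_1 unfolding C_def by simp
  have le: "K * C0 \<le> C" using C0 K_ge_1 unfolding C_def by simp
  have "q (\<Sum>i<n. y i) \<le> C * M"
    if "0 \<le> M" "\<forall>i<n. y i \<in> V \<and> q (y i) \<le> M * \<rho> ^ i" for n y M
    using that
  proof (induction n arbitrary: y M rule: less_induct)
    case (less n)
    \<comment> \<open>Padding with zeros makes the split after \<open>l\<close> terms valid even if
      \<open>n < l\<close>.\<close>
    define y' where "y' i = (if i < n then y i else 0)" for i
    have y'V: "y' i \<in> V" for i using less.prems unfolding y'_def by auto
    have y'q: "q (y' i) \<le> M * \<rho> ^ i" for i
      using less.prems \<rho> unfolding y'_def by auto
    have first: "q (\<Sum>i<l. y' i) \<le> C0 * M"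
    proof (rule C0(2))
      have "q (y' i) \<le> M" for i
        using y'q[of i] less.prems(1) \<rho>
        by (meson mult_left_le order_trans power_le_one less_imp_le)
      then show "\<forall>i<l. y' i \<in> V \<and> q (y' i) \<le> M" using y'V by blast
    qed (use less.prems in auto)
    have rest: "q (\<Sum>i<n - l. y' (i + l)) \<le> C * (M * \<rho> ^ l)"
    proof (cases "n = 0")
      case True
      then show ?thesis using C_nonneg less.prems \<rho> by simp
    next
      case False
      show ?thesis
      proof (rule less.IH)
        show "n - l < n" using False l by simp
        show "\<forall>i<n - l. y' (i + l) \<in> V \<and> q (y' (i + l)) \<le> M * \<rho> ^ l * \<rho> ^ i"
        proof (intro allI impI conjI y'V)
          fix i
          show "q (y' (i + l)) \<le> M * \<rho> ^ l * \<rho> ^ i"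
            using y'q[of "i + l"] by (simp add: power_add ac_simps)
        qed
      qed (use less.prems \<rho> in simp)
    qed
    have "(\<Sum>i<n. y i) = (\<Sum>i<l + (n - l). y' i)"
      by (rule sum.mono_neutral_cong_left) (auto simp: y'_def)
    also have "\<dots> = (\<Sum>i<l. y' i) + (\<Sum>i<n - l. y' (i + l))"
      by (rule sum_lessThan_add)
    finally have "q (\<Sum>i<n. y i) \<le> K * (q (\<Sum>i<l. y' i) + q (\<Sum>i<n - l. y' (i + l)))"
      using y'V by (simp add: q_add V_sum)
    also have "\<dots> \<le> K * (C0 * M + C * (M * \<rho> ^ l))"
      using first rest K_ge_1 by (intro mult_left_mono add_mono) auto
    also have "\<dots> = K * C0 * M + K * \<rho> ^ l * (C * M)" by (simp add: algebra_simps)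
    also have "\<dots> \<le> K * C0 * M + 1 / 2 * (C * M)"
      using l C_nonneg less.prems by (intro add_left_mono mult_right_mono) auto
    also have "\<dots> = C * M" unfolding C_def by simp
    finally show ?case .
  qed
  then show ?thesis using C_nonneg by blast
qed

text \<open>Cut at \<open>r\<close> and reverse the first \<open>r\<close> terms: both pieces then
  decay from their first term. The exponent is 0 at both \<open>r - 1\<close> and
  \<open>r\<close>.\<close>

lemma q_two_sided_geometric_sum:
  assumes \<rho>: "0 \<le> \<rho>" "\<rho> < 1"
  shows "\<exists>C\<ge>0. \<forall>r R y M. 0 \<le> M \<longrightarrow>
    (\<forall>n<R. y n \<in> V \<and> q (y n) \<le> M * \<rho> ^ (if n < r then r - 1 - n else n - r)) \<longrightarrow>
    q (\<Sum>n<R. y n) \<le> C * M"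
proof -
  obtain C where C: "0 \<le> C"
    "\<And>n y M. 0 \<le> M \<Longrightarrow> (\<forall>i<n. y i \<in> V \<and> q (y i) \<le> M * \<rho> ^ i) \<Longrightarrow>
      q (\<Sum>i<n. y i) \<le> C * M"
    using q_geometric_sum[OF \<rho>] by blast
  have "q (\<Sum>n<R. y n) \<le> K * (2 * C) * M"
    if M: "0 \<le> M"
      and y: "\<forall>n<R. y n \<in> V \<and> q (y n) \<le> M * \<rho> ^ (if n < r then r - 1 - n else n - r)"
    for r R y M
  proof -
    define y' where "y' i = (if i < R then y i else 0)" for i
    have y'V: "y' i \<in> V" for i using y unfolding y'_def by auto
    have y'q: "q (y' n) \<le> M * \<rho> ^ (if n < r then r - 1 - n else n - r)" for n
      using y M \<rho> unfolding y'_def by auto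
    have "(\<Sum>n<R. y n) = (\<Sum>n<r + R. y' n)"
      by (rule sum.mono_neutral_cong_left) (auto simp: y'_def)
    also have "\<dots> = (\<Sum>n<r. y' n) + (\<Sum>n<R. y' (n + r))"
      by (rule sum_lessThan_add)
    also have "(\<Sum>n<r. y' n) = (\<Sum>n<r. y' (r - Suc n))"
      by (rule sum.nat_diff_reindex[symmetric])
    finally have "q (\<Sum>n<R. y n) \<le> K * (q (\<Sum>n<r. y' (r - Suc n)) + q (\<Sum>n<R. y' (n + r)))"
      using y'V by (simp add: q_add V_sum)
    also have "\<dots> \<le> K * (C * M + C * M)"
    proof (intro mult_left_mono add_mono C(2) M)
      show "\<forall>i<r. y' (r - Suc i) \<in> V \<and> q (y' (r - Suc i)) \<le> M * \<rho> ^ i"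
      proof (intro allI impI conjI y'V)
        fix i assume "i < r"
        then show "q (y' (r - Suc i)) \<le> M * \<rho> ^ i" using y'q[of "r - Suc i"] by simp
      qed
      show "\<forall>i<R. y' (i + r) \<in> V \<and> q (y' (i + r)) \<le> M * \<rho> ^ i"
      proof (intro allI impI conjI y'V)
        fix i
        show "q (y' (i + r)) \<le> M * \<rho> ^ i" using y'q[of "i + r"] by simp
      qed
    qed (use K_ge_1 in auto)
    finally show ?thesis by (simp add: algebra_simps)
  qed
  then show ?thesis using C K_ge_1 by (intro exI[of _ "K * (2 * C)"]) auto
qed

section \<open>Limits with respect to a quasi-norm\<close>

lemma qlim_unique:
  assumes "range u \<subseteq> V" "l \<in> V" "l' \<in> V" "qlim q u l" "qlim q u l'"
  shows "l = l'"
proof -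
  have u: "u n \<in> V" for n using assms by auto
  have "(\<lambda>n. K * (q (u n - l) + q (u n - l'))) \<longlonglongrightarrow> K * (0 + 0)"
    using assms unfolding qlim_def by (intro tendsto_intros) auto
  moreover have "q (l - l') \<le> K * (q (u n - l) + q (u n - l'))" for n
    using q_diff3[of l "u n" l'] q_minus_commute[of l "u n"] u assms by simp
  ultimately have "q (l - l') \<le> 0"
    by (intro LIMSEQ_le_const[of _ 0]) auto
  then show ?thesis using q_eq_0_iff[of "l - l'"] q_nonneg[of "l - l'"] V_diff assms by auto
qed

text \<open>The factor \<open>K\<close> stands in for continuity, which a quasi-norm may lack: a
  bound along the sequence passes to the limit at this cost.\<close>

lemma qlim_bound:
  assumes "range u \<subseteq> V" "l \<in> V" "qlim q u l" "\<And>n. n \<ge> n0 \<Longrightarrow> q (u n) \<le> B"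
  shows "q l \<le> K * B"
proof -
  have u: "u n \<in> V" for n using assms by auto
  have "(\<lambda>n. K * (q (u n - l) + B)) \<longlonglongrightarrow> K * (0 + B)"
    using assms unfolding qlim_def by (intro tendsto_intros) auto
  moreover have "q l \<le> K * (q (u n - l) + B)" if "n \<ge> n0" for n
  proof -
    have "q l \<le> K * (q (l - u n) + q (u n))"
      using q_diff3[of l "u n" 0] u assms by simp
    also have "\<dots> \<le> K * (q (u n - l) + B)"
      using assms(4)[OF that] q_minus_commute[of l "u n"] u assms(2) K_ge_1
      by (intro mult_left_mono) auto
    finally show ?thesis .
  qed
  ultimately show ?thesis by (intro LIMSEQ_le_const[of _ "K * B"]) auto
qed

lemma qlim_imp_qCauchy:
  assumes "range u \<subseteq> V" "l \<in> V" "qlim q u l"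
  shows "qCauchy q u"
  unfolding qCauchy_def
proof (intro allI impI)
  fix e :: real assume "0 < e"
  then have e: "0 < e / (2 * K)" using K_ge_1 by simp
  have u: "u n \<in> V" for n using assms by auto
  have "\<forall>\<^sub>F n in sequentially. q (u n - l) < e / (2 * K)"
    using assms(3) e unfolding qlim_def by (rule order_tendstoD)
  then obtain M where M: "\<And>n. n \<ge> M \<Longrightarrow> q (u n - l) < e / (2 * K)"
    by (auto simp: eventually_sequentially)
  have "q (u m - u n) < e" if "m \<ge> M" "n \<ge> M" for m n
  proof -
    have "q (u m - u n) \<le> K * (q (u m - l) + q (u n - l))"
      using q_diff3[of "u m" l "u n"] q_minus_commute[of l "u n"] u assms by simp
    also have "\<dots> < K * (e / (2 * K) + e / (2 * K))"
      using M that K_ge_1 by (intro mult_strict_left_mono add_strict_mono) auto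
    also have "\<dots> = e" using K_ge_1 by (simp add: field_simps)
    finally show ?thesis .
  qed
  then show "\<exists>M. \<forall>m\<ge>M. \<forall>n\<ge>M. q (u m - u n) < e" by blast
qed

lemma bounded_functional_tendsto:
  assumes "bounded_functional smul V q \<phi>" "range u \<subseteq> V" "l \<in> V" "qlim q u l"
  shows "(\<lambda>n. \<phi> (u n)) \<longlonglongrightarrow> \<phi> l"
proof -
  obtain C where C: "\<And>f. f \<in> V \<Longrightarrow> norm (\<phi> f) \<le> C * q f"
    using assms unfolding bounded_functional_def by blast
  have add: "\<phi> (f + g) = \<phi> f + \<phi> g" if "f \<in> V" "g \<in> V" for f g
    using assms that unfolding bounded_functional_def by blast
  have u: "u n \<in> V" for n using assms by auto
  have "(\<lambda>n. C * q (u n - l)) \<longlonglongrightarrow> C * 0"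
    using assms unfolding qlim_def by (intro tendsto_intros)
  then have "(\<lambda>n. C * q (u n - l)) \<longlonglongrightarrow> 0" by simp
  moreover have "norm (\<phi> (u n) - \<phi> l) \<le> C * q (u n - l)" for n
    using C[of "u n - l"] add[of "u n - l" l] u assms V_diff by simp
  ultimately have "(\<lambda>n. \<phi> (u n) - \<phi> l) \<longlonglongrightarrow> 0"
    by (rule Lim_null_comparison[OF always_eventually[OF allI], rotated])
  then show ?thesis by (simp add: LIM_zero_iff)
qed

end

section \<open>Uniform boundedness and Schauder bases\<close>

context quasi_banach_space
begin

text \<open>
  Sokal's gliding hump argument. Since \<open>2 \<xi> = (x + \<xi>) - (x - \<xi>)\<close>, an operator that is large at \<open>\<xi>\<close>
  is large at one of \<open>x + \<xi>\<close> and \<open>x - \<xi>\<close>; steps of size \<open>a ^ k\<close> with \<open>a\<close> small compared to the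
  quasi-norm constant make this survive in the limit.
\<close>

lemma uniform_boundedness:
  assumes TV: "\<And>n f. f \<in> V \<Longrightarrow> T n f \<in> V"
    and add: "\<And>n f g. f \<in> V \<Longrightarrow> g \<in> V \<Longrightarrow> T n (f + g) = T n f + T n g"
    and scale: "\<And>n c f. f \<in> V \<Longrightarrow> T n (smul c f) = smul c (T n f)"
    and bounded: "\<And>n. \<exists>C. \<forall>f\<in>V. q (T n f) \<le> C * q f"
    and pointwise: "\<And>f. f \<in> V \<Longrightarrow> \<exists>C. \<forall>n::nat. q (T n f) \<le> C"
  shows "\<exists>C\<ge>0. \<forall>n. \<forall>f\<in>V. q (T n f) \<le> C * q f"
proof -
  \<comment> \<open>The infimum \<open>B n\<close> of the admissible constants is the operator
    quasi-norm of \<open>T n\<close>.\<close>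
  define \<C> where "\<C> n = {C. 0 \<le> C \<and> (\<forall>f\<in>V. q (T n f) \<le> C * q f)}" for n
  define B where "B n = Inf (\<C> n)" for n
  have nonempty: "\<C> n \<noteq> {}" for n
  proof -
    obtain C where C: "\<And>f. f \<in> V \<Longrightarrow> q (T n f) \<le> C * q f" using bounded by blast
    have "q (T n f) \<le> max 0 C * q f" if "f \<in> V" for f
      using C[OF that] q_nonneg[OF that] by (meson max.cobounded2 mult_right_mono order_trans)
    then have "max 0 C \<in> \<C> n" unfolding \<C>_def by simp
    then show ?thesis by blast
  qed
  have bdd: "bdd_below (\<C> n)" for n
    unfolding \<C>_def by (rule bdd_belowI[of _ 0]) auto
  have B_nonneg: "0 \<le> B n" for n
    unfolding B_def using nonempty by (rule cInf_greatest) (simp add: \<C>_def)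
  have B_bound: "q (T n f) \<le> B n * q f" if f: "f \<in> V" for n f
  proof (cases "q f = 0")
    case True
    then show ?thesis using nonempty[of n] f unfolding \<C>_def by auto
  next
    case False
    then have pos: "0 < q f" using q_nonneg[OF f] by simp
    have "q (T n f) / q f \<le> B n"
      unfolding B_def using nonempty
      by (rule cInf_greatest) (use f pos in \<open>auto simp: \<C>_def field_simps\<close>)
    then show ?thesis using pos by (simp add: field_simps)
  qed
  have B_attained: "\<exists>f\<in>V. q (T n f) > B n / 2 * q f" if "0 < B n" for n
  proof (rule ccontr)
    assume "\<not> (\<exists>f\<in>V. q (T n f) > B n / 2 * q f)"
    then have "B n / 2 \<in> \<C> n" using that unfolding \<C>_def by auto
    then have "B n \<le> B n / 2" unfolding B_def using bdd by (rule cInf_lower)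
    then show False using that by simp
  qed
  have "\<exists>D. \<forall>n. B n \<le> D"
  proof (rule ccontr)
    assume "\<nexists>D. \<forall>n. B n \<le> D"
    then have unbounded: "\<exists>n. D < B n" for D by (meson not_le)
    \<comment> \<open>The size of \<open>a\<close> serves two purposes:
      \<open>2 * K * a \<le> 1\<close> sums the tails, and
      \<open>2 * K ^ 3 * a = 1 / (4 * K)\<close> leaves half of the main coefficient
      \<open>1 / (2 * K)\<close> after the error of the tail is subtracted.\<close>
    define a where "a = 1 / (8 * K ^ 4)"
    have K4: "1 \<le> K ^ 4" "K \<le> K ^ 4"
      using K_ge_1 one_le_power[of K 4] self_le_power[of K 4] by auto
    have a: "0 < a" "a < 1" "2 * K * a \<le> 1"
      using K4 K_ge_1 unfolding a_def by (simp_all add: divide_less_eq divide_le_eq)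
    \<comment> \<open>The operators are picked so large that even steps of size \<open>a ^ k\<close>
      give \<open>B (nn k) * a ^ k > k + 1\<close>.\<close>
    have "\<forall>k. \<exists>n. real (Suc k) / a ^ k < B n" using unbounded by blast
    then obtain nn where nn: "\<And>k. real (Suc k) / a ^ k < B (nn k)"
      unfolding choice_iff by blast
    have B_pos: "0 < B (nn k)" for k
      using nn[of k] a by (meson divide_pos_pos less_trans of_nat_0_less_iff zero_less_Suc zero_less_power)
    have "\<exists>\<xi>\<in>V. q \<xi> = a ^ k \<and> B (nn k) / 2 * a ^ k \<le> q (T (nn k) \<xi>)" for k
    proof -
      obtain f where f: "f \<in> V" "q (T (nn k) f) > B (nn k) / 2 * q f"
        using B_attained[OF B_pos] by blast
      have "q f \<noteq> 0" using B_bound[OF f(1), of "nn k"] f(2) by auto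
      then have pos: "0 < q f" using q_nonneg[OF f(1)] by simp
      define c where "c = a ^ k / q f"
      have c: "0 < c" using pos a unfolding c_def by simp
      have cq: "c * q f = a ^ k" using pos unfolding c_def by simp
      have "q (smul (of_real c) f) = a ^ k"
        using q_scale[OF f(1), of "of_real c"] c cq by simp
      moreover have "q (T (nn k) (smul (of_real c) f)) = c * q (T (nn k) f)"
        using q_scale[OF TV[OF f(1)]] scale[OF f(1)] c by simp
      moreover have "c * q (T (nn k) f) \<ge> c * (B (nn k) / 2 * q f)"
        using f(2) c by (intro mult_left_mono) auto
      moreover have "c * (B (nn k) / 2 * q f) = B (nn k) / 2 * a ^ k"
        using pos unfolding c_def by simp
      ultimately show ?thesis using V_scale[OF f(1)] by (metis)
    qed
    then obtain \<xi> where \<xi>: "\<And>k. \<xi> k \<in> V" "\<And>k. q (\<xi> k) = a ^ k"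
      "\<And>k. B (nn k) / 2 * a ^ k \<le> q (T (nn k) (\<xi> k))" by metis
    \<comment> \<open>Each step takes the sign that keeps \<open>T (nn k)\<close> large at the next
      point; \<open>large\<close> shows that one of the two signs succeeds.\<close>
    define x where "x = rec_nat 0 (\<lambda>k z. if q (T (nn k) (\<xi> k)) / K \<le> q (T (nn k) (z + \<xi> k))
      then z + \<xi> k else z - \<xi> k)"
    have x_0: "x 0 = 0" unfolding x_def by simp
    have x_Suc: "x (Suc k) = (if q (T (nn k) (\<xi> k)) / K \<le> q (T (nn k) (x k + \<xi> k))
      then x k + \<xi> k else x k - \<xi> k)" for k unfolding x_def by simp
    have xV: "x k \<in> V" for k
      by (induction k) (auto simp: x_0 x_Suc intro: V_add V_diff \<xi>)
    have step: "q (x (Suc k) - x k) = a ^ k" for k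
      using \<xi> q_neg by (simp add: x_Suc)
    have large: "q (T (nn k) (\<xi> k)) / K \<le> q (T (nn k) (x (Suc k)))" for k
    proof (rule ccontr)
      assume neg: "\<not> ?thesis"
      let ?T = "T (nn k)"
      have lt: "q (?T (x k + \<xi> k)) < q (?T (\<xi> k)) / K" "q (?T (x k - \<xi> k)) < q (?T (\<xi> k)) / K"
        using neg by (auto simp: x_Suc split: if_splits)
      have plus: "x k + \<xi> k \<in> V" and minus: "x k - \<xi> k \<in> V"
        using xV \<xi> V_add V_diff by auto
      have "?T (x k + \<xi> k) = ?T ((x k - \<xi> k) + smul 2 (\<xi> k))"
        using scale_left_distrib[of 1 1 "\<xi> k"] by (simp add: algebra_simps)
      also have "\<dots> = ?T (x k - \<xi> k) + smul 2 (?T (\<xi> k))"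
        using add[OF minus V_scale[OF \<xi>(1)]] scale[OF \<xi>(1)] by simp
      finally have "smul 2 (?T (\<xi> k)) = ?T (x k + \<xi> k) - ?T (x k - \<xi> k)" by simp
      then have "2 * q (?T (\<xi> k)) \<le> K * (q (?T (x k + \<xi> k)) + q (?T (x k - \<xi> k)))"
        using q_scale[OF TV[OF \<xi>(1)], of 2 "nn k" k] q_diff[OF TV[OF plus] TV[OF minus], of "nn k" "nn k"]
        by simp
      also have "\<dots> < K * (q (?T (\<xi> k)) / K + q (?T (\<xi> k)) / K)"
        using lt K_ge_1 by (intro mult_strict_left_mono add_strict_mono) auto
      also have "\<dots> = 2 * q (?T (\<xi> k))" using K_ge_1 by simp
      finally show False by simp
    qed
    \<comment> \<open>The bound at \<open>Suc m\<close> reproduces itself at \<open>m\<close>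
      because \<open>2 * K * a \<le> 1\<close>.\<close>
    have tail: "q (x (m + j) - x m) \<le> 2 * K * a ^ m" for m j
    proof (induction j arbitrary: m)
      case 0
      then show ?case using K_ge_1 a by simp
    next
      case (Suc j)
      have "q (x (m + Suc j) - x m) \<le> K * (q (x (Suc m + j) - x (Suc m)) + q (x (Suc m) - x m))"
        using q_diff3[OF xV xV xV, of "m + Suc j" m "Suc m"] by simp
      also have "\<dots> \<le> K * (2 * K * a ^ Suc m + a ^ m)"
        using Suc[of "Suc m"] step[of m] K_ge_1 by (intro mult_left_mono add_mono) auto
      also have "\<dots> = K * a ^ m * (2 * K * a + 1)" by (simp add: algebra_simps)
      also have "\<dots> \<le> K * a ^ m * 2" using a K_ge_1 by (intro mult_left_mono) auto
      finally show ?case by simp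
    qed
    have range: "range x \<subseteq> V" using xV by auto
    have "qCauchy q x"
      unfolding qCauchy_def
    proof (intro allI impI)
      fix e :: real assume "0 < e"
      have "(\<lambda>m. K * (2 * K * a ^ m + 2 * K * a ^ m)) \<longlonglongrightarrow> K * (2 * K * 0 + 2 * K * 0)"
        using a by (intro tendsto_intros LIMSEQ_realpow_zero) auto
      then have "\<forall>\<^sub>F m in sequentially. K * (2 * K * a ^ m + 2 * K * a ^ m) < e"
        using \<open>0 < e\<close> by (intro order_tendstoD) auto
      then obtain M where M: "K * (2 * K * a ^ M + 2 * K * a ^ M) < e"
        by (auto simp: eventually_sequentially)
      have "q (x m - x n) < e" if "m \<ge> M" "n \<ge> M" for m n
      proof -
        have "q (x m - x n) \<le> K * (q (x m - x M) + q (x n - x M))"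
          using q_diff3[OF xV xV xV, of m n M] q_minus_commute[OF xV xV, of M n] by simp
        also have "\<dots> \<le> K * (2 * K * a ^ M + 2 * K * a ^ M)"
          using tail[of M "m - M"] tail[of M "n - M"] that K_ge_1
          by (intro mult_left_mono add_mono) auto
        finally show ?thesis using M by simp
      qed
      then show "\<exists>M. \<forall>m\<ge>M. \<forall>n\<ge>M. q (x m - x n) < e" by blast
    qed
    then obtain z where z: "z \<in> V" "qlim q x z" using complete_V range by blast
    \<comment> \<open>Passing to the limit costs one further factor \<open>K\<close>.\<close>
    have z_tail: "q (z - x m) \<le> 2 * K ^ 2 * a ^ m" for m
    proof -
      have "q (z - x m) \<le> K * (2 * K * a ^ m)"
      proof (rule qlim_bound)
        show "qlim q (\<lambda>n. x n - x m) (z - x m)" using z(2) unfolding qlim_def by simp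
        show "q (x n - x m) \<le> 2 * K * a ^ m" if "n \<ge> m" for n
          using tail[of m "n - m"] that by simp
      qed (use xV z V_diff in auto)
      then show ?thesis by (simp add: power2_eq_square algebra_simps)
    qed
    obtain D where D: "\<And>n. q (T n z) \<le> D" using pointwise[OF z(1)] by blast
    have "real (Suc k) \<le> 4 * K ^ 2 * D" for k
    proof -
      let ?T = "T (nn k)" and ?B = "B (nn k)"
      have V: "z \<in> V" "x (Suc k) \<in> V" "z - x (Suc k) \<in> V" using z xV V_diff by auto
      have "?T z = ?T (x (Suc k)) + ?T (z - x (Suc k))"
        using add[OF V(2,3)] by simp
      then have eq: "?T (x (Suc k)) = ?T z - ?T (z - x (Suc k))" by simp
      have "?B / 2 * a ^ k / K \<le> q (?T (\<xi> k)) / K"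
        using \<xi>(3) K_ge_1 by (intro divide_right_mono) auto
      also have "\<dots> \<le> q (?T (x (Suc k)))" by (rule large)
      also have "\<dots> \<le> K * (q (?T z) + q (?T (z - x (Suc k))))"
        unfolding eq by (intro q_diff TV V)
      also have "\<dots> \<le> K * (D + ?B * (2 * K ^ 2 * a ^ Suc k))"
      proof (intro mult_left_mono add_mono D)
        have "q (?T (z - x (Suc k))) \<le> ?B * q (z - x (Suc k))" by (intro B_bound V)
        also have "\<dots> \<le> ?B * (2 * K ^ 2 * a ^ Suc k)"
          by (intro mult_left_mono z_tail B_nonneg)
        finally show "q (?T (z - x (Suc k))) \<le> ?B * (2 * K ^ 2 * a ^ Suc k)" .
      qed (use K_ge_1 in auto)
      also have "\<dots> = K * D + ?B * a ^ k * (2 * K ^ 3 * a)"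
        by (simp add: algebra_simps power2_eq_square power3_eq_cube)
      also have "2 * K ^ 3 * a = 1 / (4 * K)"
        using K_ge_1 unfolding a_def by (simp add: field_simps power_numeral_reduce)
      finally have "?B * a ^ k / (4 * K) \<le> K * D" using K_ge_1 by (simp add: field_simps)
      then have "?B * a ^ k \<le> 4 * K ^ 2 * D" using K_ge_1 by (simp add: field_simps power2_eq_square)
      moreover have "real (Suc k) < ?B * a ^ k"
        using nn[of k] a by (simp add: field_simps)
      ultimately show ?thesis by simp
    qed
    moreover obtain k where "4 * K ^ 2 * D < real k" using reals_Archimedean2 by blast
    ultimately show False by (metis less_imp_le lessI not_le of_nat_less_iff order_less_trans order_less_le_trans)
  qed
  then obtain D where D: "\<And>n. B n \<le> D" by blast
  have "q (T n f) \<le> max 0 D * q f" if f: "f \<in> V" for n f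
  proof -
    have "q (T n f) \<le> B n * q f" using B_bound f by blast
    also have "\<dots> \<le> max 0 D * q f"
      using D[of n] q_nonneg[OF f] by (intro mult_right_mono) auto
    finally show ?thesis .
  qed
  then show ?thesis by (intro exI[of _ "max 0 D"]) auto
qed

end

section \<open>Partial sum projections of a Schauder basis\<close>

locale schauder_space = quasi_banach_space +
  fixes y ys
  assumes system: "schauder_system smul V q y ys"
begin

lemma y_in_V: "y n \<in> V"
  using system unfolding schauder_system_def by blast

lemma ys_bounded: "bounded_functional smul V q (ys n)"
  using system unfolding schauder_system_def by blast

lemma ys_y: "ys n (y m) = (if n = m then 1 else 0)"
  using system unfolding schauder_system_def by blast

lemma ys_add: "f \<in> V \<Longrightarrow> g \<in> V \<Longrightarrow> ys n (f + g) = ys n f + ys n g"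
  using ys_bounded unfolding bounded_functional_def by blast

lemma ys_scale: "f \<in> V \<Longrightarrow> ys n (smul c f) = c * ys n f"
  using ys_bounded unfolding bounded_functional_def by blast

lemma ys_0 [simp]: "ys n 0 = 0"
  using ys_scale[of 0 n 0] by simp

lemma ys_diff: "f \<in> V \<Longrightarrow> g \<in> V \<Longrightarrow> ys n (f - g) = ys n f - ys n g"
  using ys_add[of "f - g" g n] V_diff by simp

lemma ys_sum: "finite A \<Longrightarrow> (\<And>i. i \<in> A \<Longrightarrow> f i \<in> V) \<Longrightarrow> ys n (sum f A) = (\<Sum>i\<in>A. ys n (f i))"
  by (induction A rule: finite_induct) (auto simp: ys_add V_sum)

definition psum where "psum n f = (\<Sum>k<n. smul (ys k f) (y k))"

lemma psum_in_V: "psum n f \<in> V"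
  unfolding psum_def by (intro V_sum V_scale y_in_V)

lemma qlim_psum: "f \<in> V \<Longrightarrow> qlim q (\<lambda>n. psum n f) f"
  using system unfolding schauder_system_def qsums_def psum_def by blast

lemma tendsto_psum: "f \<in> V \<Longrightarrow> (\<lambda>n. q (f - psum n f)) \<longlonglongrightarrow> 0"
  using qlim_psum[of f] unfolding qlim_def by (simp add: q_minus_commute psum_in_V)

text \<open>Both vectors are limits of the same sequence of partial sums.\<close>

lemma ys_inject:
  assumes "f \<in> V" "g \<in> V" "\<And>n. ys n f = ys n g"
  shows "f = g"
  using qlim_unique[of "\<lambda>n. psum n f" f g] qlim_psum[of f] qlim_psum[of g] assms psum_in_V
  by (auto simp: psum_def)

text \<open>Each partial sum operator is a finite sum of bounded rank-one operators, and convergence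
  of the expansions bounds them pointwise; uniform boundedness yields a common constant.\<close>

lemma psum_bounded: "\<exists>C\<ge>0. \<forall>n. \<forall>f\<in>V. q (psum n f) \<le> C * q f"
proof (rule uniform_boundedness)
  show "psum n (f + g) = psum n f + psum n g" if "f \<in> V" "g \<in> V" for n f g
    using that by (simp add: psum_def ys_add scale_left_distrib sum.distrib)
  show "psum n (smul c f) = smul c (psum n f)" if "f \<in> V" for n c f
    using that by (simp add: psum_def ys_scale scale_sum_right)
  show "\<exists>C. \<forall>f\<in>V. q (psum n f) \<le> C * q f" for n
  proof (induction n)
    case 0
    then show ?case by (intro exI[of _ 0]) (simp add: psum_def)
  next
    case (Suc n)
    then obtain C where C: "\<And>f. f \<in> V \<Longrightarrow> q (psum n f) \<le> C * q f" by blast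
    obtain D where D: "\<And>f. f \<in> V \<Longrightarrow> norm (ys n f) \<le> D * q f"
      using ys_bounded unfolding bounded_functional_def by blast
    have "q (psum (Suc n) f) \<le> K * (C + D * q (y n)) * q f" if f: "f \<in> V" for f
    proof -
      have "q (psum (Suc n) f) \<le> K * (q (psum n f) + q (smul (ys n f) (y n)))"
        using q_add[OF psum_in_V V_scale[OF y_in_V]] by (simp add: psum_def)
      also have "\<dots> \<le> K * (C * q f + D * q f * q (y n))"
        using C[OF f] D[OF f] q_nonneg[OF y_in_V, of n] K_ge_1
        by (auto simp: q_scale y_in_V intro!: mult_left_mono add_mono mult_right_mono)
      finally show ?thesis by (simp add: algebra_simps)
    qed
    then show ?case by blast
  qed
  show "\<exists>C. \<forall>n. q (psum n f) \<le> C" if f: "f \<in> V" for f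
  proof -
    have "Bseq (\<lambda>n. q (f - psum n f))"
      using tendsto_psum[OF f] by (intro convergent_imp_Bseq) (auto simp: convergent_def)
    then obtain D where "\<And>n. norm (q (f - psum n f)) \<le> D" unfolding Bseq_def by blast
    then have D: "\<And>n. q (f - psum n f) \<le> D" by (metis abs_le_D1 real_norm_def)
    have "q (psum n f) \<le> K * (q f + D)" for n
    proof -
      have "q (psum n f) \<le> K * (q f + q (f - psum n f))"
        using q_diff[of f "f - psum n f"] f psum_in_V V_diff by simp
      also have "\<dots> \<le> K * (q f + D)" using D K_ge_1 by (intro mult_left_mono add_left_mono) auto
      finally show ?thesis .
    qed
    then show ?thesis by blast
  qed
qed (rule psum_in_V)

text \<open>The term \<open>smul (ys n f) (y n)\<close> is a difference of consecutive partial sums,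
  and the lower bound on \<open>q (y n)\<close> turns control of the term into control of its
  coefficient, uniformly in \<open>n\<close>.\<close>

lemma coordinates_bounded:
  assumes "semi_normalized q y"
  shows "\<exists>C\<ge>0. \<forall>n. \<forall>f\<in>V. norm (ys n f) \<le> C * q f"
proof -
  define c where "c = (INF j. q (y j))"
  have c: "0 < c" using assms unfolding semi_normalized_def c_def by simp
  have c_le: "c \<le> q (y n)" for n
    unfolding c_def using q_nonneg[OF y_in_V] by (intro cINF_lower bdd_belowI2[of _ 0]) auto
  obtain C where C: "0 \<le> C" "\<And>n f. f \<in> V \<Longrightarrow> q (psum n f) \<le> C * q f"
    using psum_bounded by blast
  have "norm (ys n f) \<le> 2 * K * C / c * q f" if f: "f \<in> V" for n f
  proof -
    have "norm (ys n f) * c \<le> norm (ys n f) * q (y n)" using c_le by (intro mult_left_mono) auto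
    also have "\<dots> = q (psum (Suc n) f - psum n f)"
      by (simp add: psum_def q_scale y_in_V)
    also have "\<dots> \<le> K * (q (psum (Suc n) f) + q (psum n f))" by (intro q_diff psum_in_V)
    also have "\<dots> \<le> K * (C * q f + C * q f)"
      using C(2)[OF f] K_ge_1 by (intro mult_left_mono add_mono) auto
    finally show ?thesis using c by (simp add: field_simps)
  qed
  then show ?thesis using C c K_ge_1 by (intro exI[of _ "2 * K * C / c"]) auto
qed

end

section \<open>Subsymmetric sequence spaces\<close>

lemma sum_fun_apply: "sum F A j = (\<Sum>i\<in>A. F i j)"
  for F :: "'a \<Rightarrow> 'b \<Rightarrow> 'c::comm_monoid_add"
  by (induction A rule: infinite_finite_induct) auto

lemma seq_scale_apply [simp]: "seq_scale c f j = c * f j"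
  by (simp add: seq_scale_def)

interpretation seq: vector_space seq_scale
  by (rule vector_space_seq_scale)

text \<open>The coordinate projection onto \<open>A\<close>, given pointwise so that it also makes
  sense for infinite \<open>A\<close>, in particular for complements of finite sets.\<close>

definition restr :: "nat set \<Rightarrow> (nat \<Rightarrow> 'k::zero) \<Rightarrow> nat \<Rightarrow> 'k" where
  "restr A f = (\<lambda>j. if j \<in> A then f j else 0)"

lemma restr_apply: "restr A f j = (if j \<in> A then f j else 0)"
  by (simp add: restr_def)

lemma restr_add: "restr A (f + g) = restr A f + restr A g"
  for f g :: "nat \<Rightarrow> 'k::comm_monoid_add"
  by (auto simp: restr_def fun_eq_iff)

lemma restr_eq_sum:
  assumes "finite A"
  shows "restr A f = (\<Sum>j\<in>A. seq_scale (f j) (unit_vec j))"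
proof
  fix i
  have "(\<Sum>j\<in>A. f j * unit_vec j i) = (\<Sum>j\<in>A. if j = i then f j else 0)"
    by (rule sum.cong) (auto simp: unit_vec_def)
  then show "restr A f i = (\<Sum>j\<in>A. seq_scale (f j) (unit_vec j)) i"
    using assms by (simp add: restr_def sum_fun_apply)
qed

lemma c00_iff: "f \<in> c00 \<longleftrightarrow> finite {j. f j \<noteq> 0}"
proof
  assume "f \<in> c00"
  then show "finite {j. f j \<noteq> 0}"
    unfolding c00_def
  proof (induction rule: seq.span_induct_alt)
    case base
    then show ?case by simp
  next
    case (step c x y)
    obtain n where n: "x = unit_vec n" using step by blast
    have "{j. (seq_scale c x + y) j \<noteq> 0} \<subseteq> insert n {j. y j \<noteq> 0}"
      by (auto simp: n unit_vec_def)
    then show ?case using step finite_subset by blast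
  qed
next
  assume fin: "finite {j. f j \<noteq> 0}"
  have "f = restr {j. f j \<noteq> 0} f" by (auto simp: restr_def fun_eq_iff)
  also have "\<dots> \<in> c00"
    unfolding restr_eq_sum[OF fin] c00_def
    by (intro seq.span_sum seq.span_scale seq.span_base) auto
  finally show "f \<in> c00" .
qed

lemma restr_in_c00: "finite A \<Longrightarrow> restr A f \<in> c00"
  by (auto simp: c00_iff restr_def elim: finite_subset[rotated])

lemma unit_vec_in_c00: "unit_vec n \<in> c00"
  by (auto simp: c00_iff unit_vec_def)

text \<open>Extend \<open>A\<close> by all integers beyond its maximum; the increasing enumeration
  of this infinite set runs through \<open>A\<close> first. Subsymmetry can then move vectors
  between \<open>A\<close> and an initial segment.\<close>

lemma exists_strict_mono_image:
  assumes "finite A"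
  shows "\<exists>\<phi> :: nat \<Rightarrow> nat. strict_mono \<phi> \<and> \<phi> ` {..<card A} = A"
proof -
  define B where "B = A \<union> {Suc (Max (insert 0 A))..}"
  have inf: "infinite B" unfolding B_def by (simp add: infinite_Ici)
  have lt: "x < y" if "x \<in> A" "y \<in> B - A" for x y
  proof -
    have "x \<le> Max (insert 0 A)" using that assms by (intro Max_ge) auto
    moreover have "Suc (Max (insert 0 A)) \<le> y" using that unfolding B_def by blast
    ultimately show ?thesis by linarith
  qed
  define \<phi> where "\<phi> = enumerate B"
  have mono: "strict_mono \<phi>" unfolding \<phi>_def by (rule strict_mono_enumerate[OF inf])
  have range: "range \<phi> = B" unfolding \<phi>_def using inf by (rule range_enumerate)
  define I where "I = \<phi> -` A"
  have img: "\<phi> ` I = A" using range unfolding I_def B_def by auto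
  have inj: "inj \<phi>" using mono by (rule strict_mono_imp_inj_on)
  have "finite I" unfolding I_def using assms inj by (intro finite_vimageI) auto
  have card: "card I = card A" using img inj by (metis card_image inj_on_subset subset_UNIV)
  have down: "i \<in> I" if "j \<in> I" "i \<le> j" for i j
  proof (rule ccontr)
    assume "i \<notin> I"
    then have "\<phi> i \<in> B - A" using range unfolding I_def by auto
    then have "\<phi> j < \<phi> i" using lt that unfolding I_def by auto
    then show False using mono that by (simp add: strict_mono_less)
  qed
  \<comment> \<open>A finite downward closed set of natural numbers is an initial segment.\<close>
  have "I = {..<card I}"
  proof (rule card_subset_eq[symmetric])
    show "{..<card I} \<subseteq> I"
    proof
      fix i assume i: "i \<in> {..<card I}"
      show "i \<in> I"
      proof (rule ccontr)
        assume "i \<notin> I"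
        then have "I \<subseteq> {..<i}" using down by (meson lessThan_iff not_le subsetI)
        then have "card I \<le> i" using card_mono[of "{..<i}" I] by simp
        then show False using i by simp
      qed
    qed
  qed (use \<open>finite I\<close> in auto)
  then show ?thesis using mono img card by metis
qed

section \<open>Unconditionality and lattice estimates\<close>

sublocale lc_subsymmetric_space \<subseteq> schauder_space seq_scale S nS unit_vec "\<lambda>n f. f n"
  by unfold_locales (rule basis)

context lc_subsymmetric_space
begin

lemma c00_subset: "c00 \<subseteq> S"
  unfolding c00_def using y_in_V subspace_V by (intro span_minimal) auto

lemma tendsto_apply: "range u \<subseteq> S \<Longrightarrow> g \<in> S \<Longrightarrow> qlim nS u g \<Longrightarrow> (\<lambda>n. u n j) \<longlonglongrightarrow> g j"
  by (rule bounded_functional_tendsto[OF ys_bounded])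

text \<open>Evaluations are bounded functionals, so the sum of the series provided by subsymmetry
  can be read off coordinate by coordinate.\<close>

lemma spread:
  assumes f: "f \<in> S" and \<epsilon>: "\<And>n. norm (\<epsilon> n) = 1" and \<phi>: "strict_mono (\<phi> :: nat \<Rightarrow> nat)"
  shows "\<exists>g\<in>S. nS g = nS f \<and> (\<forall>j. g (\<phi> j) = \<epsilon> j * f j) \<and> (\<forall>i. i \<notin> range \<phi> \<longrightarrow> g i = 0)"
proof -
  let ?u = "\<lambda>n. \<Sum>k<n. seq_scale (\<epsilon> k * f k) (unit_vec (\<phi> k))"
  have "\<exists>g\<in>S. qlim nS ?u g \<and> nS g = nS f"
    using subsymmetric[OF f \<epsilon> \<phi>] by (simp only: qsums_def)
  then obtain g where g: "g \<in> S" "qlim nS ?u g" "nS g = nS f" by (elim bexE conjE)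
  have "range ?u \<subseteq> S" by (auto intro: V_sum V_scale y_in_V)
  then have lim: "(\<lambda>n. ?u n i) \<longlonglongrightarrow> g i" for i
    by (rule tendsto_apply[OF _ g(1,2)])
  have "g (\<phi> j) = \<epsilon> j * f j" for j
  proof -
    have "?u n (\<phi> j) = \<epsilon> j * f j" if "n \<ge> Suc j" for n
    proof -
      have "?u n (\<phi> j) = (\<Sum>k<n. if k = j then \<epsilon> k * f k else 0)"
        unfolding sum_fun_apply using \<phi>
        by (intro sum.cong) (auto simp: unit_vec_def strict_mono_eq)
      then show ?thesis using that by simp
    qed
    then have "\<forall>\<^sub>F n in sequentially. ?u n (\<phi> j) = \<epsilon> j * f j"
      unfolding eventually_sequentially by blast
    then have "(\<lambda>n. ?u n (\<phi> j)) \<longlonglongrightarrow> \<epsilon> j * f j" by (rule tendsto_eventually)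
    with lim[of "\<phi> j"] show ?thesis by (rule LIMSEQ_unique)
  qed
  moreover have "g i = 0" if "i \<notin> range \<phi>" for i
  proof -
    have "?u n i = 0" for n
      unfolding sum_fun_apply using that by (intro sum.neutral) (auto simp: unit_vec_def)
    then have "(\<lambda>n. ?u n i) \<longlonglongrightarrow> 0" by simp
    with lim[of i] show ?thesis by (rule LIMSEQ_unique)
  qed
  ultimately show ?thesis using g by blast
qed

lemma sign_change:
  assumes f: "f \<in> S" and \<epsilon>: "\<And>n. norm (\<epsilon> n) = 1"
  shows "(\<lambda>n. \<epsilon> n * f n) \<in> S" "nS (\<lambda>n. \<epsilon> n * f n) = nS f"
proof -
  obtain g where g: "g \<in> S" "nS g = nS f" "\<And>j. g j = \<epsilon> j * f j"
    using spread[where f = f and \<epsilon> = \<epsilon> and \<phi> = "\<lambda>n. n"] f \<epsilon> by (auto simp: strict_mono_def)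
  then have "g = (\<lambda>n. \<epsilon> n * f n)" by auto
  then show "(\<lambda>n. \<epsilon> n * f n) \<in> S" "nS (\<lambda>n. \<epsilon> n * f n) = nS f" using g by auto
qed

lemma nS_convex:
  assumes "f \<in> S" "g \<in> S" "0 \<le> t" "t \<le> 1" "nS f \<le> c" "nS g \<le> c"
  shows "nS (seq_scale (of_real t) f + seq_scale (of_real (1 - t)) g) \<le> c"
proof -
  have "nS (seq_scale (of_real t) f + seq_scale (of_real (1 - t)) g)
    \<le> norm (of_real t :: 'k) * nS f + norm (of_real (1 - t) :: 'k) * nS g"
    using triangle[OF V_scale[OF assms(1)] V_scale[OF assms(2)]] q_scale assms by metis
  also have "\<dots> = t * nS f + (1 - t) * nS g" unfolding norm_of_real using assms by simp
  also have "\<dots> \<le> t * c + (1 - t) * c" using assms by (intro add_mono mult_left_mono) auto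
  finally show ?thesis by (simp add: algebra_simps)
qed

text \<open>The restriction is the average of \<open>f\<close> and of \<open>f\<close> with the
  signs outside \<open>A\<close> reversed, two vectors of equal norm.\<close>

lemma suppression:
  assumes f: "f \<in> S"
  shows "restr A f \<in> S" "nS (restr A f) \<le> nS f"
proof -
  define g where "g = (\<lambda>n. (if n \<in> A then 1 else -1) * f n)"
  have g: "g \<in> S" "nS g = nS f"
    unfolding g_def by (rule sign_change[OF f]; simp)+
  have eq: "restr A f = seq_scale (of_real (1 / 2)) f + seq_scale (of_real (1 - 1 / 2)) g"
    by (auto simp: restr_def g_def fun_eq_iff field_simps)
  show "restr A f \<in> S" unfolding eq using f g by (intro V_add V_scale)
  show "nS (restr A f) \<le> nS f" unfolding eq using f g by (intro nS_convex) auto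
qed

text \<open>One coordinate at a time: \<open>c i\<close> is \<open>norm (c i)\<close> times a
  unimodular \<open>u\<close>, so the new vector is a convex combination of a rotated vector and the
  vector with coordinate \<open>i\<close> deleted.\<close>

lemma finite_contraction:
  assumes "finite A" "f \<in> S" "\<And>j. j \<in> A \<Longrightarrow> norm (c j) \<le> 1"
  shows "(\<lambda>j. if j \<in> A then c j * f j else f j) \<in> S \<and>
    nS (\<lambda>j. if j \<in> A then c j * f j else f j) \<le> nS f"
  using assms
proof (induction A rule: finite_induct)
  case empty
  then show ?case by simp
next
  case (insert i A)
  define g where "g = (\<lambda>j. if j \<in> A then c j * f j else f j)"
  have g: "g \<in> S" "nS g \<le> nS f" using insert unfolding g_def by auto
  \<comment> \<open>The value 1 for \<open>c i = 0\<close> keeps \<open>u\<close>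
    unimodular.\<close>
  define u where "u = (if c i = 0 then 1 else c i / of_real (norm (c i)))"
  have u: "norm u = 1" "of_real (norm (c i)) * u = c i"
    unfolding u_def by (auto simp: norm_divide)
  define g' where "g' = (\<lambda>j. (if j = i then u else 1) * g j)"
  have g': "g' \<in> S" "nS g' = nS g"
    unfolding g'_def using u g by (intro sign_change; simp)+
  have eq: "(\<lambda>j. if j \<in> insert i A then c j * f j else f j) =
    seq_scale (of_real (norm (c i))) g' + seq_scale (of_real (1 - norm (c i))) (restr (- {i}) g)"
  proof
    fix j
    have "of_real (norm (c i)) * (u * f i) = c i * f i"
      using u(2) by (metis mult.assoc)
    then show "(if j \<in> insert i A then c j * f j else f j) = (seq_scale (of_real (norm (c i))) g'
      + seq_scale (of_real (1 - norm (c i))) (restr (- {i}) g)) j"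
      using insert.hyps by (auto simp: g'_def g_def restr_def algebra_simps)
  qed
  note s = suppression[OF g(1), of "- {i}"]
  show ?case unfolding eq using g g' s insert.prems
    by (intro conjI V_add V_scale nS_convex) auto
qed

text \<open>On \<open>A\<close> the quotients \<open>f j / g j\<close> are multipliers of modulus at
  most 1. Where \<open>g j\<close> vanishes so does \<open>f j\<close>, and division by zero yields
  the correct value 0.\<close>

lemma lattice:
  assumes A: "finite A" and g: "g \<in> S" and dom: "\<And>j. j \<in> A \<Longrightarrow> norm (f j) \<le> norm (g j)"
  shows "nS (restr A f) \<le> nS g"
proof -
  have eq: "restr A f = restr A (\<lambda>j. if j \<in> A then f j / g j * g j else g j)"
  proof
    fix j
    show "restr A f j = restr A (\<lambda>j. if j \<in> A then f j / g j * g j else g j) j"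
      using dom[of j] by (cases "g j = 0") (auto simp: restr_def)
  qed
  have c: "(\<lambda>j. if j \<in> A then f j / g j * g j else g j) \<in> S \<and>
    nS (\<lambda>j. if j \<in> A then f j / g j * g j else g j) \<le> nS g"
    using A g by (rule finite_contraction) (auto simp: norm_divide divide_le_eq dom)
  then show ?thesis unfolding eq using suppression[of _ A] by (meson order_trans)
qed

lemma restr_in_S: "finite A \<Longrightarrow> restr A f \<in> S"
  using restr_in_c00 c00_subset by blast

section \<open>The fundamental function of the subsymmetric space\<close>

abbreviation \<Lambda> :: "nat \<Rightarrow> real" where "\<Lambda> \<equiv> Lam nS"

text \<open>Spreading the indicator of an initial segment along an increasing map that carries it
  onto \<open>A\<close> preserves the norm.\<close>

lemma nS_indicator:
  assumes A: "finite A"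
  shows "nS (restr A (\<lambda>_. 1)) = \<Lambda> (card A)"
proof -
  obtain \<phi> :: "nat \<Rightarrow> nat" where \<phi>: "strict_mono \<phi>" "\<phi> ` {..<card A} = A"
    using exists_strict_mono_image[OF A] by blast
  let ?f = "restr {..<card A} (\<lambda>_. 1) :: nat \<Rightarrow> 'k"
  obtain g where g: "g \<in> S" "nS g = nS ?f" "\<And>j. g (\<phi> j) = 1 * ?f j"
      "\<And>i. i \<notin> range \<phi> \<Longrightarrow> g i = 0"
    using spread[OF restr_in_S _ \<phi>(1), of "{..<card A}" "\<lambda>_. 1" "\<lambda>_. 1"] by auto
  have "g i = restr A (\<lambda>_. 1) i" for i
  proof (cases "i \<in> range \<phi>")
    case True
    then obtain j where j: "i = \<phi> j" by blast
    have "\<phi> j \<in> A \<longleftrightarrow> j < card A"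
      using \<phi>(2) strict_mono_imp_inj_on[OF \<phi>(1)] by (metis image_iff inj_eq lessThan_iff)
    then show ?thesis using g(3)[of j] by (simp add: j restr_def)
  next
    case False
    then have "i \<notin> A" using \<phi>(2) by blast
    then show ?thesis using g(4)[OF False] by (simp add: restr_def)
  qed
  then have "g = restr A (\<lambda>_. 1)" by blast
  moreover have "?f = (\<Sum>n<card A. unit_vec n)"
    by (simp add: restr_eq_sum del: seq_scale_apply)
  ultimately show ?thesis using g(2) unfolding Lam_def by simp
qed

lemma Lam_mono: "m \<le> n \<Longrightarrow> \<Lambda> m \<le> \<Lambda> n"
proof -
  assume "m \<le> n"
  then have "restr {..<m} (\<lambda>_. 1) = restr {..<m} (restr {..<n} (\<lambda>_. 1 :: 'k))"
    by (auto simp: restr_def fun_eq_iff)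
  then show "\<Lambda> m \<le> \<Lambda> n"
    using suppression(2)[OF restr_in_S, of "{..<n}" "{..<m}" "\<lambda>_. 1"]
      nS_indicator[of "{..<m}"] nS_indicator[of "{..<n}"] by simp
qed

lemma Lam_pos: "1 \<le> m \<Longrightarrow> 0 < \<Lambda> m"
proof -
  assume m: "1 \<le> m"
  have "unit_vec 0 \<noteq> (0 :: nat \<Rightarrow> 'k)" by (auto simp: unit_vec_def fun_eq_iff)
  then have "0 < \<Lambda> 1"
    using q_eq_0_iff[OF y_in_V, of 0] q_nonneg[OF y_in_V, of 0] by (simp add: Lam_def)
  then show ?thesis using Lam_mono[OF m] by simp
qed

lemma Lam_nonneg: "0 \<le> \<Lambda> m"
  unfolding Lam_def by (intro q_nonneg V_sum y_in_V)

lemma Lam_mult_le: "\<Lambda> (k * m) \<le> real k * \<Lambda> m"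
proof (induction k)
  case 0
  then show ?case by (simp add: Lam_def)
next
  case (Suc k)
  have "restr {..<Suc k * m} (\<lambda>_. 1) =
    restr {..<k * m} (\<lambda>_. 1) + restr {k * m..<Suc k * m} (\<lambda>_. 1 :: 'k)"
    by (auto simp: restr_def fun_eq_iff)
  then have "nS (restr {..<Suc k * m} (\<lambda>_. 1)) \<le>
    nS (restr {..<k * m} (\<lambda>_. 1)) + nS (restr {k * m..<Suc k * m} (\<lambda>_. 1))"
    using triangle[OF restr_in_S restr_in_S] by simp
  then have "\<Lambda> (Suc k * m) \<le> \<Lambda> (k * m) + \<Lambda> m" by (simp add: nS_indicator)
  then show ?case using Suc by (simp add: algebra_simps)
qed

lemma nS_upper:
  assumes A: "finite A" and t: "0 \<le> t" and f: "\<And>j. j \<in> A \<Longrightarrow> norm (f j) \<le> t"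
  shows "nS (restr A f) \<le> t * \<Lambda> (card A)"
proof -
  have "nS (restr A f) \<le> nS (seq_scale (of_real t) (restr A (\<lambda>_. 1)))"
    using A f t by (intro lattice V_scale restr_in_S) (auto simp: restr_apply)
  also have "\<dots> = t * \<Lambda> (card A)"
    using A t by (simp add: q_scale restr_in_S nS_indicator)
  finally show ?thesis .
qed

lemma nS_lower:
  assumes A: "finite A" and t: "0 \<le> t" and f: "f \<in> S" "\<And>j. j \<in> A \<Longrightarrow> t \<le> norm (f j)"
  shows "t * \<Lambda> (card A) \<le> nS f"
proof -
  have "t * \<Lambda> (card A) = nS (seq_scale (of_real t) (restr A (\<lambda>_. 1)))"
    using A t by (simp add: q_scale restr_in_S nS_indicator)
  also have "seq_scale (of_real t) (restr A (\<lambda>_. 1)) = restr A (\<lambda>_. of_real t)"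
    by (auto simp: restr_def fun_eq_iff)
  also have "nS \<dots> \<le> nS f" using A f t by (intro lattice) auto
  finally show ?thesis .
qed

text \<open>
  Compress \<open>restr A f\<close> to \<open>{..<k}\<close>, where \<open>k = card A\<close>. In the sum of its first \<open>2 * k\<close> translates, which
  all have the same norm, each of the \<open>k\<close> coordinates \<open>k, \<dots>, 2 * k - 1\<close> equals \<open>\<Sum>j\<in>A. f j\<close>.
\<close>

lemma sum_bound:
  assumes A: "finite A" and f: "f \<in> S"
  shows "norm (\<Sum>j\<in>A. f j) * \<Lambda> (card A) \<le> 2 * real (card A) * nS f"
proof -
  define k where "k = card A"
  obtain \<phi> :: "nat \<Rightarrow> nat" where \<phi>: "strict_mono \<phi>" "\<phi> ` {..<k} = A"
    using exists_strict_mono_image[OF A] unfolding k_def by blast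
  define b where "b = restr {..<k} (\<lambda>i. f (\<phi> i))"
  have b: "b \<in> S" unfolding b_def by (intro restr_in_S) simp
  have inj: "inj \<phi>" using \<phi>(1) by (rule strict_mono_imp_inj_on)
  \<comment> \<open>Spreading \<open>b\<close> back along \<open>\<phi>\<close> gives
    \<open>restr A f\<close>, to which suppression applies.\<close>
  have "nS b \<le> nS f"
  proof -
    obtain g where g: "g \<in> S" "nS g = nS b" "\<And>j. g (\<phi> j) = 1 * b j"
        "\<And>i. i \<notin> range \<phi> \<Longrightarrow> g i = 0"
      using spread[OF b _ \<phi>(1), of "\<lambda>_. 1"] by auto
    have "g i = restr A f i" for i
    proof (cases "i \<in> range \<phi>")
      case True
      then obtain j where j: "i = \<phi> j" by blast
      have "\<phi> j \<in> A \<longleftrightarrow> j < k" using \<phi>(2) inj by (metis image_iff inj_eq lessThan_iff)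
      then show ?thesis using g(3)[of j] by (simp add: j restr_def b_def)
    next
      case False
      then have "i \<notin> A" using \<phi>(2) by blast
      then show ?thesis using g(4)[OF False] by (simp add: restr_def)
    qed
    then have "g = restr A f" by blast
    then show ?thesis using g(2) suppression(2)[OF f, of A] by simp
  qed
  define g where "g s = (\<lambda>i. if s \<le> i then b (i - s) else 0)" for s
  have g: "g s \<in> S" "nS (g s) = nS b" for s
  proof -
    have "strict_mono (\<lambda>j::nat. j + s)" by (simp add: strict_mono_def)
    from spread[OF b _ this, of "\<lambda>_. 1"] obtain h where
      h: "h \<in> S" "nS h = nS b" "\<And>j. h (j + s) = b j" "\<And>i. i \<notin> range (\<lambda>j. j + s) \<Longrightarrow> h i = 0"
      by auto
    have "h i = g s i" for i
    proof (cases "s \<le> i")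
      case True
      then show ?thesis using h(3)[of "i - s"] by (simp add: g_def)
    next
      case False
      then have "i \<notin> range (\<lambda>j. j + s)" by auto
      then show ?thesis using h(4) False by (simp add: g_def)
    qed
    then have "h = g s" by blast
    then show "g s \<in> S" "nS (g s) = nS b" using h by auto
  qed
  have "nS (\<Sum>s<n. g s) \<le> real n * nS b" for n
  proof (induction n)
    case (Suc n)
    have "nS (\<Sum>s<Suc n. g s) \<le> nS (\<Sum>s<n. g s) + nS (g n)"
      using triangle[OF V_sum g(1), of "{..<n}" g n] g(1) by simp
    also have "\<dots> \<le> real n * nS b + nS b" using Suc g(2)[of n] by simp
    also have "\<dots> = real (Suc n) * nS b" by (simp add: algebra_simps)
    finally show ?case .
  next
    case 0
    show ?case by (simp only: lessThan_0 sum.empty q_0 of_nat_0 mult_zero_left order_refl)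
  qed
  then have upper: "nS (\<Sum>s<2 * k. g s) \<le> real (2 * k) * nS f"
    using \<open>nS b \<le> nS f\<close> by (meson mult_left_mono of_nat_0_le_iff order_trans)
  \<comment> \<open>All shifts \<open>s \<le> i\<close> are available because
    \<open>i < 2 * k\<close>, and \<open>i - s\<close> runs over all of \<open>{..<k}\<close>, which
    contains the support of \<open>b\<close>, because \<open>k \<le> i\<close>.\<close>
  have coord: "(\<Sum>s<2 * k. g s) i = (\<Sum>j\<in>A. f j)" if "i \<in> {k..<2 * k}" for i
  proof -
    have "(\<Sum>s<2 * k. g s) i = (\<Sum>s<2 * k. if s \<le> i then b (i - s) else 0)"
      by (simp add: sum_fun_apply g_def)
    also have "\<dots> = (\<Sum>s\<in>{..i}. b (i - s))"
      using that by (intro sum.mono_neutral_cong_right) auto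
    also have "\<dots> = (\<Sum>s\<le>i. b s)"
      using sum.nat_diff_reindex[of b "Suc i"] by (simp add: lessThan_Suc_atMost)
    also have "\<dots> = (\<Sum>s<k. f (\<phi> s))"
      using that by (intro sum.mono_neutral_cong_right) (auto simp: b_def restr_def)
    also have "\<dots> = (\<Sum>j\<in>A. f j)"
      unfolding \<phi>(2)[symmetric] using inj by (simp add: sum.reindex inj_on_subset)
    finally show ?thesis .
  qed
  have "norm (\<Sum>j\<in>A. f j) * \<Lambda> (card {k..<2 * k}) \<le> nS (\<Sum>s<2 * k. g s)"
    by (rule nS_lower) (auto simp: coord intro: V_sum g)
  then show ?thesis using upper by (simp add: k_def)
qed

end

section \<open>Geometric growth along the partition\<close>

text \<open>Halving after every \<open>J\<close> steps is geometric decay whose ratio is the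
  \<open>J\<close>-th root of 1/2; \<open>D\<close> controls the fewer than \<open>J\<close> steps
  left over.\<close>

lemma geometric_decay:
  fixes w :: "nat \<Rightarrow> real"
  assumes w: "\<And>r. 0 \<le> w r" and J: "1 \<le> J" "\<And>r. w (r + J) \<le> w r / 2"
    and D: "\<And>r j. w (r + j) \<le> D * w r" "0 \<le> D"
  shows "\<exists>\<rho> C. 0 < \<rho> \<and> \<rho> < 1 \<and> 0 \<le> C \<and> (\<forall>r j. w (r + j) \<le> C * \<rho> ^ j * w r)"
proof -
  define \<rho> where "\<rho> = root J (1 / 2)"
  have \<rho>J: "\<rho> ^ J = 1 / 2" unfolding \<rho>_def using J by simp
  have \<rho>: "0 < \<rho>" "\<rho> < 1" unfolding \<rho>_def using J by auto
  have iter: "w (r + J * k) \<le> (1 / 2) ^ k * w r" for r k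
  proof (induction k)
    case (Suc k)
    have "w (r + J * Suc k) \<le> w (r + J * k) / 2"
      using J(2)[of "r + J * k"] by (simp add: ac_simps)
    then show ?case using Suc by simp
  qed simp
  have "w (r + j) \<le> 2 * D * \<rho> ^ j * w r" for r j
  proof -
    have "w (r + j) = w (r + J * (j div J) + j mod J)" by (simp add: add.assoc)
    also have "\<dots> \<le> D * w (r + J * (j div J))" by (rule D)
    also have "\<dots> \<le> D * ((1 / 2) ^ (j div J) * w r)" using iter D by (intro mult_left_mono)
    \<comment> \<open>The factor 2 pays for the remainder \<open>j mod J\<close>, over which the
      power of \<open>\<rho>\<close> drops by a factor of at most 2.\<close>
    also have "(1 / 2) ^ (j div J) \<le> 2 * \<rho> ^ j"
    proof -
      have "\<rho> ^ J \<le> \<rho> ^ (j mod J)"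
        using \<rho> J by (intro power_decreasing) (auto intro: less_imp_le)
      then have "(1 / 2) ^ (j div J) * (1 / 2) \<le> (1 / 2) ^ (j div J) * \<rho> ^ (j mod J)"
        unfolding \<rho>J by (intro mult_left_mono) auto
      also have "\<dots> = \<rho> ^ (J * (j div J) + j mod J)"
        unfolding power_add power_mult \<rho>J ..
      finally show ?thesis by simp
    qed
    finally show ?thesis using D w
      by (simp add: algebra_simps mult_left_mono mult_right_mono)
  qed
  then show ?thesis using \<rho> D by (intro exI[of _ \<rho>] exI[of _ "2 * D"]) auto
qed

text \<open>The index \<open>r\<close> locates \<open>m\<close> among the sums of block lengths. The
  first two inequalities serve the upper democracy estimate, the third the lower one, and the last
  three the projections onto blocks from \<open>r\<close> on.\<close>

definition block_estimates :: "(nat \<Rightarrow> real) \<Rightarrow> (nat \<Rightarrow> nat) \<Rightarrow> real \<Rightarrow> real \<Rightarrow> bool" where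
  "block_estimates \<Gamma> N \<rho> C \<longleftrightarrow> (\<forall>m r n. 1 \<le> m \<longrightarrow>
    ((\<Sum>n<r. N n) \<le> m \<longrightarrow> n < r \<longrightarrow> \<Gamma> (N n) \<le> C * \<rho> ^ (r - 1 - n) * \<Gamma> m) \<and>
    (m \<le> (\<Sum>n<Suc r. N n) \<longrightarrow> r \<le> n \<longrightarrow>
      real m * \<Gamma> (N n) \<le> C * \<rho> ^ (n - r) * \<Gamma> m * real (N n) \<and>
      \<Gamma> m \<le> C * \<rho> ^ (n - r) * \<Gamma> (N n) \<and>
      real m \<le> C * \<rho> ^ (n - r) * real (N n)))"

section \<open>The regularity properties along the blocks\<close>

context lc_subsymmetric_space
begin

text \<open>Up to a factor 2, \<open>\<Lambda> n / n\<close> is decreasing: \<open>n\<close> points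
  are covered by \<open>n div m + 1\<close> sets of \<open>m\<close> points, and
  \<open>m * (n div m + 1) \<le> 2 * n\<close>.\<close>

lemma Lam_ratio: "1 \<le> m \<Longrightarrow> m \<le> n \<Longrightarrow> real m * \<Lambda> n \<le> 2 * real n * \<Lambda> m"
proof -
  assume m: "1 \<le> m" "m \<le> n"
  define k where "k = n div m + 1"
  have "n \<le> k * m"
  proof -
    have "n = n div m * m + n mod m" by simp
    also have "\<dots> \<le> n div m * m + m" using m by (intro add_left_mono less_imp_le) simp
    finally show ?thesis by (simp add: k_def)
  qed
  then have "\<Lambda> n \<le> real k * \<Lambda> m" using Lam_mono Lam_mult_le order_trans by blast
  then have "real m * \<Lambda> n \<le> real (m * k) * \<Lambda> m"
    by (simp add: mult.assoc mult_left_mono)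
  also have "m * k \<le> 2 * n"
  proof -
    have "m * k = m * (n div m) + m" by (simp add: k_def)
    then show ?thesis using m times_div_less_eq_dividend[of m n] by linarith
  qed
  then have "real (m * k) * \<Lambda> m \<le> real (2 * n) * \<Lambda> m"
    using Lam_nonneg by (intro mult_right_mono) (simp_all only: of_nat_le_iff)
  finally show ?thesis by simp
qed

text \<open>The growth hypothesis makes the sums of block lengths grow exponentially while staying
  comparable with their last block. The LRP then gives geometric decay of
  \<open>1 / \<Lambda> (T r)\<close> and the URP that of \<open>\<Lambda> (T r) / T r\<close>;
  comparability carries both from \<open>T\<close> to \<open>N\<close>.\<close>

lemma exists_block_estimates:
  assumes LRP: "LRP \<Lambda>" and URP: "URP \<Lambda>" and N: "\<And>n. 1 \<le> N n"
    and growth: "\<exists>C. \<forall>r\<ge>1. real (\<Sum>n<r. N n) \<le> C * real (N r)"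
  shows "\<exists>\<rho> C. 0 < \<rho> \<and> \<rho> < 1 \<and> 1 \<le> C \<and> block_estimates \<Lambda> N \<rho> C"
proof -
  define M where "M r = (\<Sum>n<r. N n)" for r
  \<comment> \<open>Shifting the index by one avoids the value \<open>M 0 = 0\<close>.\<close>
  define T where "T r = M (Suc r)" for r
  obtain C where C: "\<And>r. 1 \<le> r \<Longrightarrow> real (M r) \<le> C * real (N r)"
    using growth unfolding M_def by blast
  obtain c where c: "max 1 C \<le> real c" using real_arch_simple by blast
  have c1: "1 \<le> c" using c by simp
  have Mc: "M r \<le> c * N r" for r
  proof (cases "r = 0")
    case False
    then have "real (M r) \<le> C * real (N r)" using C by simp
    also have "\<dots> \<le> real c * real (N r)" using c by (intro mult_right_mono) auto
    finally have "real (M r) \<le> real (c * N r)" by simp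
    then show ?thesis by (simp only: of_nat_le_iff)
  qed (simp add: M_def)
  have T_Suc: "T (Suc r) = T r + N (Suc r)" for r unfolding T_def M_def by simp
  have NT: "N r \<le> T r" "T r \<le> (c + 1) * N r" for r
    using Mc[of r] unfolding T_def M_def by (auto simp: algebra_simps)
  have T_pos: "1 \<le> T r" for r using N[of r] NT[of r] by linarith
  have T_mono: "T r \<le> T (r + j)" for r j by (induction j) (auto simp: T_Suc)
  \<comment> \<open>Since \<open>T (r + j)\<close> is at most \<open>c\<close> times the next block,
    adding that block multiplies the sum by at least \<open>1 + 1 / c\<close>.\<close>
  have T_geom: "(1 + 1 / real c) ^ j * real (T r) \<le> real (T (r + j))" for r j
  proof (induction j)
    case (Suc j)
    have "real (T (r + j)) \<le> real c * real (N (Suc (r + j)))"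
      using Mc[of "Suc (r + j)"] unfolding T_def by (metis of_nat_le_iff of_nat_mult)
    then have "real (T (r + j)) / real c \<le> real (N (Suc (r + j)))"
      using c1 by (simp add: field_simps)
    then have "(1 + 1 / real c) * real (T (r + j)) \<le> real (T (r + Suc j))"
      by (simp add: T_Suc algebra_simps)
    moreover have "(1 + 1 / real c) * ((1 + 1 / real c) ^ j * real (T r)) \<le>
        (1 + 1 / real c) * real (T (r + j))"
      using Suc by (intro mult_left_mono) auto
    ultimately show ?case by simp
  qed simp
  \<comment> \<open>Exponential growth turns a dilation by \<open>b\<close> into a shift of the
    index by a fixed number of steps.\<close>
  have dilate: "\<exists>J\<ge>1. \<forall>r. b * T r \<le> T (r + J)" for b
  proof -
    obtain J where J: "real b < (1 + 1 / real c) ^ J"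
      using real_arch_pow[of "1 + 1 / real c" "real b"] c1 by auto
    have "b * T r \<le> T (r + Suc J)" for r
    proof -
      have "real b * real (T r) \<le> (1 + 1 / real c) ^ J * real (T r)"
        using J by (intro mult_right_mono) auto
      also have "\<dots> \<le> real (T (r + J))" by (rule T_geom)
      finally have "b * T r \<le> T (r + J)" by (metis of_nat_le_iff of_nat_mult)
      also have "\<dots> \<le> T (r + Suc J)" by (simp add: T_Suc)
      finally show ?thesis .
    qed
    then show ?thesis by (intro exI[of _ "Suc J"]) auto
  qed
  have \<Lambda>T: "0 < \<Lambda> (T r)" for r using Lam_pos T_pos by blast
  obtain b where b: "\<And>m. 1 \<le> m \<Longrightarrow> 2 * \<Lambda> m \<le> \<Lambda> (b * m)"
    using LRP unfolding LRP_def by blast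
  obtain J where J: "1 \<le> J" "\<And>r. b * T r \<le> T (r + J)" using dilate by blast
  have "\<exists>\<rho> C. 0 < \<rho> \<and> \<rho> < 1 \<and> 0 \<le> C \<and>
    (\<forall>r j. 1 / \<Lambda> (T (r + j)) \<le> C * \<rho> ^ j * (1 / \<Lambda> (T r)))"
  proof (rule geometric_decay[OF _ J(1), where D = 1])
    fix r j
    show "0 \<le> 1 / \<Lambda> (T r)" using \<Lambda>T[of r] by simp
    have "2 * \<Lambda> (T r) \<le> \<Lambda> (T (r + J))"
      using b[OF T_pos, of r] Lam_mono[OF J(2), of r] by linarith
    then show "1 / \<Lambda> (T (r + J)) \<le> 1 / \<Lambda> (T r) / 2"
      using \<Lambda>T[of r] \<Lambda>T[of "r + J"] by (simp add: field_simps)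
    show "1 / \<Lambda> (T (r + j)) \<le> 1 * (1 / \<Lambda> (T r))"
      using Lam_mono[OF T_mono, of r j] \<Lambda>T[of r] \<Lambda>T[of "r + j"] by (simp add: field_simps)
  qed simp
  then obtain \<rho>1 C1 where 1: "0 < \<rho>1" "\<rho>1 < 1" "0 \<le> C1"
    "\<And>r j. 1 / \<Lambda> (T (r + j)) \<le> C1 * \<rho>1 ^ j * (1 / \<Lambda> (T r))" by blast
  obtain d where d: "1 \<le> d" "\<And>m. 1 \<le> m \<Longrightarrow> 2 * \<Lambda> (d * m) \<le> real d * \<Lambda> m"
    using URP unfolding URP_def by blast
  \<comment> \<open>The URP is applied twice: the factor 1/4 it gives outweighs the factor 2 lost in
    \<open>ratio\<close> and leaves 1/2.\<close>
  obtain J2 where J2: "1 \<le> J2" "\<And>r. d * d * T r \<le> T (r + J2)" using dilate by blast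
  have ratio: "\<Lambda> n / real n \<le> 2 * (\<Lambda> m / real m)" if "1 \<le> m" "m \<le> n" for m n
    using Lam_ratio[OF that] that by (simp add: field_simps)
  have "\<exists>\<rho> C. 0 < \<rho> \<and> \<rho> < 1 \<and> 0 \<le> C \<and>
    (\<forall>r j. \<Lambda> (T (r + j)) / real (T (r + j)) \<le> C * \<rho> ^ j * (\<Lambda> (T r) / real (T r)))"
  proof (rule geometric_decay[OF _ J2(1), where D = 2])
    fix r j
    show "0 \<le> \<Lambda> (T r) / real (T r)" using Lam_nonneg by simp
    have "\<Lambda> (T (r + J2)) / real (T (r + J2)) \<le> 2 * (\<Lambda> (d * d * T r) / real (d * d * T r))"
      using T_pos[of r] d(1) by (intro ratio J2) (simp add: Suc_le_eq)
    also have "\<dots> \<le> \<Lambda> (T r) / real (T r) / 2"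
    proof -
      have "2 * \<Lambda> (d * (d * T r)) \<le> real d * \<Lambda> (d * T r)"
        using T_pos[of r] d(1) by (intro d(2)) (simp add: Suc_le_eq)
      moreover have "real d * (2 * \<Lambda> (d * T r)) \<le> real d * (real d * \<Lambda> (T r))"
        by (intro mult_left_mono d(2) T_pos) simp
      ultimately have "4 * \<Lambda> (d * d * T r) \<le> real d * real d * \<Lambda> (T r)"
        by (simp add: mult.assoc)
      moreover have "0 < real d" "0 < real (T r)" using d(1) T_pos[of r] by auto
      ultimately show ?thesis by (simp add: field_simps)
    qed
    finally show "\<Lambda> (T (r + J2)) / real (T (r + J2)) \<le> \<Lambda> (T r) / real (T r) / 2" .
    show "\<Lambda> (T (r + j)) / real (T (r + j)) \<le> 2 * (\<Lambda> (T r) / real (T r))"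
      by (intro ratio T_pos T_mono)
  qed simp
  then obtain \<rho>2 C2 where 2: "0 < \<rho>2" "\<rho>2 < 1" "0 \<le> C2"
    "\<And>r j. \<Lambda> (T (r + j)) / real (T (r + j)) \<le> C2 * \<rho>2 ^ j * (\<Lambda> (T r) / real (T r))" by blast
  define \<rho> where "\<rho> = max \<rho>1 \<rho>2"
  have \<rho>: "0 < \<rho>" "\<rho> < 1" unfolding \<rho>_def using 1 2 by auto
  have \<rho>12: "\<rho>1 ^ j \<le> \<rho> ^ j" "\<rho>2 ^ j \<le> \<rho> ^ j" for j
    unfolding \<rho>_def using 1 2 by (auto intro: power_mono)
  define D where "D = 1 + (real c + 1) * (C1 + 2 * C2)"
  have D: "1 \<le> D" unfolding D_def using 1 2 by simp
  have D1: "(real c + 1) * C1 \<le> D" "C1 \<le> D"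
  proof -
    have "C1 \<le> (real c + 1) * C1" using 1(3) by (simp add: algebra_simps)
    moreover have "(real c + 1) * C1 \<le> (real c + 1) * (C1 + 2 * C2)"
      using 2(3) by (intro mult_left_mono) auto
    ultimately show "(real c + 1) * C1 \<le> D" "C1 \<le> D" unfolding D_def by linarith+
  qed
  have D2: "(real c + 1) * C2 * 2 \<le> D"
    unfolding D_def using 1 2 by (simp add: algebra_simps)
  have G1: "\<Lambda> (T r) \<le> C1 * \<rho> ^ j * \<Lambda> (T (r + j))" for r j
  proof -
    have "\<Lambda> (T r) \<le> C1 * \<rho>1 ^ j * \<Lambda> (T (r + j))"
      using 1(4)[of r j] \<Lambda>T[of r] \<Lambda>T[of "r + j"] by (simp add: field_simps)
    also have "\<dots> \<le> C1 * \<rho> ^ j * \<Lambda> (T (r + j))"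
      using \<rho>12 1 Lam_nonneg by (intro mult_right_mono mult_left_mono) auto
    finally show ?thesis .
  qed
  have G2: "\<Lambda> (T (r + j)) / real (T (r + j)) \<le> C2 * \<rho> ^ j * (\<Lambda> (T r) / real (T r))" for r j
  proof -
    have "C2 * \<rho>2 ^ j * (\<Lambda> (T r) / real (T r)) \<le> C2 * \<rho> ^ j * (\<Lambda> (T r) / real (T r))"
      using \<rho>12 2 Lam_nonneg by (intro mult_right_mono mult_left_mono) auto
    then show ?thesis using 2(4)[of r j] by linarith
  qed
  have F1: "\<Lambda> (N n) \<le> D * \<rho> ^ (r - 1 - n) * \<Lambda> m" if m: "1 \<le> m" "M r \<le> m" "n < r" for m r n
  proof -
    \<comment> \<open>In this form, \<open>T (n + (r - 1 - n))\<close> is \<open>M r\<close>, which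
      is at most \<open>m\<close>.\<close>
    have r: "r = Suc (n + (r - 1 - n))" using m by simp
    have "\<Lambda> (N n) \<le> \<Lambda> (T n)" by (intro Lam_mono NT)
    also have "\<dots> \<le> C1 * \<rho> ^ (r - 1 - n) * \<Lambda> (T (n + (r - 1 - n)))" by (rule G1)
    also have "\<dots> \<le> D * \<rho> ^ (r - 1 - n) * \<Lambda> m"
      using D1 \<rho> 1(3) m(2) r Lam_nonneg D
      by (intro mult_mono Lam_mono) (auto simp: T_def)
    finally show ?thesis .
  qed
  have F2: "real m * \<Lambda> (N n) \<le> D * \<rho> ^ (n - r) * \<Lambda> m * real (N n)"
    and F3: "\<Lambda> m \<le> D * \<rho> ^ (n - r) * \<Lambda> (N n)"
    if m: "1 \<le> m" "m \<le> T r" "r \<le> n" for m r n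
  proof -
    have n: "n = r + (n - r)" using m by simp
    \<comment> \<open>Comparability replaces \<open>N n\<close> by \<open>T n\<close>, the decay
      leads from \<open>T n\<close> back to \<open>T r\<close>, and \<open>ratio\<close> leads from
      \<open>T r\<close> to \<open>m\<close>.\<close>
    have "real (T n) * \<Lambda> (N n) \<le> ((real c + 1) * real (N n)) * \<Lambda> (T n)"
    proof (intro mult_mono Lam_mono NT)
      show "real (T n) \<le> (real c + 1) * real (N n)"
        using NT(2)[of n] by (metis of_nat_1 of_nat_add of_nat_le_iff of_nat_mult)
    qed (auto intro: Lam_nonneg)
    then have "\<Lambda> (N n) \<le> (real c + 1) * real (N n) * (\<Lambda> (T n) / real (T n))"
      using T_pos[of n] by (simp add: field_simps)
    also have "\<Lambda> (T n) / real (T n) \<le> C2 * \<rho> ^ (n - r) * (\<Lambda> (T r) / real (T r))"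
      using G2[of r "n - r"] n by simp
    also have "\<Lambda> (T r) / real (T r) \<le> 2 * (\<Lambda> m / real m)" by (intro ratio m)
    finally have "\<Lambda> (N n) \<le>
      (real c + 1) * real (N n) * (C2 * \<rho> ^ (n - r) * (2 * (\<Lambda> m / real m)))"
      using 2(3) \<rho> by (simp add: mult_left_mono)
    then have "real m * \<Lambda> (N n) \<le> ((real c + 1) * C2 * 2) * (\<rho> ^ (n - r) * \<Lambda> m * real (N n))"
      using m by (simp add: field_simps)
    also have "\<dots> \<le> D * (\<rho> ^ (n - r) * \<Lambda> m * real (N n))"
      using D2 \<rho> Lam_nonneg by (intro mult_right_mono) auto
    finally show "real m * \<Lambda> (N n) \<le> D * \<rho> ^ (n - r) * \<Lambda> m * real (N n)"
      by (simp add: algebra_simps)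
    have "\<Lambda> m \<le> \<Lambda> (T r)" using m by (intro Lam_mono)
    also have "\<dots> \<le> C1 * \<rho> ^ (n - r) * \<Lambda> (T n)" using G1[of r "n - r"] n by simp
    also have "\<dots> \<le> C1 * \<rho> ^ (n - r) * ((real c + 1) * \<Lambda> (N n))"
    proof (intro mult_left_mono)
      have "\<Lambda> (T n) \<le> \<Lambda> ((c + 1) * N n)" by (intro Lam_mono NT)
      also have "\<dots> \<le> real (c + 1) * \<Lambda> (N n)" by (rule Lam_mult_le)
      finally show "\<Lambda> (T n) \<le> (real c + 1) * \<Lambda> (N n)" by (simp add: add.commute)
    qed (use 1 \<rho> in auto)
    also have "\<dots> = ((real c + 1) * C1) * (\<rho> ^ (n - r) * \<Lambda> (N n))" by (simp add: algebra_simps)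
    also have "\<dots> \<le> D * (\<rho> ^ (n - r) * \<Lambda> (N n))"
      using D1 \<rho> Lam_nonneg by (intro mult_right_mono) auto
    finally show "\<Lambda> m \<le> D * \<rho> ^ (n - r) * \<Lambda> (N n)" by (simp add: algebra_simps)
  qed
  have DD: "D \<le> D * D" using D by simp
  have enlarge: "D * \<rho> ^ j * y \<le> D * D * \<rho> ^ j * y" if "0 \<le> y" for j y
    using DD \<rho> that by (intro mult_right_mono) auto
  \<comment> \<open>Insert \<open>F3\<close> into \<open>F2\<close> and cancel
    \<open>\<Lambda> (N n)\<close>. Of the two decay factors one is bounded by 1; the two constants
    multiply to \<open>D * D\<close>.\<close>
  have F4: "real m \<le> D * D * \<rho> ^ (n - r) * real (N n)"
    if m: "1 \<le> m" "m \<le> T r" "r \<le> n" for m r n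
  proof -
    have "real m * \<Lambda> (N n) \<le> D * \<rho> ^ (n - r) * \<Lambda> m * real (N n)" by (rule F2[OF m])
    also have "\<dots> \<le> D * 1 * (D * \<rho> ^ (n - r) * \<Lambda> (N n)) * real (N n)"
      using F3[OF m] \<rho> D Lam_nonneg
      by (intro mult_right_mono mult_mono) (auto intro: power_le_one less_imp_le)
    finally have "real m * \<Lambda> (N n) \<le> (D * D * \<rho> ^ (n - r) * real (N n)) * \<Lambda> (N n)"
      by (simp add: algebra_simps)
    then show ?thesis using Lam_pos[OF N, of n] by simp
  qed
  have "block_estimates \<Lambda> N \<rho> (D * D)"
    unfolding block_estimates_def M_def[symmetric] T_def[symmetric]
  proof (intro allI impI conjI)
    fix m r n :: nat assume m: "1 \<le> m"
    show "\<Lambda> (N n) \<le> D * D * \<rho> ^ (r - 1 - n) * \<Lambda> m" if "M r \<le> m" "n < r"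
      using F1[OF m that] enlarge[OF Lam_nonneg] order_trans by blast
    assume r: "m \<le> T r" "r \<le> n"
    have "0 \<le> \<Lambda> m * real (N n)" using Lam_nonneg by simp
    from enlarge[OF this, of "n - r"] F2[OF m r]
    show "real m * \<Lambda> (N n) \<le> D * D * \<rho> ^ (n - r) * \<Lambda> m * real (N n)"
      by (simp add: mult.assoc)
    show "\<Lambda> m \<le> D * D * \<rho> ^ (n - r) * \<Lambda> (N n)"
      using F3[OF m r] enlarge[OF Lam_nonneg] order_trans by blast
    show "real m \<le> D * D * \<rho> ^ (n - r) * real (N n)" by (rule F4[OF m r])
  qed
  moreover have "1 \<le> D * D" using D DD by linarith
  ultimately show ?thesis using \<rho> by blast
qed

end

section \<open>Indexing an ordered partition\<close>

locale blocks =
  fixes \<sigma> :: "nat \<Rightarrow> nat set"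
  assumes partition: "ordered_partition \<sigma>"
begin

abbreviation N :: "nat \<Rightarrow> nat" where "N n \<equiv> card (\<sigma> n)"

text \<open>The same description occurs in \<open>P_proj\<close>, so that \<open>blk\<close> can be
  folded there.\<close>

definition blk :: "nat \<Rightarrow> nat" where "blk j = (THE n. j \<in> \<sigma> n)"

definition init :: "nat \<Rightarrow> nat set" where "init r = (\<Union>n<r. \<sigma> n)"

lemma finite_block [simp]: "finite (\<sigma> n)"
  using partition unfolding ordered_partition_def by blast

lemma block_nonempty [simp]: "\<sigma> n \<noteq> {}"
  using partition unfolding ordered_partition_def by blast

lemma N_pos: "1 \<le> N n"
  using partition unfolding ordered_partition_def by (simp add: Suc_le_eq card_gt_0_iff)

lemma in_block_iff: "j \<in> \<sigma> n \<longleftrightarrow> blk j = n"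
proof -
  have disj: "n = n'" if "j \<in> \<sigma> n" "j \<in> \<sigma> n'" for n n'
    using partition that unfolding ordered_partition_def disjoint_family_on_def by blast
  obtain n0 where "j \<in> \<sigma> n0" using partition unfolding ordered_partition_def by blast
  then have "j \<in> \<sigma> (blk j)" unfolding blk_def by (rule theI) (use disj \<open>j \<in> \<sigma> n0\<close> in blast)
  then show ?thesis using disj by blast
qed

lemma in_block: "j \<in> \<sigma> (blk j)"
  by (simp add: in_block_iff)

lemma in_init: "j \<in> init r \<longleftrightarrow> blk j < r"
  by (auto simp: init_def in_block_iff)

lemma finite_init [simp]: "finite (init r)"
  by (simp add: init_def)

lemma card_init: "card (init r) = (\<Sum>n<r. N n)"
  unfolding init_def using partition
  by (intro card_UN_disjoint) (auto simp: ordered_partition_def disjoint_family_on_def)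

text \<open>Block maxima increase, so a point of an earlier block lies below the minimum of every
  later one.\<close>

lemma blk_mono: "i \<le> j \<Longrightarrow> blk i \<le> blk j"
proof (rule ccontr)
  assume "i \<le> j" and lt: "\<not> blk i \<le> blk j"
  have step: "Max (\<sigma> n) < Min (\<sigma> (Suc n))" and ne: "\<sigma> n \<noteq> {}" for n
    using partition unfolding ordered_partition_def by auto
  have "Max (\<sigma> n) < Max (\<sigma> (Suc n))" for n
    using step[of n] Min_le[of "\<sigma> (Suc n)" "Max (\<sigma> (Suc n))"] Max_in[OF finite_block ne]
    by (meson finite_block less_le_trans)
  then have mono: "mono (\<lambda>n. Max (\<sigma> n))" by (intro mono_iff_le_Suc[THEN iffD2]) (auto intro: less_imp_le)
  obtain n where n: "blk i = Suc n" using lt by (cases "blk i") auto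
  have "j \<le> Max (\<sigma> (blk j))" by (simp add: in_block)
  also have "\<dots> \<le> Max (\<sigma> n)" using mono lt n by (intro monoD[OF mono]) auto
  also have "\<dots> < Min (\<sigma> (blk i))" using step n by simp
  also have "\<dots> \<le> i" by (simp add: in_block)
  finally show False using \<open>i \<le> j\<close> by simp
qed

lemma filterlim_blk: "filterlim blk sequentially sequentially"
  unfolding filterlim_at_top
proof
  fix r
  have "\<forall>j\<ge>Suc (Max (insert 0 (init r))). r \<le> blk j"
  proof (intro allI impI, rule ccontr)
    fix j assume j: "Suc (Max (insert 0 (init r))) \<le> j" "\<not> r \<le> blk j"
    then have "j \<le> Max (insert 0 (init r))" by (intro Max_ge) (auto simp: in_init)
    then show False using j by simp
  qed
  then show "\<forall>\<^sub>F j in sequentially. r \<le> blk j" unfolding eventually_sequentially by blast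
qed

text \<open>Every block has a point, so the sums of block lengths exceed any \<open>m\<close>; the
  least \<open>r\<close> with \<open>m\<close> below the sum of the first \<open>Suc r\<close>
  lengths works.\<close>

lemma exists_init:
  assumes "1 \<le> m"
  shows "\<exists>r. (\<Sum>n<r. N n) \<le> m \<and> m \<le> (\<Sum>n<Suc r. N n)"
proof -
  have "r \<le> (\<Sum>n<r. N n)" for r
  proof (induction r)
    case (Suc r)
    then show ?case using N_pos[of r] by simp
  qed simp
  then have "m < (\<Sum>n<Suc m. N n)" by (metis Suc_le_eq)
  then have ex: "\<exists>r. m < (\<Sum>n<Suc r. N n)" by blast
  define r where "r = (LEAST r. m < (\<Sum>n<Suc r. N n))"
  have "m < (\<Sum>n<Suc r. N n)" unfolding r_def using ex by (rule LeastI_ex)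
  moreover have "(\<Sum>n<r. N n) \<le> m"
  proof (cases r)
    case (Suc r')
    then show ?thesis using not_less_Least[of r' "\<lambda>r. m < (\<Sum>n<Suc r. N n)"] r_def by auto
  qed simp
  ultimately show ?thesis by (intro exI[of _ r]) simp
qed

end

section \<open>A concrete completion\<close>

lemma qCauchy_le:
  assumes "qCauchy q u" "\<And>m n. p (w m - w n) \<le> q (u m - u n)"
  shows "qCauchy p w"
  using assms unfolding qCauchy_def by (meson le_less_trans)

locale block_basis = X: schauder_space smul X qX x xs + S: lc_subsymmetric_space S nS + blocks \<sigma>
  for smul :: "'k::{real_normed_field, banach} \<Rightarrow> 'v::ab_group_add \<Rightarrow> 'v"
    and X qX x xs and S :: "(nat \<Rightarrow> 'k) set" and nS \<sigma> +
  assumes semi_normalized: "semi_normalized qX x"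
begin

abbreviation \<Lambda> where "\<Lambda> \<equiv> Lam nS"
abbreviation L where "L n \<equiv> \<Lambda> (N n)"
abbreviation v where "v \<equiv> v_star nS \<sigma>"
abbreviation P :: "(nat \<Rightarrow> 'k) \<Rightarrow> nat \<Rightarrow> 'k" where "P \<equiv> P_proj \<sigma>"
abbreviation Q :: "(nat \<Rightarrow> 'k) \<Rightarrow> nat \<Rightarrow> 'k" where "Q \<equiv> Q_proj \<sigma>"

lemma L_pos: "0 < L n"
  by (rule S.Lam_pos[OF N_pos])

text \<open>Writing \<open>P\<close> and \<open>Q\<close> through the coefficients reduces their
  algebra to that of the linear functionals \<open>v n\<close>.\<close>

lemma P_apply: "P f j = v (blk j) f / of_real (L (blk j))"
  using L_pos[of "blk j"] by (simp add: P_proj_def block_avg_def v_star_def blk_def[symmetric])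

lemma Q_apply: "Q f j = f j - v (blk j) f / of_real (L (blk j))"
  by (simp add: Q_proj_def P_apply)

lemma v_add: "v n (f + g) = v n f + v n g"
  by (simp add: v_star_def sum.distrib distrib_left)

lemma v_diff: "v n (f - g) = v n f - v n g"
  by (simp add: v_star_def sum_subtractf right_diff_distrib)

lemma v_scale: "v n (seq_scale c f) = c * v n f"
  by (simp add: v_star_def sum_distrib_left[symmetric])

lemma Q_add: "Q (f + g) = Q f + Q g"
  by (auto simp: Q_apply v_add fun_eq_iff add_divide_distrib)

lemma Q_diff: "Q (f - g) = Q f - Q g"
  by (auto simp: Q_apply v_diff fun_eq_iff diff_divide_distrib)

lemma Q_scale: "Q (seq_scale c f) = seq_scale c (Q f)"
  by (auto simp: Q_apply v_scale fun_eq_iff algebra_simps)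

text \<open>Block-constant sequences realize any prescribed coefficients. This lifts elements of
  \<open>X\<close> to sequences and shows that \<open>P\<close> keeps the coefficients.\<close>

lemma v_blockwise: "v n (\<lambda>j. c (blk j) / of_real (L (blk j))) = c n"
proof -
  have "(\<Sum>j\<in>\<sigma> n. c (blk j) / of_real (L (blk j))) = (\<Sum>j\<in>\<sigma> n. c n / of_real (L n))"
    by (intro sum.cong) (auto simp: in_block_iff)
  then show ?thesis using L_pos[of n] N_pos[of n] by (simp add: v_star_def)
qed

lemma v_P: "v n (P f) = v n f"
proof -
  have "P f = (\<lambda>j. v (blk j) f / of_real (L (blk j)))" by (auto simp: P_apply)
  then show ?thesis by (simp only: v_blockwise[of n "\<lambda>n. v n f"])
qed

lemma v_Q: "v n (Q f) = 0"
  by (simp add: Q_proj_def v_diff v_P)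

lemma v_restr: "v n (restr A f) = of_real (L n / real (N n)) * (\<Sum>j\<in>A \<inter> \<sigma> n. f j)"
proof -
  have "(\<Sum>j\<in>\<sigma> n. restr A f j) = (\<Sum>j\<in>A \<inter> \<sigma> n. f j)"
    by (rule sum.mono_neutral_cong_right) (auto simp: restr_def)
  then show ?thesis by (simp only: v_star_def)
qed

lemma v_restr_init: "v n (restr (init r) f) = (if n < r then v n f else 0)"
proof -
  have "(\<Sum>j\<in>\<sigma> n. restr (init r) f j) = (\<Sum>j\<in>\<sigma> n. if n < r then f j else 0)"
    by (intro sum.cong) (auto simp: restr_def in_init in_block_iff)
  then show ?thesis by (simp add: v_star_def)
qed

text \<open>\<open>init r\<close> is a union of whole blocks, so truncating to it does not change
  the averages of the blocks it keeps.\<close>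

lemma Q_restr_init: "Q (restr (init r) f) = restr (init r) (Q f)"
  by (auto simp: fun_eq_iff Q_apply v_restr_init restr_apply in_init)

section \<open>The sequence space that realizes the completion\<close>

definition Y :: "(nat \<Rightarrow> 'k) set" where
  "Y = {f. Q f \<in> S \<and> (\<exists>h\<in>X. \<forall>n. xs n h = v n f)}"

text \<open>On \<open>Y\<close> the description is proper, since the coordinates determine a vector
  of \<open>X\<close>.\<close>

definition hX :: "(nat \<Rightarrow> 'k) \<Rightarrow> 'v" where
  "hX f = (THE h. h \<in> X \<and> (\<forall>n. xs n h = v n f))"

definition qY :: "(nat \<Rightarrow> 'k) \<Rightarrow> real" where
  "qY f = nS (Q f) + qX (hX f)"

lemma
  assumes "Q f \<in> S" "h \<in> X" "\<And>n. xs n h = v n f"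
  shows in_YI: "f \<in> Y" and hX_eqI: "hX f = h"
proof -
  show "f \<in> Y" unfolding Y_def using assms by blast
  show "hX f = h"
    unfolding hX_def
    by (rule the_equality) (use assms in \<open>auto intro: X.ys_inject\<close>)
qed

lemma
  assumes "f \<in> Y"
  shows Q_in_S: "Q f \<in> S" and hX_in_X: "hX f \<in> X" and xs_hX: "xs n (hX f) = v n f"
proof -
  obtain h where h: "Q f \<in> S" "h \<in> X" "\<And>n. xs n h = v n f"
    using assms unfolding Y_def by blast
  from h show "Q f \<in> S" "hX f \<in> X" "xs n (hX f) = v n f"
    using hX_eqI[OF h] by auto
qed

lemma
  assumes "f \<in> Y" "g \<in> Y"
  shows Y_add: "f + g \<in> Y" and hX_add: "hX (f + g) = hX f + hX g"
  by (rule in_YI[where h = "hX f + hX g"] hX_eqI;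
      simp add: assms Q_add S.V_add X.V_add Q_in_S hX_in_X X.ys_add xs_hX v_add)+

lemma
  assumes "f \<in> Y" "g \<in> Y"
  shows Y_diff: "f - g \<in> Y" and hX_diff: "hX (f - g) = hX f - hX g"
  by (rule in_YI[where h = "hX f - hX g"] hX_eqI;
      simp add: assms Q_diff S.V_diff X.V_diff Q_in_S hX_in_X X.ys_diff xs_hX v_diff)+

lemma
  assumes "f \<in> Y"
  shows Y_scale: "seq_scale c f \<in> Y" and hX_scale: "hX (seq_scale c f) = smul c (hX f)"
  by (rule in_YI[where h = "smul c (hX f)"] hX_eqI;
      simp add: assms Q_scale S.V_scale X.V_scale Q_in_S hX_in_X X.ys_scale xs_hX v_scale)+

lemma
  shows Y_0: "0 \<in> Y" and hX_0: "hX 0 = 0"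
proof -
  have Q0: "Q 0 = 0" by (simp add: fun_eq_iff Q_apply v_star_def)
  show "0 \<in> Y" "hX 0 = 0"
    by (rule in_YI[where h = 0] hX_eqI; simp add: Q0 v_star_def)+
qed

lemma qY_nonneg: "f \<in> Y \<Longrightarrow> 0 \<le> qY f"
  unfolding qY_def by (intro add_nonneg_nonneg S.q_nonneg X.q_nonneg Q_in_S hX_in_X)

lemma nS_Q_le: "f \<in> Y \<Longrightarrow> nS (Q f) \<le> qY f"
  unfolding qY_def using X.q_nonneg[OF hX_in_X] by simp

lemma qX_hX_le: "f \<in> Y \<Longrightarrow> qX (hX f) \<le> qY f"
  unfolding qY_def using S.q_nonneg[OF Q_in_S] by simp

lemma coordinate_bounded: "\<exists>C. \<forall>f\<in>Y. norm (f j) \<le> C * qY f"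
proof -
  obtain C where C: "\<And>f. f \<in> S \<Longrightarrow> norm (f j) \<le> C * nS f"
    using S.ys_bounded[of j] unfolding bounded_functional_def by blast
  obtain D where D: "\<And>h. h \<in> X \<Longrightarrow> norm (xs (blk j) h) \<le> D * qX h"
    using X.ys_bounded[of "blk j"] unfolding bounded_functional_def by blast
  have "norm (f j) \<le> (max 0 C + max 0 D / L (blk j)) * qY f" if f: "f \<in> Y" for f
  proof -
    have "f j = Q f j + v (blk j) f / of_real (L (blk j))" by (simp add: Q_apply)
    then have "norm (f j) \<le> norm (Q f j) + norm (v (blk j) f) / L (blk j)"
      using L_pos[of "blk j"] by (metis abs_of_pos norm_divide norm_of_real norm_triangle_ineq)
    also have "norm (Q f j) \<le> max 0 C * qY f"
    proof -
      have "norm (Q f j) \<le> C * nS (Q f)" using C Q_in_S f by blast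
      also have "\<dots> \<le> max 0 C * qY f"
        using nS_Q_le[OF f] S.q_nonneg[OF Q_in_S[OF f]] by (intro mult_mono) auto
      finally show ?thesis .
    qed
    also have "norm (v (blk j) f) \<le> max 0 D * qY f"
    proof -
      have "norm (v (blk j) f) \<le> D * qX (hX f)"
        using D[OF hX_in_X[OF f]] by (simp add: xs_hX f)
      also have "\<dots> \<le> max 0 D * qY f"
        using qX_hX_le[OF f] X.q_nonneg[OF hX_in_X[OF f]] by (intro mult_mono) auto
      finally show ?thesis .
    qed
    finally show ?thesis
      using L_pos[of "blk j"] by (simp add: divide_right_mono algebra_simps)
  qed
  then show ?thesis by blast
qed

text \<open>Both components of a Cauchy sequence converge. The limit is rebuilt from them: the limit
  \<open>a\<close> of the \<open>Q\<close> parts plus a block-constant sequence whose coefficients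
  are those of the limit \<open>h\<close> in \<open>X\<close>.\<close>

lemma Y_complete:
  assumes u: "range u \<subseteq> Y" and cauchy: "qCauchy qY u"
  shows "\<exists>f\<in>Y. qlim qY u f"
proof -
  have uY: "u n \<in> Y" for n using u by auto
  have "qCauchy nS (\<lambda>n. Q (u n))"
    using cauchy by (rule qCauchy_le) (use uY Y_diff nS_Q_le in \<open>simp flip: Q_diff\<close>)
  then obtain a where a: "a \<in> S" "qlim nS (\<lambda>n. Q (u n)) a"
    using S.complete_V[of "\<lambda>n. Q (u n)"] uY Q_in_S by blast
  have "qCauchy qX (\<lambda>n. hX (u n))"
    using cauchy by (rule qCauchy_le) (use uY Y_diff qX_hX_le in \<open>simp flip: hX_diff\<close>)
  then obtain h where h: "h \<in> X" "qlim qX (\<lambda>n. hX (u n)) h"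
    using X.complete_V[of "\<lambda>n. hX (u n)"] uY hX_in_X by blast
  define p where "p = (\<lambda>j. xs (blk j) h / of_real (L (blk j)))"
  \<comment> \<open>\<open>v n\<close> involves finitely many coordinates, each continuous on
    \<open>S\<close>, so vanishing block averages survive in the limit.\<close>
  have va: "v n a = 0" for n
  proof -
    have "(\<lambda>k. Q (u k) j) \<longlonglongrightarrow> a j" for j
      using uY Q_in_S a by (intro S.tendsto_apply) auto
    then have "(\<lambda>k. v n (Q (u k))) \<longlonglongrightarrow> v n a"
      unfolding v_star_def by (intro tendsto_intros)
    then have "(\<lambda>k. 0) \<longlonglongrightarrow> v n a" by (simp only: v_Q)
    then show ?thesis using LIMSEQ_unique tendsto_const by blast
  qed
  have vp: "v n (a + p) = xs n h" for n
    using v_blockwise[of n "\<lambda>n. xs n h"] unfolding v_add va p_def[symmetric] by simp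
  have "Q (a + p) j = a j" for j
  proof -
    have "Q (a + p) j = (a + p) j - xs (blk j) h / of_real (L (blk j))" by (simp only: Q_apply vp)
    then show ?thesis by (simp add: p_def)
  qed
  then have Qp: "Q (a + p) = a" by blast
  have Y: "a + p \<in> Y" and hp: "hX (a + p) = h"
    using a h vp Qp by (auto intro: in_YI hX_eqI)
  have "(\<lambda>n. nS (Q (u n) - a) + qX (hX (u n) - h)) \<longlonglongrightarrow> 0 + 0"
    using a h unfolding qlim_def by (intro tendsto_intros)
  then have "qlim qY u (a + p)"
    unfolding qlim_def qY_def using uY Y by (simp add: Q_diff hX_diff Qp hp)
  then show ?thesis using Y by blast
qed

lemma quasi_banach_Y: "quasi_banach_space seq_scale Y qY"
proof (intro quasi_banach_space.intro quasi_normed_space.intro vector_space_seq_scale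
    quasi_normed_space_axioms.intro quasi_banach_space_axioms.intro Y_complete qY_nonneg)
  show "seq.subspace Y" by (intro seq.subspaceI Y_0 Y_add Y_scale)
  fix f assume f: "f \<in> Y"
  show "qY f = 0 \<longleftrightarrow> f = 0"
  proof
    assume "qY f = 0"
    then have "nS (Q f) = 0" "qX (hX f) = 0"
      using nS_Q_le[OF f] qX_hX_le[OF f] S.q_nonneg[OF Q_in_S[OF f]] X.q_nonneg[OF hX_in_X[OF f]]
      by auto
    then have "Q f = 0" "hX f = 0"
      using S.q_eq_0_iff[OF Q_in_S[OF f]] X.q_eq_0_iff[OF hX_in_X[OF f]] by auto
    \<comment> \<open>A sequence is determined by its \<open>Q\<close> part together with its
      coefficients.\<close>
    then have "Q f j = 0" "v n f = 0" for j n using xs_hX[OF f] by auto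
    then show "f = 0" by (auto simp: fun_eq_iff Q_apply)
  next
    have "Q 0 = 0" by (simp add: fun_eq_iff Q_apply v_star_def)
    moreover assume "f = 0"
    ultimately show "qY f = 0" by (simp only: qY_def hX_0 S.q_0 X.q_0 add_0)
  qed
  show "qY (seq_scale c f) = norm c * qY f" for c
    using f by (simp add: qY_def Q_scale hX_scale S.q_scale X.q_scale Q_in_S hX_in_X distrib_left)
next
  have "qY (f + g) \<le> X.K * (qY f + qY g)" if f: "f \<in> Y" and g: "g \<in> Y" for f g
  proof -
    have "nS (Q (f + g)) \<le> nS (Q f) + nS (Q g)"
      unfolding Q_add by (intro S.triangle Q_in_S f g)
    also have "\<dots> \<le> X.K * (nS (Q f) + nS (Q g))"
      using X.K_ge_1 S.q_nonneg[OF Q_in_S[OF f]] S.q_nonneg[OF Q_in_S[OF g]]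
      by (simp add: mult_le_cancel_right1)
    finally have "nS (Q (f + g)) \<le> X.K * (nS (Q f) + nS (Q g))" .
    moreover have "qX (hX (f + g)) \<le> X.K * (qX (hX f) + qX (hX g))"
      unfolding hX_add[OF f g] by (intro X.q_add hX_in_X f g)
    ultimately show ?thesis unfolding qY_def by (simp add: algebra_simps)
  qed
  then show "\<exists>\<kappa>. \<forall>f\<in>Y. \<forall>g\<in>Y. qY (f + g) \<le> \<kappa> * (qY f + qY g)" by blast
qed

sublocale Y: quasi_banach_space seq_scale Y qY
  by (rule quasi_banach_Y)

section \<open>Finitely supported sequences and truncation to whole blocks\<close>

lemma finite_v: "f \<in> c00 \<Longrightarrow> finite {n. v n f \<noteq> 0}"
proof -
  assume "f \<in> c00"
  then have "finite (blk ` {j. f j \<noteq> 0})" by (simp add: c00_iff)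
  moreover have "{n. v n f \<noteq> 0} \<subseteq> blk ` {j. f j \<noteq> 0}"
  proof
    fix n assume "n \<in> {n. v n f \<noteq> 0}"
    then have "(\<Sum>j\<in>\<sigma> n. f j) \<noteq> 0" by (auto simp: v_star_def)
    then obtain j where "j \<in> \<sigma> n" "f j \<noteq> 0" by (meson sum.neutral)
    then show "n \<in> blk ` {j. f j \<noteq> 0}" by (auto simp: in_block_iff)
  qed
  ultimately show ?thesis by (rule finite_subset[rotated])
qed

lemma Q_in_c00: "f \<in> c00 \<Longrightarrow> Q f \<in> c00"
proof -
  assume f: "f \<in> c00"
  have "{j. Q f j \<noteq> 0} \<subseteq> {j. f j \<noteq> 0} \<union> (\<Union>n\<in>{n. v n f \<noteq> 0}. \<sigma> n)"
    by (auto simp: Q_apply in_block_iff)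
  moreover have "finite \<dots>" using f finite_v[OF f] by (auto simp: c00_iff)
  ultimately show ?thesis unfolding c00_iff by (rule finite_subset)
qed

lemma
  assumes f: "f \<in> c00"
  shows c00_in_Y: "f \<in> Y"
    and hX_c00: "hX f = (\<Sum>n | v n f \<noteq> 0. smul (v n f) (x n))"
proof -
  let ?h = "\<Sum>n | v n f \<noteq> 0. smul (v n f) (x n)"
  have h: "?h \<in> X" by (intro X.V_sum X.V_scale X.y_in_V)
  have "xs m ?h = (\<Sum>n | v n f \<noteq> 0. if n = m then v n f else 0)" for m
    by (subst X.ys_sum[OF finite_v[OF f]])
      (auto simp: X.ys_scale X.y_in_V X.V_scale X.ys_y intro!: sum.cong)
  then have "xs m ?h = v m f" for m using finite_v[OF f] by simp
  then show "f \<in> Y" "hX f = ?h"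
    using h Q_in_c00[OF f] S.c00_subset by (auto intro!: in_YI hX_eqI)
qed

lemma qY_c00: "f \<in> c00 \<Longrightarrow> qY f = Y_qnorm smul qX x nS \<sigma> f"
  by (simp add: qY_def Y_qnorm_def hX_c00)

lemma restr_in_Y: "finite A \<Longrightarrow> restr A f \<in> Y"
  by (intro c00_in_Y restr_in_c00)

text \<open>This links the basis of \<open>X\<close> to \<open>Y\<close>: truncation to whole blocks
  acts on the component in \<open>X\<close> as a partial sum projection.\<close>

lemma hX_restr_init:
  assumes f: "f \<in> Y"
  shows "hX (restr (init r) f) = X.psum r (hX f)"
proof (rule hX_eqI)
  show "Q (restr (init r) f) \<in> S" by (intro Q_in_S restr_in_Y finite_init)
  show "xs n (X.psum r (hX f)) = v n (restr (init r) f)" for n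
  proof -
    have "xs n (X.psum r (hX f)) = (\<Sum>k<r. if k = n then v k f else 0)"
      by (simp add: X.psum_def X.ys_sum X.ys_scale X.y_in_V X.V_scale X.ys_y xs_hX f
        if_distrib[of "(*) _"] eq_commute[of n] cong: if_cong)
    then show ?thesis by (simp add: v_restr_init)
  qed
qed (rule X.psum_in_V)

text \<open>The expansion in \<open>S\<close> converges along \<open>{..<n}\<close>. Once
  \<open>init r\<close> contains \<open>{..<n}\<close>, the new error is a restriction of the old
  one, so suppression applies.\<close>

lemma tendsto_restr_init_S:
  assumes a: "a \<in> S"
  shows "(\<lambda>r. nS (a - restr (init r) a)) \<longlonglongrightarrow> 0"
proof (rule LIMSEQ_I)
  fix e :: real assume "0 < e"
  then have "\<forall>\<^sub>F n in sequentially. nS (a - S.psum n a) < e"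
    using S.tendsto_psum[OF a] by (rule order_tendstoD(2)[rotated])
  then obtain n where n: "nS (a - S.psum n a) < e" by (auto simp: eventually_sequentially)
  have psum: "S.psum n a = restr {..<n} a" by (simp add: S.psum_def restr_eq_sum)
  have "norm (nS (a - restr (init r) a) - 0) < e" if r: "Suc (blk n) \<le> r" for r
  proof -
    have j: "j \<in> init r" if "j < n" for j
      using blk_mono[of j n] r that by (simp add: in_init)
    have eq: "a - restr (init r) a = restr (- init r) (a - restr {..<n} a)"
      using j by (auto simp: fun_eq_iff restr_apply)
    have rS: "restr A a \<in> S" for A using a by (rule S.suppression)
    have "nS (a - restr (init r) a) \<le> nS (a - restr {..<n} a)"
      unfolding eq by (intro S.suppression S.V_diff a rS)
    moreover have "0 \<le> nS (a - restr (init r) a)" by (intro S.q_nonneg S.V_diff a rS)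
    ultimately show ?thesis using n unfolding psum by simp
  qed
  then show "\<exists>n0. \<forall>r\<ge>n0. norm (nS (a - restr (init r) a) - 0) < e" by blast
qed

lemma tendsto_restr_init:
  assumes f: "f \<in> Y"
  shows "(\<lambda>r. qY (f - restr (init r) f)) \<longlonglongrightarrow> 0"
proof -
  have "(\<lambda>r. nS (Q f - restr (init r) (Q f)) + qX (hX f - X.psum r (hX f))) \<longlonglongrightarrow> 0 + 0"
    using f by (intro tendsto_add tendsto_restr_init_S X.tendsto_psum Q_in_S hX_in_X)
  then show ?thesis
    unfolding qY_def using f by (simp add: Q_diff Q_restr_init hX_diff restr_in_Y hX_restr_init)
qed

lemma seq_completion_Y: "seq_completion (Y_qnorm smul qX x nS \<sigma>) Y qY"
  unfolding seq_completion_def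
proof (intro conjI ballI allI quasi_banach_Y qY_c00)
  show "bounded_functional seq_scale Y qY (\<lambda>f. f n)" for n
    using coordinate_bounded[of n] by (simp add: bounded_functional_def)
  show "c00 \<subseteq> Y" using c00_in_Y by blast
  fix f assume f: "f \<in> Y"
  have "qlim qY (\<lambda>r. restr (init r) f) f"
    using tendsto_restr_init[OF f] f unfolding qlim_def
    by (simp add: Y.q_minus_commute restr_in_Y)
  then show "\<exists>u. range u \<subseteq> c00 \<and> qlim qY u f"
    using restr_in_c00[OF finite_init] by (intro exI[of _ "\<lambda>r. restr (init r) f"]) auto
qed

end

section \<open>Uniqueness of the completion as a sequence space\<close>

text \<open>The two quasi-norms agree on \<open>c00\<close>, so an approximating sequence from
  \<open>c00\<close> is Cauchy for both, and its two limits coincide because coordinates are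
  continuous. Comparing the quasi-norms at the limit costs the constants of both quasi-triangle
  inequalities.\<close>

lemma seq_completion_unique:
  assumes Y: "seq_completion q0 Y q" and Z: "seq_completion q0 Z p"
  shows "Y \<subseteq> Z" "\<exists>C\<ge>0. \<forall>f\<in>Y. p f \<le> C * q f \<and> q f \<le> C * p f"
proof -
  interpret Y: quasi_banach_space seq_scale Y q
    using Y unfolding seq_completion_def by blast
  interpret Z: quasi_banach_space seq_scale Z p
    using Z unfolding seq_completion_def by blast
  have c00: "c00 \<subseteq> Y" "c00 \<subseteq> Z" and eq: "\<And>f. f \<in> c00 \<Longrightarrow> p f = q f"
    using Y Z unfolding seq_completion_def by auto
  have *: "f \<in> Z \<and> p f \<le> Z.K * (Y.K * q f) \<and> q f \<le> Y.K * (Z.K * p f)" if f: "f \<in> Y" for f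
  proof -
    obtain u where u: "range u \<subseteq> c00" "qlim q u f"
      using Y f unfolding seq_completion_def by blast
    have uc: "u n \<in> c00" for n using u by auto
    have diff: "u m - u n \<in> c00" for m n
      unfolding c00_def using uc by (intro seq.span_diff) (auto simp: c00_def)
    have uY: "range u \<subseteq> Y" and uZ: "range u \<subseteq> Z" using u c00 by auto
    have "qCauchy q u" using uY f u(2) by (rule Y.qlim_imp_qCauchy)
    then have "qCauchy p u" by (rule qCauchy_le) (simp add: eq diff)
    then obtain g where g: "g \<in> Z" "qlim p u g" using Z.complete_V uZ by blast
    have "f j = g j" for j
    proof -
      have "(\<lambda>n. u n j) \<longlonglongrightarrow> f j"
        using Y unfolding seq_completion_def
        by (intro Y.bounded_functional_tendsto[OF _ uY f u(2), of "\<lambda>f. f j"]) blast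
      moreover have "(\<lambda>n. u n j) \<longlonglongrightarrow> g j"
        using Z unfolding seq_completion_def
        by (intro Z.bounded_functional_tendsto[OF _ uZ g, of "\<lambda>f. f j"]) blast
      ultimately show ?thesis by (rule LIMSEQ_unique)
    qed
    then have fg: "f = g" by blast
    \<comment> \<open>Stated for two arbitrary spaces so that it can be used in both
      directions.\<close>
    have bound: "p' f \<le> k' * (k * q' f)"
      if Q: "quasi_normed_space seq_scale W q'" and P: "quasi_normed_space seq_scale W' p'"
        and k: "k = quasi_normed_space.K W q'" "k' = quasi_normed_space.K W' p'"
        and W: "f \<in> W" "qlim q' u f" "f \<in> W'" "qlim p' u f" "c00 \<subseteq> W" "c00 \<subseteq> W'"
        and eq: "\<And>f. f \<in> c00 \<Longrightarrow> p' f = q' f" for p' q' W W' k k'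
    proof -
      interpret q': quasi_normed_space seq_scale W q' by (rule Q)
      interpret p': quasi_normed_space seq_scale W' p' by (rule P)
      have uW: "u n \<in> W" "u n \<in> W'" for n using uc W by auto
      have le: "p' f \<le> k' * (k * (q' f + e))" if e: "0 < e" for e
      proof -
        have "\<forall>\<^sub>F n in sequentially. q' (u n - f) < e"
          using W(2) e unfolding qlim_def by (rule order_tendstoD)
        then obtain n0 where n0: "\<And>n. n \<ge> n0 \<Longrightarrow> q' (u n - f) < e"
          by (auto simp: eventually_sequentially)
        have "p' (u n) \<le> k * (q' f + e)" if n: "n \<ge> n0" for n
        proof -
          have "p' (u n) = q' (f + (u n - f))" using eq uc by simp
          also have "\<dots> \<le> k * (q' f + q' (u n - f))"
            unfolding k by (intro q'.q_add q'.V_diff uW W)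
          also have "\<dots> \<le> k * (q' f + e)"
            unfolding k using n0[OF n] q'.K_ge_1 by (intro mult_left_mono) auto
          finally show ?thesis .
        qed
        then show ?thesis unfolding k(2)
          using p'.qlim_bound[of u f n0] uW W by blast
      qed
      show ?thesis
      proof (rule field_le_epsilon)
        fix e :: real assume e: "0 < e"
        have kk: "1 \<le> k" "1 \<le> k'" unfolding k using q'.K_ge_1 p'.K_ge_1 by auto
        \<comment> \<open>The choice \<open>e / (k' * k)\<close> cancels the constants in front of
          the error.\<close>
        then have "p' f \<le> k' * (k * (q' f + e / (k' * k)))" using e by (intro le) simp
        also have "\<dots> = k' * (k * q' f) + e" using kk by (simp add: field_simps)
        finally show "p' f \<le> k' * (k * q' f) + e" .
      qed
    qed
    have "p f \<le> Z.K * (Y.K * q f)"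
      using f u g c00 eq unfolding fg[symmetric]
      by (intro bound[OF Y.quasi_normed_space_axioms Z.quasi_normed_space_axioms refl refl]) auto
    moreover have "q f \<le> Y.K * (Z.K * p f)"
      using f u g c00 eq unfolding fg[symmetric]
      by (intro bound[OF Z.quasi_normed_space_axioms Y.quasi_normed_space_axioms refl refl]) auto
    ultimately show ?thesis using g fg by auto
  qed
  then show "Y \<subseteq> Z" by blast
  show "\<exists>C\<ge>0. \<forall>f\<in>Y. p f \<le> C * q f \<and> q f \<le> C * p f"
    using * Y.K_ge_1 Z.K_ge_1 by (intro exI[of _ "Z.K * Y.K"]) (auto simp: ac_simps)
qed

section \<open>Democracy and quasi-greediness\<close>

locale greedy_block_basis = block_basis +
  fixes \<rho> D
  assumes \<rho>: "0 < \<rho>" "\<rho> < 1" and D: "1 \<le> D" and estimates: "block_estimates (Lam nS) N \<rho> D"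
begin

abbreviation M :: "nat \<Rightarrow> nat" where "M r \<equiv> \<Sum>n<r. N n"

lemma estimate_before:
  "1 \<le> m \<Longrightarrow> M r \<le> m \<Longrightarrow> n < r \<Longrightarrow> L n \<le> D * \<rho> ^ (r - 1 - n) * \<Lambda> m"
  using estimates unfolding block_estimates_def by blast

lemma
  assumes "1 \<le> m" "m \<le> M (Suc r)" "r \<le> n"
  shows estimate_ratio: "real m * L n \<le> D * \<rho> ^ (n - r) * \<Lambda> m * real (N n)"
    and estimate_Lam: "\<Lambda> m \<le> D * \<rho> ^ (n - r) * L n"
    and estimate_size: "real m \<le> D * \<rho> ^ (n - r) * real (N n)"
  using estimates assms unfolding block_estimates_def by blast+

definition decay :: "nat \<Rightarrow> nat \<Rightarrow> real" where
  "decay r n = \<rho> ^ (if n < r then r - 1 - n else n - r)"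

lemma decay_before [simp]: "n < r \<Longrightarrow> decay r n = \<rho> ^ (r - 1 - n)"
  by (simp add: decay_def)

lemma decay_after [simp]: "\<not> n < r \<Longrightarrow> decay r n = \<rho> ^ (n - r)"
  by (simp add: decay_def)

lemma decay_nonneg: "0 \<le> decay r n"
  using \<rho> by (simp add: decay_def)

text \<open>Semi-normalization makes the constant independent of \<open>n\<close>.\<close>

lemma v_le: "\<exists>C\<ge>0. \<forall>f\<in>Y. \<forall>n. norm (v n f) \<le> C * qY f"
proof -
  obtain C where C: "0 \<le> C" "\<And>n h. h \<in> X \<Longrightarrow> norm (xs n h) \<le> C * qX h"
    using X.coordinates_bounded[OF semi_normalized] by blast
  have "norm (v n f) \<le> C * qY f" if f: "f \<in> Y" for f n
  proof -
    have "norm (v n f) \<le> C * qX (hX f)" using C(2)[OF hX_in_X[OF f]] by (simp add: xs_hX f)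
    also have "\<dots> \<le> C * qY f" using C(1) qX_hX_le[OF f] by (intro mult_left_mono)
    finally show ?thesis .
  qed
  then show ?thesis using C(1) by blast
qed

text \<open>A finite set meets finitely many blocks, so the restriction is a finite sum of block
  pieces to which the two-sided geometric sum applies.\<close>

lemma nS_blocks_le:
  "\<exists>C\<ge>0. \<forall>A f r B. 0 \<le> B \<longrightarrow> finite A \<longrightarrow>
    (\<forall>n. nS (restr (A \<inter> \<sigma> n) f) \<le> B * decay r n) \<longrightarrow> nS (restr A f) \<le> C * B"
proof -
  obtain C where C: "0 \<le> C" "\<And>r R y B. 0 \<le> B \<Longrightarrow>
      (\<forall>n<R. y n \<in> S \<and> nS (y n) \<le> B * decay r n) \<Longrightarrow> nS (\<Sum>n<R. y n) \<le> C * B"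
    using S.q_two_sided_geometric_sum[of \<rho>] \<rho> unfolding decay_def by auto
  have "nS (restr A f) \<le> C * B"
    if B: "0 \<le> B" and A: "finite A" and le: "\<forall>n. nS (restr (A \<inter> \<sigma> n) f) \<le> B * decay r n"
    for A f r B
  proof -
    obtain R where R: "\<And>j. j \<in> A \<Longrightarrow> blk j < R"
      using A finite_nat_set_iff_bounded[of "blk ` A"] by auto
    have "restr A f = (\<Sum>n<R. restr (A \<inter> \<sigma> n) f)"
    proof
      fix j
      have "(\<Sum>n<R. restr (A \<inter> \<sigma> n) f) j = (\<Sum>n<R. if n = blk j then restr A f j else 0)"
        unfolding sum_fun_apply by (intro sum.cong) (auto simp: restr_apply in_block_iff)
      then show "restr A f j = (\<Sum>n<R. restr (A \<inter> \<sigma> n) f) j"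
        using R[of j] by (auto simp: restr_apply)
    qed
    then show ?thesis using C(2)[OF B, of R "\<lambda>n. restr (A \<inter> \<sigma> n) f" r] A le S.restr_in_S by auto
  qed
  then show ?thesis using C(1) by blast
qed

text \<open>The component in \<open>X\<close> is a geometric sum because the \<open>x n\<close> are
  bounded. On block \<open>n\<close> the norm of \<open>P f\<close> is at most
  \<open>norm (v n f)\<close>, so \<open>P f\<close> also has norm at most a constant times
  \<open>B\<close>, and \<open>Q f = f - P f\<close>.\<close>

lemma qY_le_of_decay:
  "\<exists>C\<ge>0. \<forall>f\<in>c00. \<forall>r B. 0 \<le> B \<longrightarrow> (\<forall>n. norm (v n f) \<le> B * decay r n) \<longrightarrow> qY f \<le> nS f + C * B"
proof -
  obtain C1 where C1: "0 \<le> C1" "\<And>A f r B. 0 \<le> B \<Longrightarrow> finite A \<Longrightarrow>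
      (\<forall>n. nS (restr (A \<inter> \<sigma> n) f) \<le> B * decay r n) \<Longrightarrow> nS (restr A f) \<le> C1 * B"
    using nS_blocks_le by blast
  obtain C2 where C2: "0 \<le> C2" "\<And>r R y B. 0 \<le> B \<Longrightarrow>
      (\<forall>n<R. y n \<in> X \<and> qX (y n) \<le> B * decay r n) \<Longrightarrow> qX (\<Sum>n<R. y n) \<le> C2 * B"
    using X.q_two_sided_geometric_sum[of \<rho>] \<rho> unfolding decay_def by auto
  obtain c0 where c0: "\<And>n. qX (x n) \<le> c0"
    using semi_normalized unfolding semi_normalized_def bdd_above_def by blast
  define c where "c = max 0 c0"
  have c: "0 \<le> c" "\<And>n. qX (x n) \<le> c" unfolding c_def using c0 by (auto simp: le_max_iff_disj)
  have "qY f \<le> nS f + (C1 + C2 * c) * B"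
    if f: "f \<in> c00" and B: "0 \<le> B" and v: "\<And>n. norm (v n f) \<le> B * decay r n" for f r B
  proof -
    obtain R where R: "\<And>n. v n f \<noteq> 0 \<Longrightarrow> n < R"
      using finite_v[OF f] finite_nat_set_iff_bounded[of "{n. v n f \<noteq> 0}"] by auto
    have "hX f = (\<Sum>n<R. smul (v n f) (x n))"
      unfolding hX_c00[OF f] using R by (intro sum.mono_neutral_left) auto
    also have "qX \<dots> \<le> C2 * (c * B)"
    proof (rule C2(2), safe)
      fix n
      show "smul (v n f) (x n) \<in> X" by (intro X.V_scale X.y_in_V)
      have "qX (smul (v n f) (x n)) = norm (v n f) * qX (x n)"
        by (simp add: X.q_scale X.y_in_V)
      also have "\<dots> \<le> (B * decay r n) * c"
        using B decay_nonneg X.q_nonneg[OF X.y_in_V] by (intro mult_mono v c) auto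
      finally show "qX (smul (v n f) (x n)) \<le> c * B * decay r n" by (simp add: ac_simps)
    qed (use c B in simp)
    finally have qX: "qX (hX f) \<le> C2 * c * B" by (simp add: ac_simps)
    have PS: "P f = restr (init R) (P f)"
      using R by (auto simp: fun_eq_iff restr_apply in_init P_apply)
    have "nS (restr (init R) (P f)) \<le> C1 * B"
    proof (rule C1(2)[OF B finite_init], rule allI)
      fix n
      have "nS (restr (init R \<inter> \<sigma> n) (P f)) \<le> norm (v n f) / L n * \<Lambda> (card (init R \<inter> \<sigma> n))"
        using L_pos[of n]
        by (intro S.nS_upper) (auto simp: P_apply in_block_iff norm_divide)
      also have "\<dots> \<le> norm (v n f) / L n * L n"
        using L_pos[of n] by (intro mult_left_mono S.Lam_mono card_mono) auto
      also have "\<dots> = norm (v n f)" using L_pos[of n] by simp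
      also have "\<dots> \<le> B * decay r n" by (rule v)
      finally show "nS (restr (init R \<inter> \<sigma> n) (P f)) \<le> B * decay r n" .
    qed
    then have nSP: "nS (P f) \<le> C1 * B" using PS by simp
    have "f \<in> S" "P f \<in> S"
      using f S.c00_subset S.restr_in_S[OF finite_init, of R "P f"] PS by auto
    then have "nS (f - P f) \<le> nS f + nS (P f)"
      using S.triangle[of f "- P f"] S.V_neg S.q_neg by simp
    then show ?thesis
      unfolding qY_def Q_proj_def using nSP qX by (simp add: algebra_simps)
  qed
  then show ?thesis using C1(1) C2(1) c(1) by (intro exI[of _ "C1 + C2 * c"]) auto
qed

section \<open>Upper and lower democracy estimates\<close>

text \<open>If \<open>A\<close> has \<open>k\<close> points in block \<open>n\<close>, the
  coefficient there is at most \<open>t * k * L n / N n\<close>. With \<open>r\<close> locating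
  \<open>m\<close>, use \<open>k \<le> N n\<close> for blocks before \<open>r\<close> and
  \<open>k \<le> m\<close> from \<open>r\<close> on; both bounds decay away from
  \<open>r\<close>.\<close>

lemma upper_estimate:
  "\<exists>C\<ge>0. \<forall>A f t m. finite A \<longrightarrow> card A \<le> m \<longrightarrow> 1 \<le> m \<longrightarrow> 0 \<le> t \<longrightarrow>
    (\<forall>j\<in>A. norm (f j) \<le> t) \<longrightarrow> qY (restr A f) \<le> C * t * \<Lambda> m"
proof -
  obtain C where C: "0 \<le> C" "\<And>f r B. f \<in> c00 \<Longrightarrow> 0 \<le> B \<Longrightarrow> (\<forall>n. norm (v n f) \<le> B * decay r n) \<Longrightarrow>
      qY f \<le> nS f + C * B"
    using qY_le_of_decay by blast
  have "qY (restr A f) \<le> (1 + C * D) * t * \<Lambda> m"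
    if A: "finite A" "card A \<le> m" and m: "1 \<le> m" and t: "0 \<le> t" and f: "\<forall>j\<in>A. norm (f j) \<le> t"
    for A f t m
  proof -
    obtain r where r: "M r \<le> m" "m \<le> M (Suc r)" using exists_init[OF m] by blast
    have "norm (v n (restr A f)) \<le> t * D * \<Lambda> m * decay r n" for n
    proof -
      define k where "k = card (A \<inter> \<sigma> n)"
      have k: "k \<le> m" "k \<le> N n"
        unfolding k_def using A card_mono[of A "A \<inter> \<sigma> n"] card_mono[of "\<sigma> n" "A \<inter> \<sigma> n"] by auto
      have "norm (\<Sum>j\<in>A \<inter> \<sigma> n. f j) \<le> (\<Sum>j\<in>A \<inter> \<sigma> n. t)"
        using f by (intro order_trans[OF norm_sum] sum_mono) auto
      then have "norm (\<Sum>j\<in>A \<inter> \<sigma> n. f j) \<le> real k * t" by (simp add: k_def)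
      then have "norm (v n (restr A f)) \<le> L n / real (N n) * (real k * t)"
        unfolding v_restr norm_mult norm_of_real
        using L_pos[of n] by (simp add: divide_right_mono mult_left_mono)
      also have "\<dots> \<le> t * D * \<Lambda> m * decay r n"
      proof (cases "n < r")
        case True
        have "L n / real (N n) * (real k * t) \<le> L n / real (N n) * (real (N n) * t)"
          using k t L_pos[of n] by (intro mult_left_mono mult_right_mono) auto
        also have "\<dots> = t * L n" by simp
        also have "\<dots> \<le> t * (D * \<rho> ^ (r - 1 - n) * \<Lambda> m)"
          using t True by (intro mult_left_mono estimate_before m r) auto
        finally show ?thesis using True by (simp add: ac_simps)
      next
        case False
        have "L n / real (N n) * (real k * t) \<le> L n / real (N n) * (real m * t)"
          using k t L_pos[of n] by (intro mult_left_mono mult_right_mono) auto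
        also have "\<dots> = t * (real m * L n) / real (N n)" by simp
        also have "\<dots> \<le> t * (D * \<rho> ^ (n - r) * \<Lambda> m * real (N n)) / real (N n)"
          using t False by (intro divide_right_mono mult_left_mono estimate_ratio m r) auto
        also have "\<dots> = t * D * \<Lambda> m * \<rho> ^ (n - r)" using N_pos[of n] by (simp add: ac_simps)
        finally show ?thesis using False by simp
      qed
      finally show ?thesis .
    qed
    then have "qY (restr A f) \<le> nS (restr A f) + C * (t * D * \<Lambda> m)"
      using A t D S.Lam_nonneg by (intro C(2) restr_in_c00) auto
    also have "nS (restr A f) \<le> t * \<Lambda> (card A)" using A t f by (intro S.nS_upper) auto
    also have "\<dots> \<le> t * \<Lambda> m" using t A by (intro mult_left_mono S.Lam_mono)
    finally show ?thesis by (simp add: algebra_simps)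
  qed
  then show ?thesis using C(1) D by (intro exI[of _ "1 + C * D"]) auto
qed

lemma lower_estimate:
  "\<exists>C\<ge>0. \<forall>f\<in>Y. \<forall>A t. finite A \<longrightarrow> 0 \<le> t \<longrightarrow> (\<forall>j\<in>A. t \<le> norm (f j)) \<longrightarrow>
    t * \<Lambda> (card A) \<le> C * qY f"
proof -
  obtain c where c: "0 \<le> c" "\<And>f n. f \<in> Y \<Longrightarrow> norm (v n f) \<le> c * qY f"
    using v_le by blast
  have "t * \<Lambda> (card A) \<le> (4 + 4 * D * c) * qY f"
    if f: "f \<in> Y" and A: "finite A" and t: "0 \<le> t" and ft: "\<forall>j\<in>A. t \<le> norm (f j)" for f A t
  proof -
    define A1 where "A1 = {j\<in>A. t / 2 \<le> norm (Q f j)}"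
    define A2 where "A2 = A - A1"
    have fin: "finite A1" "finite A2" unfolding A1_def A2_def using A by auto
    have A2: "t / 2 \<le> norm (P f j)" if "j \<in> A2" for j
    proof -
      have "t \<le> norm (Q f j + P f j)" using that ft unfolding A2_def Q_proj_def by simp
      then show ?thesis
        using that norm_triangle_ineq[of "Q f j" "P f j"] unfolding A2_def A1_def by auto
    qed
    have card: "card A = card A1 + card A2"
      unfolding A2_def using A card_mono[of A A1] by (simp add: A1_def card_Diff_subset)
    \<comment> \<open>Keeping at least half of the points costs only a factor 2, since doubling the
      argument at most doubles \<open>\<Lambda>\<close>.\<close>
    have half: "t * \<Lambda> (card A) \<le> 2 * (t * \<Lambda> k)" if "card A \<le> 2 * k" for k
    proof -
      have "\<Lambda> (card A) \<le> \<Lambda> (2 * k)" using that by (rule S.Lam_mono)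
      also have "\<dots> \<le> 2 * \<Lambda> k" using S.Lam_mult_le[of 2 k] by simp
      finally show ?thesis using mult_left_mono[OF _ t] by fastforce
    qed
    have q: "0 \<le> qY f" by (rule qY_nonneg[OF f])
    show ?thesis
    proof (cases "card A2 \<le> card A1")
      case True
      have "t / 2 * \<Lambda> (card A1) \<le> nS (Q f)"
        using t f fin by (intro S.nS_lower Q_in_S) (auto simp: A1_def)
      also have "\<dots> \<le> qY f" by (rule nS_Q_le[OF f])
      finally have "t * \<Lambda> (card A) \<le> 4 * qY f" using half[of "card A1"] True card by simp
      also have "\<dots> \<le> (4 + 4 * D * c) * qY f"
        using c D q by (intro mult_right_mono) auto
      finally show ?thesis .
    next
      case False
      then have ne: "A2 \<noteq> {}" by auto
      \<comment> \<open>Only the last block met by \<open>A2\<close> matters: \<open>A2\<close> lies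
        in the first \<open>Suc r\<close> blocks, so \<open>\<Lambda> (card A2)\<close> is at most
        \<open>D * L r\<close>, while one point of \<open>A2\<close> in block \<open>r\<close>
        bounds \<open>norm (v r f)\<close> from below.\<close>
      define r where "r = Max (blk ` A2)"
      have "r \<in> blk ` A2" unfolding r_def using fin ne by (intro Max_in) auto
      then obtain j where j: "j \<in> A2" "blk j = r" by blast
      have "A2 \<subseteq> init (Suc r)"
        unfolding r_def using fin by (auto simp: in_init less_Suc_eq_le)
      then have "card A2 \<le> M (Suc r)" using card_mono[OF finite_init] card_init by metis
      then have "\<Lambda> (card A2) \<le> D * \<rho> ^ (r - r) * L r"
        using ne fin by (intro estimate_Lam) (auto simp: Suc_le_eq card_gt_0_iff)
      then have Lam: "\<Lambda> (card A2) \<le> D * L r" by simp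
      have "t / 2 \<le> norm (v r f) / L r"
        using A2[OF j(1)] L_pos[of r] by (simp add: P_apply j norm_divide)
      then have "t * L r \<le> 2 * norm (v r f)" using L_pos[of r] by (simp add: field_simps)
      also have "\<dots> \<le> 2 * (c * qY f)" using c(2)[OF f] by simp
      finally have tL: "t * L r \<le> 2 * (c * qY f)" .
      have "t * \<Lambda> (card A) \<le> 2 * (t * \<Lambda> (card A2))" using False card by (intro half) simp
      also have "\<dots> \<le> 2 * (t * (D * L r))" using Lam t by (intro mult_left_mono) auto
      also have "\<dots> = 2 * D * (t * L r)" by simp
      also have "\<dots> \<le> 2 * D * (2 * (c * qY f))" using tL D by (intro mult_left_mono) auto
      also have "\<dots> \<le> (4 + 4 * D * c) * qY f" using q by (simp add: algebra_simps)
      finally show ?thesis .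
    qed
  qed
  then show ?thesis using c(1) D by (intro exI[of _ "4 + 4 * D * c"]) auto
qed

section \<open>Boundedness of projections adapted to the blocks\<close>

text \<open>From \<open>r\<close> on the blocks are long compared with \<open>m\<close>, so
  \<open>m\<close> points contribute little to a block average. The contribution of
  \<open>P f\<close> is controlled by the uniform bound on coefficients, that of \<open>Q f\<close>
  by \<open>S.sum_bound\<close>.\<close>

lemma tail_projection_bounded:
  "\<exists>C\<ge>0. \<forall>f\<in>Y. \<forall>G m r. finite G \<longrightarrow> card G \<le> m \<longrightarrow> 1 \<le> m \<longrightarrow> m \<le> M (Suc r) \<longrightarrow>
    (\<forall>j\<in>G. r \<le> blk j) \<longrightarrow> qY (restr G f) \<le> C * qY f"
proof -
  obtain C where C: "0 \<le> C" "\<And>f r B. f \<in> c00 \<Longrightarrow> 0 \<le> B \<Longrightarrow> (\<forall>n. norm (v n f) \<le> B * decay r n) \<Longrightarrow>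
      qY f \<le> nS f + C * B"
    using qY_le_of_decay by blast
  obtain C1 where C1: "0 \<le> C1" "\<And>A f r B. 0 \<le> B \<Longrightarrow> finite A \<Longrightarrow>
      (\<forall>n. nS (restr (A \<inter> \<sigma> n) f) \<le> B * decay r n) \<Longrightarrow> nS (restr A f) \<le> C1 * B"
    using nS_blocks_le by blast
  obtain c where c: "0 \<le> c" "\<And>f n. f \<in> Y \<Longrightarrow> norm (v n f) \<le> c * qY f"
    using v_le by blast
  have "qY (restr G f) \<le> (1 + C1 * (c * D) + C * ((4 + c) * D)) * qY f"
    if f: "f \<in> Y" and G: "finite G" "card G \<le> m" and m: "1 \<le> m" "m \<le> M (Suc r)"
      and Gr: "\<forall>j\<in>G. r \<le> blk j" for f G m r
  proof -
    have q: "0 \<le> qY f" by (rule qY_nonneg[OF f])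
    have empty: "G \<inter> \<sigma> n = {}" if "n < r" for n using Gr that by (auto simp: in_block_iff)
    define k where "k n = card (G \<inter> \<sigma> n)" for n
    have k: "k n \<le> m" for n unfolding k_def using G card_mono[of G "G \<inter> \<sigma> n"] by simp
    have P_le: "norm (P f j) \<le> c * qY f / L n" if "j \<in> \<sigma> n" for j n
      using that c(2)[OF f, of n] L_pos[of n]
      by (simp add: P_apply in_block_iff norm_divide divide_right_mono)
    have "restr G f = restr G (Q f) + restr G (P f)" by (simp add: Q_proj_def flip: restr_add)
    then have "nS (restr G f) \<le> nS (restr G (Q f)) + nS (restr G (P f))"
      using S.triangle[OF S.restr_in_S S.restr_in_S] G by metis
    also have "nS (restr G (Q f)) \<le> qY f"
      using S.suppression(2)[OF Q_in_S[OF f], of G] nS_Q_le[OF f] by simp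
    also have "nS (restr G (P f)) \<le> C1 * (c * qY f * D)"
    proof (rule C1(2)[OF _ G(1)], safe)
      fix n
      show "nS (restr (G \<inter> \<sigma> n) (P f)) \<le> c * qY f * D * decay r n"
      proof (cases "n < r")
        case True
        then have "restr (G \<inter> \<sigma> n) (P f) = 0" using empty by (simp add: restr_def fun_eq_iff)
        then show ?thesis using c q D decay_nonneg[of r n] by (simp only: S.q_0) simp
      next
        case False
        have "nS (restr (G \<inter> \<sigma> n) (P f)) \<le> c * qY f / L n * \<Lambda> (k n)"
          unfolding k_def using G c q L_pos[of n] P_le by (intro S.nS_upper) auto
        also have "\<dots> \<le> c * qY f / L n * (D * \<rho> ^ (n - r) * L n)"
        proof (intro mult_left_mono)
          have "\<Lambda> (k n) \<le> \<Lambda> m" using k by (rule S.Lam_mono)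
          also have "\<dots> \<le> D * \<rho> ^ (n - r) * L n" using False by (intro estimate_Lam m) simp
          finally show "\<Lambda> (k n) \<le> D * \<rho> ^ (n - r) * L n" .
        qed (use c q L_pos[of n] in auto)
        also have "\<dots> = c * qY f * D * \<rho> ^ (n - r)" using L_pos[of n] by simp
        finally show ?thesis using False by simp
      qed
    qed (use c q D in auto)
    finally have nS: "nS (restr G f) \<le> qY f + C1 * (c * qY f * D)" by simp
    have "norm (v n (restr G f)) \<le> (4 + c) * D * qY f * decay r n" for n
    \<comment> \<open>The case \<open>k n = 0\<close> is set apart because
      \<open>\<Lambda> (k n)\<close> has to be cancelled later.\<close>
    proof (cases "n < r \<or> k n = 0")
      case True
      then have "G \<inter> \<sigma> n = {}" using empty G unfolding k_def by auto
      then show ?thesis using c q D decay_nonneg[of r n] by (simp add: v_restr)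
    next
      case False
      then have n: "r \<le> n" and k1: "1 \<le> k n" by auto
      have Lk: "0 < \<Lambda> (k n)" and Lm: "0 < \<Lambda> m" using S.Lam_pos k1 m by auto
      have Npos: "0 < real (N n)" using N_pos[of n] by linarith
      have sumP: "norm (\<Sum>j\<in>G \<inter> \<sigma> n. P f j) \<le> real m * (c * qY f / L n)"
      proof -
        have "norm (\<Sum>j\<in>G \<inter> \<sigma> n. P f j) \<le> (\<Sum>j\<in>G \<inter> \<sigma> n. c * qY f / L n)"
          using P_le by (intro order_trans[OF norm_sum] sum_mono) auto
        also have "\<dots> = real (k n) * (c * qY f / L n)" by (simp add: k_def)
        also have "\<dots> \<le> real m * (c * qY f / L n)"
          using k[of n] c q L_pos[of n] by (intro mult_right_mono) auto
        finally show ?thesis .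
      qed
      \<comment> \<open>\<open>S.sum_bound\<close> refers to the number \<open>k n\<close> of points
        in the block; \<open>S.Lam_ratio\<close> passes from \<open>k n\<close> to
        \<open>m\<close>.\<close>
      have sumQ: "norm (\<Sum>j\<in>G \<inter> \<sigma> n. Q f j) \<le> 4 * real m * qY f / \<Lambda> m"
      proof -
        let ?s = "norm (\<Sum>j\<in>G \<inter> \<sigma> n. Q f j)"
        have "?s * \<Lambda> (k n) \<le> 2 * real (k n) * nS (Q f)"
          unfolding k_def using G f by (intro S.sum_bound Q_in_S) auto
        also have "\<dots> \<le> 2 * real (k n) * qY f"
          using nS_Q_le[OF f] by (intro mult_left_mono) auto
        finally have "(?s * \<Lambda> (k n)) * \<Lambda> m \<le> (2 * real (k n) * qY f) * \<Lambda> m"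
          using Lm by (intro mult_right_mono) auto
        also have "\<dots> = 2 * qY f * (real (k n) * \<Lambda> m)" by simp
        also have "\<dots> \<le> 2 * qY f * (2 * real m * \<Lambda> (k n))"
          using q by (intro mult_left_mono S.Lam_ratio k k1) auto
        finally have "(?s * \<Lambda> m) * \<Lambda> (k n) \<le> (4 * real m * qY f) * \<Lambda> (k n)"
          by (simp add: algebra_simps)
        then have "?s * \<Lambda> m \<le> 4 * real m * qY f" using Lk by simp
        then show ?thesis using Lm by (simp add: field_simps)
      qed
      have "(\<Sum>j\<in>G \<inter> \<sigma> n. f j) = (\<Sum>j\<in>G \<inter> \<sigma> n. Q f j) + (\<Sum>j\<in>G \<inter> \<sigma> n. P f j)"
        by (simp add: Q_proj_def flip: sum.distrib)
      then have "norm (\<Sum>j\<in>G \<inter> \<sigma> n. f j) \<le> 4 * real m * qY f / \<Lambda> m + real m * (c * qY f / L n)"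
        using norm_triangle_ineq[of "\<Sum>j\<in>G \<inter> \<sigma> n. Q f j" "\<Sum>j\<in>G \<inter> \<sigma> n. P f j"] sumP sumQ by simp
      then have "norm (v n (restr G f)) \<le>
          L n / real (N n) * (4 * real m * qY f / \<Lambda> m + real m * (c * qY f / L n))"
        unfolding v_restr norm_mult norm_of_real
        using L_pos[of n] by (simp add: divide_right_mono mult_left_mono)
      \<comment> \<open>The terms are regrouped into the two quotients bounded by
        \<open>estimate_ratio\<close> and \<open>estimate_size\<close>.\<close>
      also have "\<dots> = 4 * qY f * ((real m * L n) / (\<Lambda> m * real (N n))) +
          c * qY f * (real m / real (N n))"
        using L_pos[of n] Lm Npos by (simp add: field_simps)
      also have "\<dots> \<le> 4 * qY f * (D * \<rho> ^ (n - r)) + c * qY f * (D * \<rho> ^ (n - r))"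
      proof (intro add_mono mult_left_mono)
        show "real m * L n / (\<Lambda> m * real (N n)) \<le> D * \<rho> ^ (n - r)"
          using estimate_ratio[OF m n] Lm Npos by (simp add: divide_le_eq ac_simps)
        show "real m / real (N n) \<le> D * \<rho> ^ (n - r)"
          using estimate_size[OF m n] Npos by (simp add: divide_le_eq)
      qed (use c q in auto)
      finally show ?thesis using n by (simp add: algebra_simps)
    qed
    then have "qY (restr G f) \<le> nS (restr G f) + C * ((4 + c) * D * qY f)"
      using G c q D by (intro C(2) restr_in_c00) auto
    then show ?thesis using nS by (simp add: algebra_simps)
  qed
  then show ?thesis using C(1) C1(1) c(1) D
    by (intro exI[of _ "1 + C1 * (c * D) + C * ((4 + c) * D)"]) auto
qed

text \<open>Suppression bounds the component in \<open>S\<close>, and uniformly bounded partial sums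
  bound the one in \<open>X\<close>.\<close>

lemma init_projection_bounded: "\<exists>C\<ge>0. \<forall>f\<in>Y. \<forall>r. qY (restr (init r) f) \<le> C * qY f"
proof -
  obtain C where C: "0 \<le> C" "\<And>r h. h \<in> X \<Longrightarrow> qX (X.psum r h) \<le> C * qX h"
    using X.psum_bounded by blast
  have "qY (restr (init r) f) \<le> (1 + C) * qY f" if f: "f \<in> Y" for f r
  proof -
    have "nS (restr (init r) (Q f)) \<le> qY f"
      using S.suppression(2)[OF Q_in_S[OF f]] nS_Q_le[OF f] order_trans by blast
    moreover have "qX (X.psum r (hX f)) \<le> C * qY f"
      using C(2)[OF hX_in_X[OF f], of r] mult_left_mono[OF qX_hX_le[OF f] C(1)] by linarith
    ultimately show ?thesis
      by (simp add: qY_def[of "restr (init r) f"] Q_restr_init hX_restr_init f algebra_simps)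
  qed
  then show ?thesis using C(1) by (intro exI[of _ "1 + C"]) auto
qed

text \<open>Truncation at \<open>n\<close> differs from truncation at a block boundary by part of
  the block containing \<open>n\<close>. The tail projection bound, applied to
  \<open>g (blk n)\<close> with the length of that block as \<open>m\<close>, covers this
  part.\<close>

lemma tendsto_restr:
  assumes f: "f \<in> Y"
  shows "(\<lambda>n. qY (f - restr {..<n} f)) \<longlonglongrightarrow> 0"
proof -
  obtain C where C: "0 \<le> C" "\<And>f G m r. f \<in> Y \<Longrightarrow> finite G \<Longrightarrow> card G \<le> m \<Longrightarrow> 1 \<le> m \<Longrightarrow>
      m \<le> M (Suc r) \<Longrightarrow> (\<forall>j\<in>G. r \<le> blk j) \<Longrightarrow> qY (restr G f) \<le> C * qY f"
    using tail_projection_bounded by blast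
  define g where "g r = f - restr (init r) f" for r
  have g: "g r \<in> Y" for r unfolding g_def by (intro Y_diff f restr_in_Y finite_init)
  have "(\<lambda>n. Y.K * (qY (g (blk n)) + C * qY (g (blk n)))) \<longlonglongrightarrow> Y.K * (0 + C * 0)"
    using filterlim_compose[OF tendsto_restr_init[OF f] filterlim_blk] unfolding g_def
    by (intro tendsto_intros)
  then have lim: "(\<lambda>n. Y.K * (qY (g (blk n)) + C * qY (g (blk n)))) \<longlonglongrightarrow> 0" by simp
  have le: "norm (qY (f - restr {..<n} f)) \<le> Y.K * (qY (g (blk n)) + C * qY (g (blk n)))" for n
  proof -
    define G where "G = {..<n} - init (blk n)"
    have G: "finite G" "\<And>j. j \<in> G \<Longrightarrow> blk j = blk n"
      unfolding G_def using blk_mono by (auto simp: in_init not_less le_antisym)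
    have sub: "G \<subseteq> \<sigma> (blk n)" using G(2) by (auto simp: in_block_iff)
    have "j \<in> init (blk n) \<Longrightarrow> j < n" for j
      using blk_mono[of n j] by (cases "j < n") (auto simp: in_init)
    then have eq: "f - restr {..<n} f = g (blk n) - restr G (g (blk n))"
      by (auto simp: fun_eq_iff g_def G_def restr_apply)
    have "qY (restr G (g (blk n))) \<le> C * qY (g (blk n))"
      using sub G N_pos by (intro C(2)[where m = "N (blk n)" and r = "blk n"] g card_mono) auto
    then have "Y.K * (qY (g (blk n)) + qY (restr G (g (blk n)))) \<le>
        Y.K * (qY (g (blk n)) + C * qY (g (blk n)))"
      using Y.K_ge_1 by (intro mult_left_mono) auto
    moreover have "qY (f - restr {..<n} f) \<le> Y.K * (qY (g (blk n)) + qY (restr G (g (blk n))))"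
      unfolding eq by (intro Y.q_diff g restr_in_Y G)
    moreover have "0 \<le> qY (f - restr {..<n} f)"
      by (intro qY_nonneg Y_diff f restr_in_Y) simp
    ultimately show ?thesis by simp
  qed
  show ?thesis by (rule Lim_null_comparison[OF always_eventually lim]) (use le in blast)
qed

section \<open>Greedy projections and almost greediness\<close>

lemma greedy_projection_bounded:
  "\<exists>C\<ge>0. \<forall>f\<in>Y. \<forall>G. greedy_set (\<lambda>n f. f n) f G \<longrightarrow> qY (restr G f) \<le> C * qY f"
proof -
  obtain CU where CU: "0 \<le> CU" "\<And>A (f :: nat \<Rightarrow> 'a) t m. finite A \<Longrightarrow> card A \<le> m \<Longrightarrow> 1 \<le> m \<Longrightarrow>
      0 \<le> t \<Longrightarrow> (\<forall>j\<in>A. norm (f j) \<le> t) \<Longrightarrow> qY (restr A f) \<le> CU * t * \<Lambda> m"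
    using upper_estimate by blast
  obtain CL where "0 \<le> CL" "\<forall>f\<in>Y. \<forall>A t. finite A \<longrightarrow> 0 \<le> t \<longrightarrow> (\<forall>j\<in>A. t \<le> norm (f j)) \<longrightarrow>
      t * \<Lambda> (card A) \<le> CL * qY f"
    using lower_estimate by (elim exE conjE)
  note CL = this(1) this(2)[rule_format]
  obtain CT where CT: "0 \<le> CT" "\<And>f G m r. f \<in> Y \<Longrightarrow> finite G \<Longrightarrow> card G \<le> m \<Longrightarrow> 1 \<le> m \<Longrightarrow>
      m \<le> M (Suc r) \<Longrightarrow> (\<forall>j\<in>G. r \<le> blk j) \<Longrightarrow> qY (restr G f) \<le> CT * qY f"
    using tail_projection_bounded by blast
  obtain CI where CI: "0 \<le> CI" "\<And>f r. f \<in> Y \<Longrightarrow> qY (restr (init r) f) \<le> CI * qY f"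
    using init_projection_bounded by blast
  define C where "C = Y.K * (Y.K * (CI + CU * CL) + CT)"
  have C0: "0 \<le> C" unfolding C_def using CU CL CT CI Y.K_ge_1 by simp
  have "qY (restr G f) \<le> C * qY f"
    if f: "f \<in> Y" and G: "greedy_set (\<lambda>n f. f n) f G" for f G
  proof (cases "G = {}")
    case True
    then have "restr G f = 0" by (simp add: restr_def fun_eq_iff)
    then show ?thesis using C0 qY_nonneg[OF f] by (simp only: Y.q_0 mult_nonneg_nonneg)
  next
    case False
    have fin: "finite G" and greedy: "\<And>j k. j \<in> G \<Longrightarrow> k \<notin> G \<Longrightarrow> norm (f k) \<le> norm (f j)"
      using G unfolding greedy_set_def by auto
    define m where "m = card G"
    have m: "1 \<le> m" unfolding m_def using fin False by (simp add: Suc_le_eq card_gt_0_iff)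
    obtain r where r: "M r \<le> m" "m \<le> M (Suc r)" using exists_init[OF m] by blast
    define t where "t = Min ((\<lambda>j. norm (f j)) ` G)"
    have "t \<in> (\<lambda>j. norm (f j)) ` G" unfolding t_def using fin False by (intro Min_in) auto
    then have t0: "0 \<le> t" and t_ge: "\<And>k. k \<notin> G \<Longrightarrow> norm (f k) \<le> t" using greedy by auto
    have t_le: "\<And>j. j \<in> G \<Longrightarrow> t \<le> norm (f j)" unfolding t_def using fin by (intro Min_le) auto
    have tm: "t * \<Lambda> m \<le> CL * qY f" unfolding m_def using t0 t_le by (intro CL f fin) auto
    \<comment> \<open>Both inequalities for \<open>r\<close> enter: \<open>M r \<le> m\<close>
      limits the number of points in the middle term, and \<open>m \<le> M (Suc r)\<close> allows
      the tail bound for the last.\<close>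
    have eq: "restr G f = (restr (init r) f - restr (init r - G) f) + restr (G - init r) f"
      by (auto simp: fun_eq_iff restr_apply)
    have 1: "qY (restr (init r) f) \<le> CI * qY f" by (rule CI(2)[OF f])
    have "card (init r - G) \<le> m"
      using r(1) card_init[of r] card_mono[of "init r" "init r - G"] by simp
    then have "qY (restr (init r - G) f) \<le> CU * t * \<Lambda> m"
      using t0 t_ge m by (intro CU) auto
    also have "\<dots> \<le> CU * (CL * qY f)" using tm CU(1) by (simp add: mult.assoc mult_left_mono)
    finally have 2: "qY (restr (init r - G) f) \<le> CU * CL * qY f" by simp
    have 3: "qY (restr (G - init r) f) \<le> CT * qY f"
      using fin m r(2) card_mono[of G "G - init r"]
      by (intro CT(2)[where m = m and r = r] f) (auto simp: m_def in_init)
    have Y: "restr (init r) f \<in> Y" "restr (init r - G) f \<in> Y" "restr (G - init r) f \<in> Y"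
      using fin by (auto intro: restr_in_Y)
    have "qY (restr G f) \<le> Y.K * (Y.K * (qY (restr (init r) f) + qY (restr (init r - G) f)) +
        qY (restr (G - init r) f))"
      unfolding eq using Y.K_ge_1
      by (intro order_trans[OF Y.q_add] mult_left_mono add_mono Y.q_diff Y Y_diff) auto
    also have "\<dots> \<le> Y.K * (Y.K * (CI * qY f + CU * CL * qY f) + CT * qY f)"
      using 1 2 3 Y.K_ge_1 by (intro mult_left_mono add_mono) auto
    finally show ?thesis unfolding C_def by (simp add: algebra_simps)
  qed
  then show ?thesis using C0 by blast
qed

text \<open>For \<open>g = f - restr B f\<close> the set \<open>A - B\<close> is greedy, so the
  greedy projection bound applies to \<open>g\<close>. What remains is
  \<open>restr (B - A) f\<close>: it has at most \<open>card (A - B)\<close> entries, none larger in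
  modulus than those of \<open>g\<close> on \<open>A - B\<close>, so the upper and lower estimates
  bound it by \<open>g\<close>.\<close>

lemma almost_greedy:
  "\<exists>C\<ge>0. \<forall>f\<in>Y. \<forall>A B. greedy_set (\<lambda>n f. f n) f A \<longrightarrow> finite B \<longrightarrow> card B \<le> card A \<longrightarrow>
    qY (f - restr A f) \<le> C * qY (f - restr B f)"
proof -
  obtain CU where CU: "0 \<le> CU" "\<And>A (f :: nat \<Rightarrow> 'a) t m. finite A \<Longrightarrow> card A \<le> m \<Longrightarrow> 1 \<le> m \<Longrightarrow>
      0 \<le> t \<Longrightarrow> (\<forall>j\<in>A. norm (f j) \<le> t) \<Longrightarrow> qY (restr A f) \<le> CU * t * \<Lambda> m"
    using upper_estimate by blast
  obtain CL where "0 \<le> CL" "\<forall>f\<in>Y. \<forall>A t. finite A \<longrightarrow> 0 \<le> t \<longrightarrow> (\<forall>j\<in>A. t \<le> norm (f j)) \<longrightarrow>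
      t * \<Lambda> (card A) \<le> CL * qY f"
    using lower_estimate by (elim exE conjE)
  note CL = this(1) this(2)[rule_format]
  obtain CG where "0 \<le> CG" "\<forall>f\<in>Y. \<forall>G. greedy_set (\<lambda>n f. f n) f G \<longrightarrow> qY (restr G f) \<le> CG * qY f"
    using greedy_projection_bounded by (elim exE conjE)
  note CG = this(1) this(2)[rule_format]
  define C where "C = Y.K * (Y.K * (1 + CG) + CU * CL)"
  have C0: "0 \<le> C" unfolding C_def using CU CL CG Y.K_ge_1 by simp
  have "qY (f - restr A f) \<le> C * qY (f - restr B f)"
    if f: "f \<in> Y" and A: "greedy_set (\<lambda>n f. f n) f A" and B: "finite B" "card B \<le> card A"
    for f A B
  proof -
    have fin: "finite A" and greedy: "\<And>j k. j \<in> A \<Longrightarrow> k \<notin> A \<Longrightarrow> norm (f k) \<le> norm (f j)"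
      using A unfolding greedy_set_def by auto
    define g where "g = f - restr B f"
    have g_apply: "g j = (if j \<in> B then 0 else f j)" for j by (simp add: g_def restr_apply)
    have g: "g \<in> Y" unfolding g_def by (intro Y_diff f restr_in_Y B)
    have gg: "greedy_set (\<lambda>n f. f n) g (A - B)"
      unfolding greedy_set_def using fin greedy by (auto simp: g_apply)
    have card: "card (B - A) \<le> card (A - B)"
    proof -
      have "card (B - A) + card (A \<inter> B) = card B" "card (A - B) + card (A \<inter> B) = card A"
        using fin B(1) by (auto simp: card_Diff_subset_Int Int_commute card_mono)
      then show ?thesis using B(2) by linarith
    qed
    have rest: "qY (restr (B - A) f) \<le> CU * CL * qY g"
    proof (cases "A - B = {}")
      case True
      then have empty: "B - A = {}"
        using card B(1) by (metis card.empty card_0_eq finite_Diff le_zero_eq)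
      have "restr (B - A) f = 0" unfolding empty by (simp add: restr_def fun_eq_iff)
      then show ?thesis
        using CU CL qY_nonneg[OF g] by (simp only: Y.q_0 mult_nonneg_nonneg)
    next
      case False
      define m where "m = card (A - B)"
      have m: "1 \<le> m" unfolding m_def using fin False by (simp add: Suc_le_eq card_gt_0_iff)
      \<comment> \<open>The minimum runs over \<open>A - B\<close>, where \<open>f\<close> and
        \<open>g\<close> agree, so it bounds the entries of \<open>g\<close> there from
        below.\<close>
      define t where "t = Min ((\<lambda>j. norm (f j)) ` (A - B))"
      have "t \<in> (\<lambda>j. norm (f j)) ` (A - B)" unfolding t_def using fin False by (intro Min_in) auto
      then have t0: "0 \<le> t" and t_ge: "\<And>k. k \<notin> A \<Longrightarrow> norm (f k) \<le> t" using greedy by auto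
      have t_le: "\<And>j. j \<in> A - B \<Longrightarrow> t \<le> norm (g j)"
        unfolding t_def using fin by (auto simp: g_apply intro: Min_le)
      have "t * \<Lambda> m \<le> CL * qY g" unfolding m_def using t0 t_le fin by (intro CL g) auto
      then have "CU * t * \<Lambda> m \<le> CU * (CL * qY g)"
        using CU(1) by (simp add: mult.assoc mult_left_mono)
      moreover have "qY (restr (B - A) f) \<le> CU * t * \<Lambda> m"
        using t0 t_ge m card B(1) unfolding m_def by (intro CU) auto
      ultimately show ?thesis by simp
    qed
    have eq: "f - restr A f = (g - restr (A - B) g) + restr (B - A) f"
      by (auto simp: fun_eq_iff restr_apply g_apply)
    have Y: "restr (A - B) g \<in> Y" "restr (B - A) f \<in> Y" using fin B by (auto intro: restr_in_Y)
    have "qY (f - restr A f) \<le> Y.K * (Y.K * (qY g + qY (restr (A - B) g)) + qY (restr (B - A) f))"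
      unfolding eq using Y.K_ge_1
      by (intro order_trans[OF Y.q_add] mult_left_mono add_mono Y.q_diff g Y Y_diff) auto
    also have "\<dots> \<le> Y.K * (Y.K * (qY g + CG * qY g) + CU * CL * qY g)"
      using rest CG(2)[OF g gg] Y.K_ge_1 by (intro mult_left_mono add_mono) auto
    finally show ?thesis unfolding C_def g_def by (simp add: algebra_simps)
  qed
  then show ?thesis using C0 by blast
qed

section \<open>Transfer to an arbitrary completion\<close>

text \<open>Almost greediness passes between equivalent quasi-norms at the cost of constants. For
  the fundamental function the two quasi-norms can be exchanged freely, since they coincide on
  \<open>c00\<close>.\<close>

lemma
  assumes Z: "seq_completion (Y_qnorm smul qX x nS \<sigma>) Z p"
  shows completion_almost_greedy: "almost_greedy_basis seq_scale Z p unit_vec"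
    and completion_fundamental_function:
      "equivalent_to (fundamental_function seq_scale p unit_vec) \<Lambda>"
proof -
  interpret Z: quasi_banach_space seq_scale Z p
    using Z unfolding seq_completion_def by blast
  have ZY: "Z \<subseteq> Y" by (rule seq_completion_unique[OF Z seq_completion_Y])
  obtain C where C: "0 \<le> C" "\<And>f. f \<in> Z \<Longrightarrow> qY f \<le> C * p f" "\<And>f. f \<in> Z \<Longrightarrow> p f \<le> C * qY f"
    using seq_completion_unique(2)[OF Z seq_completion_Y] by blast
  have c00: "restr A f \<in> Z" "p (restr A f) = qY (restr A f)" if "finite A" for A f
    using Z restr_in_c00[OF that, of f] unfolding seq_completion_def by (auto simp: qY_c00)
  have coord: "coord_proj seq_scale unit_vec (\<lambda>n f. f n) A f = restr A f" if "finite A" for A f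
    unfolding coord_proj_def by (rule restr_eq_sum[OF that, symmetric])
  have greedy_fin: "finite A" if "greedy_set (\<lambda>n f. f n) f A" for f :: "nat \<Rightarrow> 'a" and A
    using that unfolding greedy_set_def by blast
  have system: "schauder_system seq_scale Z p unit_vec (\<lambda>n f. f n)"
    unfolding schauder_system_def
  proof (intro conjI allI ballI)
    show "range unit_vec \<subseteq> Z"
      using Z unit_vec_in_c00 unfolding seq_completion_def by blast
    show "bounded_functional seq_scale Z p (\<lambda>f. f n)" for n
      using Z unfolding seq_completion_def by blast
    show "unit_vec m n = (if n = m then 1 else 0)" for n m by (simp add: unit_vec_def)
    fix f assume f: "f \<in> Z"
    have fY: "f \<in> Y" using f ZY by blast
    have "(\<lambda>n. C * qY (f - restr {..<n} f)) \<longlonglongrightarrow> C * 0"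
      by (intro tendsto_intros tendsto_restr fY)
    then have lim: "(\<lambda>n. C * qY (f - restr {..<n} f)) \<longlonglongrightarrow> 0" by simp
    have "norm (p (restr {..<n} f - f)) \<le> C * qY (f - restr {..<n} f)" for n
      using f c00[of "{..<n}" f] C(3)[of "f - restr {..<n} f"] Z.V_diff Z.q_nonneg
        Z.q_minus_commute[of f "restr {..<n} f"] by simp
    then have "(\<lambda>n. p (restr {..<n} f - f)) \<longlonglongrightarrow> 0"
      by (intro Lim_null_comparison[OF always_eventually lim]) blast
    then show "qsums p (\<lambda>n. seq_scale (f n) (unit_vec n)) f"
      unfolding qsums_def qlim_def by (simp only: restr_eq_sum[OF finite_lessThan])
  qed
  obtain CA where "0 \<le> CA" "\<forall>f\<in>Y. \<forall>A B. greedy_set (\<lambda>n f. f n) f A \<longrightarrow> finite B \<longrightarrow>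
      card B \<le> card A \<longrightarrow> qY (f - restr A f) \<le> CA * qY (f - restr B f)"
    using almost_greedy by (elim exE conjE)
  note CA = this(1) this(2)[rule_format]
  have "p (f - coord_proj seq_scale unit_vec (\<lambda>n f. f n) A f) \<le>
      C * CA * C * p (f - coord_proj seq_scale unit_vec (\<lambda>n f. f n) B f)"
    if f: "f \<in> Z" and A: "greedy_set (\<lambda>n f. f n) f A" and B: "finite B" "card B \<le> card A"
    for f A B
  proof -
    have "p (f - restr A f) \<le> C * qY (f - restr A f)"
      by (intro C Z.V_diff f c00 greedy_fin[OF A])
    also have "\<dots> \<le> C * (CA * qY (f - restr B f))"
      using f ZY A B C(1) by (intro mult_left_mono CA(2)) auto
    also have "\<dots> \<le> C * (CA * (C * p (f - restr B f)))"
      using C(1) CA(1) by (intro mult_left_mono C Z.V_diff f c00 B)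
    finally show ?thesis by (simp add: coord greedy_fin[OF A] B ac_simps)
  qed
  then show "almost_greedy_basis seq_scale Z p unit_vec"
    unfolding almost_greedy_basis_def using system by blast
  obtain CU where CU: "0 \<le> CU" "\<And>A (f :: nat \<Rightarrow> 'a) t m. finite A \<Longrightarrow> card A \<le> m \<Longrightarrow> 1 \<le> m \<Longrightarrow>
      0 \<le> t \<Longrightarrow> (\<forall>j\<in>A. norm (f j) \<le> t) \<Longrightarrow> qY (restr A f) \<le> CU * t * \<Lambda> m"
    using upper_estimate by blast
  obtain CL where "0 \<le> CL" "\<forall>f\<in>Y. \<forall>A t. finite A \<longrightarrow> 0 \<le> t \<longrightarrow> (\<forall>j\<in>A. t \<le> norm (f j)) \<longrightarrow>
      t * \<Lambda> (card A) \<le> CL * qY f"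
    using lower_estimate by (elim exE conjE)
  note CL = this(1) this(2)[rule_format]
  show "equivalent_to (fundamental_function seq_scale p unit_vec) \<Lambda>"
    unfolding equivalent_to_def
  proof (intro exI conjI allI impI)
    \<comment> \<open>Adding 1 makes the denominator positive from \<open>0 \<le> CL\<close>
      alone.\<close>
    show "0 < 1 / (CL + 1)" using CL(1) by simp
    fix m :: nat assume m: "1 \<le> m"
    let ?E = "{ereal (p (\<Sum>n\<in>A. seq_scale (\<epsilon> n) (unit_vec n))) | A \<epsilon>.
      finite A \<and> card A \<le> m \<and> (\<forall>n\<in>A. norm (\<epsilon> n) = 1)}"
    have "1 * \<Lambda> (card {..<m}) \<le> CL * qY (restr {..<m} (\<lambda>_. 1))"
      by (intro CL(2) restr_in_Y) (auto simp: restr_apply)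
    also have "\<dots> \<le> (CL + 1) * p (restr {..<m} (\<lambda>_. 1))"
      unfolding c00(2)[OF finite_lessThan]
      by (intro mult_right_mono qY_nonneg restr_in_Y) auto
    finally have le: "1 / (CL + 1) * \<Lambda> m \<le> p (restr {..<m} (\<lambda>_. 1))"
      using CL(1) by (simp add: field_simps)
    have "ereal (p (restr {..<m} (\<lambda>_. 1))) \<in> ?E"
      unfolding restr_eq_sum[OF finite_lessThan]
      by (intro CollectI exI[of _ "{..<m}"] exI[of _ "\<lambda>_. 1"]) auto
    then have "ereal (p (restr {..<m} (\<lambda>_. 1))) \<le> Sup ?E" by (rule Sup_upper)
    then show "ereal (1 / (CL + 1) * \<Lambda> m) \<le> fundamental_function seq_scale p unit_vec m"
      unfolding fundamental_function_def using le by (meson ereal_less_eq(3) order_trans)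
    show "fundamental_function seq_scale p unit_vec m \<le> ereal (CU * \<Lambda> m)"
      unfolding fundamental_function_def
    proof (rule Sup_least, clarify)
      fix A and \<epsilon> :: "nat \<Rightarrow> 'a"
      assume A: "finite A" "card A \<le> m" and \<epsilon>: "\<forall>n\<in>A. norm (\<epsilon> n) = 1"
      have "p (restr A \<epsilon>) \<le> CU * 1 * \<Lambda> m"
        unfolding c00(2)[OF A(1)] using A m \<epsilon> by (intro CU) auto
      then show "ereal (p (\<Sum>n\<in>A. seq_scale (\<epsilon> n) (unit_vec n))) \<le> ereal (CU * \<Lambda> m)"
        by (simp add: restr_eq_sum[OF A(1)] del: seq_scale_apply)
    qed
  qed
qed

end

theorem theorem2p14:
  fixes smul :: "'k::{real_normed_field, banach} \<Rightarrow> 'v::ab_group_add \<Rightarrow> 'v"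
    and X :: "'v set" and qX :: "'v \<Rightarrow> real" and x :: "nat \<Rightarrow> 'v"
    and S :: "(nat \<Rightarrow> 'k) set" and nS :: "(nat \<Rightarrow> 'k) \<Rightarrow> real"
    and \<sigma> :: "nat \<Rightarrow> nat set"
  assumes "quasi_banach_space smul X qX"
    and "schauder_basis smul X qX x"
    and "semi_normalized qX x"
    and "lc_subsymmetric_space S nS"
    and "ordered_partition \<sigma>"
    and "LRP (Lam nS)"
    and "URP (Lam nS)"
    and "\<exists>C. \<forall>r\<ge>1. real (\<Sum>n<r. card (\<sigma> n)) \<le> C * real (card (\<sigma> r))"
  shows "(\<exists>Y qY. seq_completion (Y_qnorm smul qX x nS \<sigma>) Y qY) \<and>
    (\<forall>Y qY. seq_completion (Y_qnorm smul qX x nS \<sigma>) Y qY \<longrightarrow>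
      almost_greedy_basis seq_scale Y qY unit_vec \<and>
      equivalent_to (fundamental_function seq_scale qY unit_vec) (Lam nS))"
proof -
  obtain xs where xs: "schauder_system smul X qX x xs"
    using assms(2) unfolding schauder_basis_def by blast
  have \<sigma>: "blocks \<sigma>" using assms(5) by (rule blocks.intro)
  \<comment> \<open>The estimates involve only \<open>Lam nS\<close> and the block lengths, so their
    constants are available before the combined locale is entered.\<close>
  obtain \<rho> D where "0 < \<rho>" "\<rho> < 1" "1 \<le> D"
      "block_estimates (Lam nS) (\<lambda>n. card (\<sigma> n)) \<rho> D"
    using lc_subsymmetric_space.exists_block_estimates[OF assms(4,6,7) blocks.N_pos[OF \<sigma>] assms(8)]
    by blast
  then interpret greedy_block_basis smul X qX x xs S nS \<sigma> \<rho> D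
    by (intro greedy_block_basis.intro block_basis.intro schauder_space.intro
      schauder_space_axioms.intro block_basis_axioms.intro greedy_block_basis_axioms.intro
      assms xs \<sigma>)
  show ?thesis
    using seq_completion_Y completion_almost_greedy completion_fundamental_function by blast
qed

end
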